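(* The following statement (the Kirman–Sondermann theorem for countable societies) is provable in $\mathsf{RCA}_0$: Suppose $\mathcal{S} = \langle V,X,\mathcal{A},\mathcal{F}\rangle$ is a countable society and $\sigma$ is a social welfare function for $\mathcal{S}$. Then the set $$\mathcal{U}_\sigma = \{ i \in \mathbb{N} : A_i \text{ is } \sigma\text{-decisive} \}$$ exists and is an ultrafilter on $\mathcal{A}$, and $\mathcal{U}_\sigma$ is principal if and only if $\sigma$ is dictatorial.
   Context: We work in second-order arithmetic. $\mathsf{RCA}_0$ is the subsystem with the basic arithmetical axioms (those of Peano arithmetic without induction), the $\Sigma^0_1$-induction scheme and the $\Delta^0_1$ (recursive) comprehension scheme. Finite sets and finite sequences are coded by natural numbers; $\mathrm{lh}(s)$ is the length of a finite sequence $s$. A sequence of sets $\langle Y_i : i \in \mathbb{N}\rangle$ is coded by a set $Y \subseteq \mathbb{N}$ via $(i,v) \in Y \leftrightarrow v \in Y_i$, where $(m,n) = (m+n)^2+m$. Countable algebras: for $V \subseteq \mathbb{N}$, a countable algebra over $V$ is a sequence $\mathcal{A} = \langle A_n : n \in \mathbb{N}\rangle$ of subsets of $V$ (repetitions allowed) which contains $V$ and is closed under unions, intersections, and complements relative to $V$ (i.e. for all $i,j$ there are indices $k$ with $A_k = A_i\cup A_j$, resp. $A_i \cap A_j$, resp. $V\setminus A_i$). Write $A_i^c = V \setminus A_i$. $\mathcal{A}$ is atomic if for every $v \in V$ there is $k$ with $A_k = \{v\}$. Ultrafilters: $\mathcal{U} \subseteq \mathbb{N}$ is an ultrafilter on $\mathcal{A}$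 if for all $i,j,k$: (1) if $A_i = V$ then $i \in \mathcal{U}$; (2) if $A_i = \emptyset$ then $i \notin \mathcal{U}$; (3) if $i \in \mathcal{U}$ and $A_i \subseteq A_j$ then $j \in \mathcal{U}$; (4) if $i,j \in \mathcal{U}$ and $A_k = A_i \cap A_j$ then $k \in \mathcal{U}$; (5) if $A_j = A_i^c$ then $i \in \mathcal{U}$ or $j \in \mathcal{U}$. $\mathcal{U}$ is principal if there exist $k,d$ with $k \in \mathcal{U}$ and $A_k = \{d\}$, and non-principal otherwise. Weak orders and profiles: for a finite nonempty $X \subseteq \mathbb{N}$, a weak order on $X$ is a transitive, strongly connected (for all $x,y$: $(x,y)\in R$ or $(y,x) \in R$) relation $R \subseteq X \times X$; write $x \lesssim_R y$ for $(x,y)\in R$, $x <_R y$ for $(x,y) \in R \wedge (y,x)\notin R$, $x \sim_R y$ for $(x,y)\in R \wedge (y,x) \in R$. $W$ is the finite set of (codes of) weak orders on $X$. A profile over $V,X$ is a function $f: V \to W$. For a sequence $\mathcal{F} = \langle f_i : i\in\mathbb{N}\rangle$ of profiles write $x \lesssim_{i(v)} y$ for $x \lesssim_{f_i(v)} y$ (similarly $<_{i(v)}$, $\sim_{i(v)}$), and for $C \subseteq V$ write $x <_{i[C]} y$ to mean $x <_{i(v)} y$ for all $v \in C$. "$f_i = f_j$ on $\{x,y\}$" means that for all $v \in V$ and all $a,b \in \{x,y\}$, $a \lesssim_{i(v)} b \leftrightarrow a \lesssim_{j(v)} b$; for weak orders $R,R'$, "$R = R'$ on $\{x,y\}$" is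 defined analogously. Uniform measurability: $\mathcal{F}$ is uniformly $\mathcal{A}$-measurable if there is $\mu : \mathbb{N} \times X \times X \to \mathbb{N}$ such that for all $n$, $x,y \in X$, $v \in V$: $x \lesssim_{n(v)} y \leftrightarrow v \in A_{\mu(n,x,y)}$. Quasi-partition embedding: a permutation of $W$ is a finite sequence $p$ such that for every $R \in W$ there is a unique $i$ with $p(i) = R$; $\mathrm{Perm}(W)$ is the set of these. A quasi-partition is a finite sequence $s$ of natural numbers with $\mathrm{lh}(s) \geq 1$; $\mathrm{QPart}(k)$ is the set of quasi-partitions with $\mathrm{lh}(s) \le k$. $\mathcal{A}$ is quasi-partition embedded into $\mathcal{F}$ if there is $e : \mathrm{Perm}(W) \times \mathrm{QPart}(|W|) \to \mathbb{N}$ such that for all $p,s$ and all $v \in V$: $f_{e(p,s)}(v) = p(i)$ if there is a unique $i < \mathrm{lh}(s)-1$ with $v \in A_{s(i)}$, and $f_{e(p,s)}(v) = p(\mathrm{lh}(s)-1)$ otherwise. Countable society: $\mathcal{S} = \langle V,X,\mathcal{A},\mathcal{F}\rangle$ where $V \subseteq \mathbb{N}$ is nonempty, $X \subseteq \mathbb{N}$ is finite with $|X| \ge 3$, $\mathcal{A}$ is an atomic countable algebra over $V$, $\mathcal{F}$ is a sequence of profiles over $V,X$, $\mathcal{F}$ is uniformly $\mathcal{A}$-measurable, and $\mathcal{A}$ is quasi-partition embedded into $\mathcal{F}$. Social welfare functions: $\sigma : \mathbb{N} \to W$ is a social welfare function for $\mathcal{S}$ if (unanimity) for all $x,y \in X$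 and $i$, if $x <_{i[V]} y$ then $x <_{\sigma(i)} y$; and (independence) for all $x,y\in X$ and $i,j$, if $f_i = f_j$ on $\{x,y\}$ then $\sigma(i) = \sigma(j)$ on $\{x,y\}$. $\sigma$ is non-dictatorial if for every $v \in V$ there are $i$ and $x,y \in X$ with $x <_{i(v)} y$ and $y \lesssim_{\sigma(i)} x$; dictatorial otherwise (i.e. there is $d \in V$ such that for all $i$ and $x,y$, $x <_{i(d)} y$ implies $x <_{\sigma(i)} y$). Decisiveness: $A_n$ is $\sigma$-decisive for $x,y$ if for all $i$, $x <_{i[A_n]} y$ implies $x <_{\sigma(i)} y$; $A_n$ is $\sigma$-decisive if it is $\sigma$-decisive for all $x,y \in X$. *)

theory Defs
  imports Main
begin

section \<open>Second-order arithmetic\<close>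

text \<open>
  The language of second-order arithmetic has number terms and two sorts of variables. The
  only set terms are set variables. Both sorts of variables are de Bruijn indices, in separate
  name spaces: \<open>All\<close> binds number variable \<open>0\<close>, and \<open>AllS\<close> binds set variable \<open>0\<close>.
  Logic is classical, so falsum, implication and the two universal quantifiers suffice. Equality
  is primitive for numbers only; equality of sets is extensional equality.
\<close>

datatype tm = Var nat | Zero | One | Add tm tm | Mul tm tm

datatype fm =
    Eq tm tm | Less tm tm | Mem tm nat
  | Fls | Imp fm fm | All fm | AllS fm

definition Neg :: "fm \<Rightarrow> fm" where "Neg p = Imp p Fls"
definition Con :: "fm \<Rightarrow> fm \<Rightarrow> fm" where "Con p q = Neg (Imp p (Neg q))"
definition Dis :: "fm \<Rightarrow> fm \<Rightarrow> fm" where "Dis p q = Imp (Neg p) q"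
definition Iff :: "fm \<Rightarrow> fm \<Rightarrow> fm" where "Iff p q = Con (Imp p q) (Imp q p)"
definition Exi :: "fm \<Rightarrow> fm" where "Exi p = Neg (All (Neg p))"
definition ExiS :: "fm \<Rightarrow> fm" where "ExiS p = Neg (AllS (Neg p))"

text \<open>Simultaneous capture-avoiding substitution of terms for number variables and of set
  variables for set variables.\<close>

primrec sub_tm :: "(nat \<Rightarrow> tm) \<Rightarrow> tm \<Rightarrow> tm" where
  "sub_tm f (Var i) = f i"
| "sub_tm f Zero = Zero"
| "sub_tm f One = One"
| "sub_tm f (Add t u) = Add (sub_tm f t) (sub_tm f u)"
| "sub_tm f (Mul t u) = Mul (sub_tm f t) (sub_tm f u)"

definition lift_tm :: "tm \<Rightarrow> tm" where
  "lift_tm = sub_tm (\<lambda>i. Var (Suc i))"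

primrec sub :: "(nat \<Rightarrow> tm) \<Rightarrow> (nat \<Rightarrow> nat) \<Rightarrow> fm \<Rightarrow> fm" where
  "sub f g (Eq t u) = Eq (sub_tm f t) (sub_tm f u)"
| "sub f g (Less t u) = Less (sub_tm f t) (sub_tm f u)"
| "sub f g (Mem t X) = Mem (sub_tm f t) (g X)"
| "sub f g Fls = Fls"
| "sub f g (Imp p q) = Imp (sub f g p) (sub f g q)"
| "sub f g (All p) = All (sub (case_nat (Var 0) (\<lambda>i. lift_tm (f i))) g p)"
| "sub f g (AllS p) = AllS (sub f (case_nat 0 (\<lambda>i. Suc (g i))) p)"

definition lift :: "fm \<Rightarrow> fm" where "lift = sub (\<lambda>i. Var (Suc i)) id"
definition liftS :: "fm \<Rightarrow> fm" where "liftS = sub Var Suc"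
definition inst :: "fm \<Rightarrow> tm \<Rightarrow> fm" where "inst p t = sub (case_nat t Var) id p"
definition instS :: "fm \<Rightarrow> nat \<Rightarrow> fm" where "instS p X = sub Var (case_nat X id) p"

text \<open>
  Classical natural deduction for two-sorted predicate logic with equality. An axiom from \<open>T\<close>
  may have free variables and then stands for its universal closure: rule \<open>Ax\<close> may be followed
  by generalisation over any of its variables. Free variables of hypotheses in \<open>H\<close> are fixed.
\<close>

inductive deriv :: "fm set \<Rightarrow> fm set \<Rightarrow> fm \<Rightarrow> bool" for T :: "fm set" where
  Ax: "p \<in> T \<Longrightarrow> deriv T H p"
| Hyp: "p \<in> H \<Longrightarrow> deriv T H p"
| ImpI: "deriv T (insert p H) q \<Longrightarrow> deriv T H (Imp p q)"
| ImpE: "deriv T H (Imp p q) \<Longrightarrow> deriv T H p \<Longrightarrow> deriv T H q"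
| Class: "deriv T (insert (Neg p) H) Fls \<Longrightarrow> deriv T H p"
| AllI: "deriv T (lift ` H) p \<Longrightarrow> deriv T H (All p)"
| AllE: "deriv T H (All p) \<Longrightarrow> deriv T H (inst p t)"
| AllSI: "deriv T (liftS ` H) p \<Longrightarrow> deriv T H (AllS p)"
| AllSE: "deriv T H (AllS p) \<Longrightarrow> deriv T H (instS p X)"
| EqI: "deriv T H (Eq t t)"
| EqE: "deriv T H (Eq t u) \<Longrightarrow> deriv T H (inst p t) \<Longrightarrow> deriv T H (inst p u)"

definition provable :: "fm set \<Rightarrow> fm \<Rightarrow> bool" (infix "\<turnstile>" 50) where
  "T \<turnstile> p \<longleftrightarrow> deriv T {} p"

section \<open>The system RCA0\<close>

text \<open>In a bounded quantifier the bounding term must not mention the bound variable; this is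
  ensured by \<open>lift_tm\<close>. Bounded existential quantifiers arise by negation.\<close>

inductive Delta0 :: "fm \<Rightarrow> bool" where
  "Delta0 (Eq t u)"
| "Delta0 (Less t u)"
| "Delta0 (Mem t X)"
| "Delta0 Fls"
| "Delta0 p \<Longrightarrow> Delta0 q \<Longrightarrow> Delta0 (Imp p q)"
| "Delta0 p \<Longrightarrow> Delta0 (All (Imp (Less (Var 0) (lift_tm t)) p))"

inductive Sigma1 :: "fm \<Rightarrow> bool" where
  "Delta0 p \<Longrightarrow> Sigma1 (Exi p)"

inductive Pi1 :: "fm \<Rightarrow> bool" where
  "Delta0 p \<Longrightarrow> Pi1 (All p)"

definition basic_axioms :: "fm set" where
  "basic_axioms =
    (let m = Var 0; n = Var 1 in
     { Neg (Eq (Add n One) Zero),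
       Imp (Eq (Add m One) (Add n One)) (Eq m n),
       Eq (Add m Zero) m,
       Eq (Add m (Add n One)) (Add (Add m n) One),
       Eq (Mul m Zero) Zero,
       Eq (Mul m (Add n One)) (Add (Mul m n) m),
       Neg (Less m Zero),
       Iff (Less m (Add n One)) (Dis (Less m n) (Eq m n)) })"

text \<open>In the two schemes, number variable \<open>0\<close> of \<open>p\<close> (and \<open>q\<close>) is the distinguished one;
  all other free variables, of both sorts, are parameters.\<close>

definition induction_axiom :: "fm \<Rightarrow> fm" where
  "induction_axiom p =
     Imp (Con (inst p Zero)
              (All (Imp p (sub (case_nat (Add (Var 0) One) (\<lambda>i. Var (Suc i))) id p))))
         (All p)"

definition comprehension_axiom :: "fm \<Rightarrow> fm \<Rightarrow> fm" where
  "comprehension_axiom p q =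
     Imp (All (Iff p q)) (ExiS (All (Iff (Mem (Var 0) 0) (liftS p))))"

definition RCA0 :: "fm set" where
  "RCA0 = basic_axioms
     \<union> {induction_axiom p | p. Sigma1 p}
     \<union> {comprehension_axiom p q | p q. Sigma1 p \<and> Pi1 q}"

section \<open>Notation for formulas with named bound variables\<close>

text \<open>
  To write large formulas legibly, we build them as functions of the numbers \<open>n\<close> and \<open>s\<close> of
  enclosing number and set quantifiers. A bound variable is represented by the level \<open>l\<close> of its
  quantifier, which at depth \<open>n\<close> is the de Bruijn index \<open>n - Suc l\<close>. Hence a term may be passed
  unchanged under further quantifiers, and HOL's own binding takes care of variable capture.
  A formula without free variables is closed off by evaluating it at depth \<open>0\<close>.
\<close>

type_synonym num = "nat \<Rightarrow> tm"
type_synonym svar = "nat \<Rightarrow> nat"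
type_synonym form = "nat \<Rightarrow> nat \<Rightarrow> fm"

definition sentence :: "form \<Rightarrow> fm" where "sentence P = P 0 0"

definition zero :: num ("\<^bold>0") where "\<^bold>0 = (\<lambda>n. Zero)"
definition one :: num ("\<^bold>1") where "\<^bold>1 = (\<lambda>n. One)"
definition add :: "num \<Rightarrow> num \<Rightarrow> num" (infixl "\<^bold>+" 65) where
  "t \<^bold>+ u = (\<lambda>n. Add (t n) (u n))"
definition mul :: "num \<Rightarrow> num \<Rightarrow> num" (infixl "\<^bold>*" 70) where
  "t \<^bold>* u = (\<lambda>n. Mul (t n) (u n))"

definition eq :: "num \<Rightarrow> num \<Rightarrow> form" (infix "\<^bold>=" 50) where
  "(t \<^bold>= u) = (\<lambda>n s. Eq (t n) (u n))"
definition less :: "num \<Rightarrow> num \<Rightarrow> form" (infix "\<^bold><" 50) where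
  "(t \<^bold>< u) = (\<lambda>n s. Less (t n) (u n))"
definition mem :: "num \<Rightarrow> svar \<Rightarrow> form" (infix "\<^bold>\<in>" 50) where
  "(t \<^bold>\<in> X) = (\<lambda>n s. Mem (t n) (X s))"

definition fls :: form ("\<^bold>\<bottom>") where "\<^bold>\<bottom> = (\<lambda>n s. Fls)"
definition neg :: "form \<Rightarrow> form" ("\<^bold>\<not> _" [40] 40) where
  "(\<^bold>\<not> P) = (\<lambda>n s. Neg (P n s))"
definition con :: "form \<Rightarrow> form \<Rightarrow> form" (infixr "\<^bold>\<and>" 35) where
  "(P \<^bold>\<and> Q) = (\<lambda>n s. Con (P n s) (Q n s))"
definition dis :: "form \<Rightarrow> form \<Rightarrow> form" (infixr "\<^bold>\<or>" 30) where
  "(P \<^bold>\<or> Q) = (\<lambda>n s. Dis (P n s) (Q n s))"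
definition imp :: "form \<Rightarrow> form \<Rightarrow> form" (infixr "\<^bold>\<longrightarrow>" 25) where
  "(P \<^bold>\<longrightarrow> Q) = (\<lambda>n s. Imp (P n s) (Q n s))"
definition iff :: "form \<Rightarrow> form \<Rightarrow> form" (infixr "\<^bold>\<longleftrightarrow>" 25) where
  "(P \<^bold>\<longleftrightarrow> Q) = (\<lambda>n s. Iff (P n s) (Q n s))"

definition all :: "(num \<Rightarrow> form) \<Rightarrow> form" (binder "\<^bold>\<forall>" 10) where
  "all P = (\<lambda>n s. All (P (\<lambda>n'. Var (n' - Suc n)) (Suc n) s))"
definition exi :: "(num \<Rightarrow> form) \<Rightarrow> form" (binder "\<^bold>\<exists>" 10) where
  "exi P = (\<lambda>n s. Exi (P (\<lambda>n'. Var (n' - Suc n)) (Suc n) s))"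
definition allS :: "(svar \<Rightarrow> form) \<Rightarrow> form" (binder "\<^bold>\<forall>\<^sub>S" 10) where
  "allS P = (\<lambda>n s. AllS (P (\<lambda>s'. s' - Suc s) n (Suc s)))"
definition exiS :: "(svar \<Rightarrow> form) \<Rightarrow> form" (binder "\<^bold>\<exists>\<^sub>S" 10) where
  "exiS P = (\<lambda>n s. ExiS (P (\<lambda>s'. s' - Suc s) n (Suc s)))"

lemma sentence_example:
  "sentence (\<^bold>\<forall>\<^sub>S X. \<^bold>\<forall>x. x \<^bold>\<in> X \<^bold>\<longrightarrow> (\<^bold>\<forall>\<^sub>S Y. \<^bold>\<forall>y. y \<^bold>< x \<^bold>\<longrightarrow> x \<^bold>\<in> Y \<^bold>\<longrightarrow> y \<^bold>\<in> X)) =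
   AllS (All (Imp (Mem (Var 0) 0)
     (AllS (All (Imp (Less (Var 0) (Var 1)) (Imp (Mem (Var 1) 0) (Mem (Var 0) 1)))))))"
  by (simp add: sentence_def all_def allS_def imp_def mem_def less_def)

definition ex1 :: "(num \<Rightarrow> form) \<Rightarrow> form" (binder "\<^bold>\<exists>\<^bold>!" 10) where
  "ex1 P = (\<^bold>\<exists>x. P x \<^bold>\<and> (\<^bold>\<forall>y. P y \<^bold>\<longrightarrow> y \<^bold>= x))"

definition leq :: "num \<Rightarrow> num \<Rightarrow> form" (infix "\<^bold>\<le>" 50) where
  "(t \<^bold>\<le> u) = (t \<^bold>< u \<^bold>\<or> t \<^bold>= u)"

section \<open>Pairs, functions, finite sets and finite sequences\<close>

definition pair :: "num \<Rightarrow> num \<Rightarrow> num" ("\<^bold>\<langle>_,/ _\<^bold>\<rangle>") where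
  "\<^bold>\<langle>t, u\<^bold>\<rangle> = (t \<^bold>+ u) \<^bold>* (t \<^bold>+ u) \<^bold>+ t"

text \<open>Definable classes of numbers are treated as their membership formulas.\<close>

type_synonym cls = "num \<Rightarrow> form"

definition elts :: "svar \<Rightarrow> cls" where "elts X = (\<lambda>x. x \<^bold>\<in> X)"
definition naturals :: cls where "naturals = (\<lambda>x. x \<^bold>= x)"
definition section_of :: "svar \<Rightarrow> num \<Rightarrow> cls" where
  "section_of Y i = (\<lambda>x. \<^bold>\<langle>i, x\<^bold>\<rangle> \<^bold>\<in> Y)"
definition cprod :: "cls \<Rightarrow> cls \<Rightarrow> cls" where
  "cprod C D = (\<lambda>z. \<^bold>\<exists>x y. C x \<^bold>\<and> D y \<^bold>\<and> z \<^bold>= \<^bold>\<langle>x, y\<^bold>\<rangle>)"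

text \<open>\<open>G\<close> is (the graph of) a function from \<open>C\<close> to \<open>D\<close>.\<close>

definition is_fun :: "cls \<Rightarrow> cls \<Rightarrow> cls \<Rightarrow> form" where
  "is_fun G C D =
     ((\<^bold>\<forall>z. G z \<^bold>\<longrightarrow> cprod C D z) \<^bold>\<and>
      (\<^bold>\<forall>x y y'. G \<^bold>\<langle>x, y\<^bold>\<rangle> \<^bold>\<and> G \<^bold>\<langle>x, y'\<^bold>\<rangle> \<^bold>\<longrightarrow> y \<^bold>= y') \<^bold>\<and>
      (\<^bold>\<forall>x. C x \<^bold>\<longrightarrow> (\<^bold>\<exists>y. D y \<^bold>\<and> G \<^bold>\<langle>x, y\<^bold>\<rangle>)))"

text \<open>
  Finite sets are coded as in Simpson's \<open>Subsystems of Second Order Arithmetic\<close>, by a variant of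
  Goedel's beta function: \<open>(k, (m, n))\<close> represents the set of all \<open>i < k\<close> such that
  \<open>m (i + 1) + 1\<close> divides \<open>n\<close>. The code of a finite set is the least number representing it.
\<close>

definition in_code :: "num \<Rightarrow> num \<Rightarrow> form" where
  "in_code i c = (\<^bold>\<exists>k m n. c \<^bold>= \<^bold>\<langle>k, \<^bold>\<langle>m, n\<^bold>\<rangle>\<^bold>\<rangle> \<^bold>\<and> i \<^bold>< k \<^bold>\<and>
     (\<^bold>\<exists>q. n \<^bold>= (m \<^bold>* (i \<^bold>+ \<^bold>1) \<^bold>+ \<^bold>1) \<^bold>* q))"

definition represents_set :: "num \<Rightarrow> form" where
  "represents_set c = (\<^bold>\<exists>k m n. c \<^bold>= \<^bold>\<langle>k, \<^bold>\<langle>m, n\<^bold>\<rangle>\<^bold>\<rangle>)"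

definition set_code :: "num \<Rightarrow> form" where
  "set_code c = (represents_set c \<^bold>\<and>
     (\<^bold>\<forall>d. d \<^bold>< c \<^bold>\<and> represents_set d \<^bold>\<longrightarrow> \<^bold>\<not> (\<^bold>\<forall>i. in_code i d \<^bold>\<longleftrightarrow> in_code i c)))"

text \<open>A finite sequence is (the code of) a finite function with domain \<open>{i. i < l}\<close>, where \<open>l\<close>
  is its length.\<close>

definition seq_at :: "num \<Rightarrow> num \<Rightarrow> num \<Rightarrow> form" where
  "seq_at s i a = in_code \<^bold>\<langle>i, a\<^bold>\<rangle> s"

definition seq_of_length :: "num \<Rightarrow> num \<Rightarrow> form" where
  "seq_of_length s l = (set_code s \<^bold>\<and> is_fun (\<lambda>z. in_code z s) (\<lambda>i. i \<^bold>< l) naturals)"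

text \<open>\<open>s\<close> enumerates the class \<open>C\<close> without repetitions.\<close>

definition enumerates :: "num \<Rightarrow> cls \<Rightarrow> form" where
  "enumerates s C =
     ((\<^bold>\<exists>l. seq_of_length s l) \<^bold>\<and>
      (\<^bold>\<forall>i a. seq_at s i a \<^bold>\<longrightarrow> C a) \<^bold>\<and>
      (\<^bold>\<forall>a. C a \<^bold>\<longrightarrow> (\<^bold>\<exists>\<^bold>!i. seq_at s i a)))"

definition has_card :: "cls \<Rightarrow> num \<Rightarrow> form" where
  "has_card C k = (\<^bold>\<exists>s. seq_of_length s k \<^bold>\<and> enumerates s C)"

definition finite_set :: "svar \<Rightarrow> form" where
  "finite_set X = (\<^bold>\<exists>b. \<^bold>\<forall>x. x \<^bold>\<in> X \<^bold>\<longrightarrow> x \<^bold>< b)"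

section \<open>Countable algebras and ultrafilters\<close>

text \<open>A sequence of sets \<open>A\<close> is coded by a single set; its \<open>i\<close>-th member is
  \<open>section_of A i\<close>.\<close>

definition countable_algebra :: "svar \<Rightarrow> svar \<Rightarrow> form" where
  "countable_algebra V A =
     ((\<^bold>\<forall>i v. section_of A i v \<^bold>\<longrightarrow> v \<^bold>\<in> V) \<^bold>\<and>
      (\<^bold>\<exists>k. \<^bold>\<forall>v. section_of A k v \<^bold>\<longleftrightarrow> v \<^bold>\<in> V) \<^bold>\<and>
      (\<^bold>\<forall>i j. \<^bold>\<exists>k. \<^bold>\<forall>v. section_of A k v \<^bold>\<longleftrightarrow> section_of A i v \<^bold>\<or> section_of A j v) \<^bold>\<and>
      (\<^bold>\<forall>i j. \<^bold>\<exists>k. \<^bold>\<forall>v. section_of A k v \<^bold>\<longleftrightarrow> section_of A i v \<^bold>\<and> section_of A j v) \<^bold>\<and>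
      (\<^bold>\<forall>i. \<^bold>\<exists>k. \<^bold>\<forall>v. section_of A k v \<^bold>\<longleftrightarrow> v \<^bold>\<in> V \<^bold>\<and> \<^bold>\<not> section_of A i v))"

definition atomic :: "svar \<Rightarrow> svar \<Rightarrow> form" where
  "atomic V A = (\<^bold>\<forall>v. v \<^bold>\<in> V \<^bold>\<longrightarrow> (\<^bold>\<exists>k. \<^bold>\<forall>w. section_of A k w \<^bold>\<longleftrightarrow> w \<^bold>= v))"

definition ultrafilter :: "svar \<Rightarrow> svar \<Rightarrow> svar \<Rightarrow> form" where
  "ultrafilter V A U =
     ((\<^bold>\<forall>i. (\<^bold>\<forall>v. section_of A i v \<^bold>\<longleftrightarrow> v \<^bold>\<in> V) \<^bold>\<longrightarrow> i \<^bold>\<in> U) \<^bold>\<and>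
      (\<^bold>\<forall>i. (\<^bold>\<forall>v. \<^bold>\<not> section_of A i v) \<^bold>\<longrightarrow> \<^bold>\<not> i \<^bold>\<in> U) \<^bold>\<and>
      (\<^bold>\<forall>i j. i \<^bold>\<in> U \<^bold>\<and> (\<^bold>\<forall>v. section_of A i v \<^bold>\<longrightarrow> section_of A j v) \<^bold>\<longrightarrow> j \<^bold>\<in> U) \<^bold>\<and>
      (\<^bold>\<forall>i j k. i \<^bold>\<in> U \<^bold>\<and> j \<^bold>\<in> U \<^bold>\<and>
         (\<^bold>\<forall>v. section_of A k v \<^bold>\<longleftrightarrow> section_of A i v \<^bold>\<and> section_of A j v) \<^bold>\<longrightarrow> k \<^bold>\<in> U) \<^bold>\<and>
      (\<^bold>\<forall>i j. (\<^bold>\<forall>v. section_of A j v \<^bold>\<longleftrightarrow> v \<^bold>\<in> V \<^bold>\<and> \<^bold>\<not> section_of A i v) \<^bold>\<longrightarrow>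
         i \<^bold>\<in> U \<^bold>\<or> j \<^bold>\<in> U))"

definition is_principal :: "svar \<Rightarrow> svar \<Rightarrow> form" where
  "is_principal A U = (\<^bold>\<exists>k d. k \<^bold>\<in> U \<^bold>\<and> (\<^bold>\<forall>v. section_of A k v \<^bold>\<longleftrightarrow> v \<^bold>= d))"

section \<open>Weak orders and profiles\<close>

type_synonym rel = "num \<Rightarrow> num \<Rightarrow> form"

definition rel_of_code :: "num \<Rightarrow> rel" where
  "rel_of_code r = (\<lambda>x y. in_code \<^bold>\<langle>x, y\<^bold>\<rangle> r)"

definition strict :: "rel \<Rightarrow> rel" where
  "strict R = (\<lambda>x y. R x y \<^bold>\<and> \<^bold>\<not> R y x)"

text \<open>The class \<open>W\<close> of codes of weak orders on \<open>X\<close>.\<close>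

definition weak_order :: "svar \<Rightarrow> cls" where
  "weak_order X = (\<lambda>r.
     set_code r \<^bold>\<and>
     (\<^bold>\<forall>z. in_code z r \<^bold>\<longrightarrow> cprod (elts X) (elts X) z) \<^bold>\<and>
     (\<^bold>\<forall>x y z. rel_of_code r x y \<^bold>\<and> rel_of_code r y z \<^bold>\<longrightarrow> rel_of_code r x z) \<^bold>\<and>
     (\<^bold>\<forall>x y. x \<^bold>\<in> X \<^bold>\<and> y \<^bold>\<in> X \<^bold>\<longrightarrow> rel_of_code r x y \<^bold>\<or> rel_of_code r y x))"

text \<open>A sequence \<open>F\<close> of profiles is a sequence of sets, each the graph of a function from \<open>V\<close>
  to \<open>W\<close>.\<close>

definition profiles :: "svar \<Rightarrow> svar \<Rightarrow> svar \<Rightarrow> form" where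
  "profiles V X F = (\<^bold>\<forall>i. is_fun (section_of F i) (elts V) (weak_order X))"

definition profile_value :: "svar \<Rightarrow> num \<Rightarrow> num \<Rightarrow> num \<Rightarrow> form" where
  "profile_value F i v r = section_of F i \<^bold>\<langle>v, r\<^bold>\<rangle>"

definition pref :: "svar \<Rightarrow> num \<Rightarrow> num \<Rightarrow> rel" where
  "pref F i v = (\<lambda>x y. \<^bold>\<exists>r. profile_value F i v r \<^bold>\<and> rel_of_code r x y)"

definition strict_pref_on :: "svar \<Rightarrow> num \<Rightarrow> cls \<Rightarrow> rel" where
  "strict_pref_on F i C = (\<lambda>x y. \<^bold>\<forall>v. C v \<^bold>\<longrightarrow> strict (pref F i v) x y)"

definition agree :: "rel \<Rightarrow> rel \<Rightarrow> num \<Rightarrow> num \<Rightarrow> form" where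
  "agree R R' x y =
     (\<^bold>\<forall>a b. (a \<^bold>= x \<^bold>\<or> a \<^bold>= y) \<^bold>\<and> (b \<^bold>= x \<^bold>\<or> b \<^bold>= y) \<^bold>\<longrightarrow> (R a b \<^bold>\<longleftrightarrow> R' a b))"

section \<open>Countable societies\<close>

definition uniformly_measurable :: "svar \<Rightarrow> svar \<Rightarrow> svar \<Rightarrow> svar \<Rightarrow> form" where
  "uniformly_measurable V X A F =
     (\<^bold>\<exists>\<^sub>S \<mu>. is_fun (elts \<mu>) (cprod naturals (cprod (elts X) (elts X))) naturals \<^bold>\<and>
        (\<^bold>\<forall>n x y v. x \<^bold>\<in> X \<^bold>\<and> y \<^bold>\<in> X \<^bold>\<and> v \<^bold>\<in> V \<^bold>\<longrightarrow>
           (pref F n v x y \<^bold>\<longleftrightarrow>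
            (\<^bold>\<exists>k. \<^bold>\<langle>\<^bold>\<langle>n, \<^bold>\<langle>x, y\<^bold>\<rangle>\<^bold>\<rangle>, k\<^bold>\<rangle> \<^bold>\<in> \<mu> \<^bold>\<and> section_of A k v))))"

text \<open>Permutations of \<open>W\<close> take values in \<open>W\<close> only.\<close>

definition perm_W :: "svar \<Rightarrow> cls" where
  "perm_W X = (\<lambda>p. enumerates p (weak_order X))"

definition qpart_W :: "svar \<Rightarrow> cls" where
  "qpart_W X = (\<lambda>s. \<^bold>\<exists>l k. seq_of_length s l \<^bold>\<and> has_card (weak_order X) k \<^bold>\<and> \<^bold>1 \<^bold>\<le> l \<^bold>\<and> l \<^bold>\<le> k)"

text \<open>Since \<open>lh(s) \<ge> 1\<close>, we write \<open>lh(s) = l + 1\<close>, so that \<open>l = lh(s) - 1\<close>.\<close>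

definition quasi_partition_embedded :: "svar \<Rightarrow> svar \<Rightarrow> svar \<Rightarrow> svar \<Rightarrow> form" where
  "quasi_partition_embedded V X A F =
     (\<^bold>\<exists>\<^sub>S e. is_fun (elts e) (cprod (perm_W X) (qpart_W X)) naturals \<^bold>\<and>
        (\<^bold>\<forall>p s n l v.
           \<^bold>\<langle>\<^bold>\<langle>p, s\<^bold>\<rangle>, n\<^bold>\<rangle> \<^bold>\<in> e \<^bold>\<and> seq_of_length s (l \<^bold>+ \<^bold>1) \<^bold>\<and> v \<^bold>\<in> V \<^bold>\<longrightarrow>
           (let selects = (\<lambda>i. i \<^bold>< l \<^bold>\<and> (\<^bold>\<exists>a. seq_at s i a \<^bold>\<and> section_of A a v)) in
             (\<^bold>\<forall>i. selects i \<^bold>\<and> (\<^bold>\<forall>j. selects j \<^bold>\<longrightarrow> j \<^bold>= i) \<^bold>\<longrightarrow>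
                (\<^bold>\<exists>r. seq_at p i r \<^bold>\<and> profile_value F n v r)) \<^bold>\<and>
             (\<^bold>\<not> (\<^bold>\<exists>\<^bold>!i. selects i) \<^bold>\<longrightarrow>
                (\<^bold>\<exists>r. seq_at p l r \<^bold>\<and> profile_value F n v r)))))"

definition countable_society :: "svar \<Rightarrow> svar \<Rightarrow> svar \<Rightarrow> svar \<Rightarrow> form" where
  "countable_society V X A F =
     ((\<^bold>\<exists>v. v \<^bold>\<in> V) \<^bold>\<and>
      finite_set X \<^bold>\<and> (\<^bold>\<exists>k. has_card (elts X) k \<^bold>\<and> \<^bold>1 \<^bold>+ \<^bold>1 \<^bold>+ \<^bold>1 \<^bold>\<le> k) \<^bold>\<and>
      countable_algebra V A \<^bold>\<and> atomic V A \<^bold>\<and>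
      profiles V X F \<^bold>\<and>
      uniformly_measurable V X A F \<^bold>\<and>
      quasi_partition_embedded V X A F)"

section \<open>Social welfare functions\<close>

definition social_pref :: "svar \<Rightarrow> num \<Rightarrow> rel" where
  "social_pref \<sigma> i = (\<lambda>x y. \<^bold>\<exists>r. \<^bold>\<langle>i, r\<^bold>\<rangle> \<^bold>\<in> \<sigma> \<^bold>\<and> rel_of_code r x y)"

definition unanimity :: "svar \<Rightarrow> svar \<Rightarrow> svar \<Rightarrow> svar \<Rightarrow> form" where
  "unanimity V X F \<sigma> =
     (\<^bold>\<forall>x y i. x \<^bold>\<in> X \<^bold>\<and> y \<^bold>\<in> X \<^bold>\<longrightarrow>
        strict_pref_on F i (elts V) x y \<^bold>\<longrightarrow> strict (social_pref \<sigma> i) x y)"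

definition independence :: "svar \<Rightarrow> svar \<Rightarrow> svar \<Rightarrow> svar \<Rightarrow> form" where
  "independence V X F \<sigma> =
     (\<^bold>\<forall>x y i j. x \<^bold>\<in> X \<^bold>\<and> y \<^bold>\<in> X \<^bold>\<longrightarrow>
        (\<^bold>\<forall>v. v \<^bold>\<in> V \<^bold>\<longrightarrow> agree (pref F i v) (pref F j v) x y) \<^bold>\<longrightarrow>
        agree (social_pref \<sigma> i) (social_pref \<sigma> j) x y)"

definition social_welfare_function :: "svar \<Rightarrow> svar \<Rightarrow> svar \<Rightarrow> svar \<Rightarrow> form" where
  "social_welfare_function V X F \<sigma> =
     (is_fun (elts \<sigma>) naturals (weak_order X) \<^bold>\<and> unanimity V X F \<sigma> \<^bold>\<and> independence V X F \<sigma>)"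

definition non_dictatorial :: "svar \<Rightarrow> svar \<Rightarrow> svar \<Rightarrow> svar \<Rightarrow> form" where
  "non_dictatorial V X F \<sigma> =
     (\<^bold>\<forall>v. v \<^bold>\<in> V \<^bold>\<longrightarrow>
        (\<^bold>\<exists>i x y. x \<^bold>\<in> X \<^bold>\<and> y \<^bold>\<in> X \<^bold>\<and> strict (pref F i v) x y \<^bold>\<and> social_pref \<sigma> i y x))"

definition dictatorial :: "svar \<Rightarrow> svar \<Rightarrow> svar \<Rightarrow> svar \<Rightarrow> form" where
  "dictatorial V X F \<sigma> = (\<^bold>\<not> non_dictatorial V X F \<sigma>)"

definition decisive_for :: "svar \<Rightarrow> svar \<Rightarrow> svar \<Rightarrow> num \<Rightarrow> num \<Rightarrow> num \<Rightarrow> form" where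
  "decisive_for A F \<sigma> n x y =
     (\<^bold>\<forall>i. strict_pref_on F i (section_of A n) x y \<^bold>\<longrightarrow> strict (social_pref \<sigma> i) x y)"

definition decisive :: "svar \<Rightarrow> svar \<Rightarrow> svar \<Rightarrow> svar \<Rightarrow> num \<Rightarrow> form" where
  "decisive X A F \<sigma> n = (\<^bold>\<forall>x y. x \<^bold>\<in> X \<^bold>\<and> y \<^bold>\<in> X \<^bold>\<longrightarrow> decisive_for A F \<sigma> n x y)"

end

(*
  By a Henkin construction, a sentence that holds in all models of RCA0 with countable first and
  second order parts is derivable, so it suffices to argue inside an arbitrary model. There the
  ultrafilter exists by recursive comprehension: a set in the algebra is decisive as soon as it can
  force a single strict preference x < y against unanimous opposition, and whether it does so is
  read off from the social order at one profile, which the quasi-partition embedding computes from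
  the index of the set. Kirman and Sondermann's argument then only needs profiles taking four
  values. Since the set of alternatives may be nonstandard, the embedding applies only after the
  class of weak orders has been shown to have a permutation with prescribed initial values; this
  follows from a bound on the codes of all subsets of a finite set and Sigma^0_1 induction.
*)
theory Submission
  imports Defs "HOL-Library.Countable_Set"
begin

text \<open>Decisiveness quantifies over all profiles and all voters, so it is not visibly
  recursive. Forcing one strict preference at one profile is, provided that this profile is computed
  uniformly: the permutation of weak orders is fixed once, as a parameter, and only the
  quasi-partition varies with the index of the set. The number four comes from field expansion.
  Outside the given set an arbitrary ranking of two alternatives must be reproduced, and weak orders
  leave three possibilities there: either strict order, or a tie. The set itself is the fourth
  region. A permutation does not repeat values, so the four orders must be pairwise distinct;
  profiles with fewer values are padded with orders assigned to the empty set. Instead of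
  written-out formulas, predicates on a model carry a certificate \<open>d0\<close> of definability
  by a bounded formula with parameters. Induction and comprehension ask for such certificates only;
  unbounded codes are put below one further number, so that a single unbounded quantifier
  remains.\<close>

instance tm :: countable by countable_datatype
instance fm :: countable by countable_datatype

section \<open>Substitution\<close>

abbreviation up :: "(nat \<Rightarrow> tm) \<Rightarrow> nat \<Rightarrow> tm" where
  "up f \<equiv> case_nat (Var 0) (\<lambda>i. lift_tm (f i))"

abbreviation upS :: "(nat \<Rightarrow> nat) \<Rightarrow> nat \<Rightarrow> nat" where
  "upS g \<equiv> case_nat 0 (\<lambda>i. Suc (g i))"

lemma sub_tm_sub_tm: "sub_tm f (sub_tm g t) = sub_tm (\<lambda>i. sub_tm f (g i)) t"
  by (induction t) auto

lemma sub_tm_Var [simp]: "sub_tm Var t = t"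
  by (induction t) auto

lemma sub_tm_up_lift: "sub_tm (up f) (lift_tm t) = lift_tm (sub_tm f t)"
  by (simp add: lift_tm_def sub_tm_sub_tm)

lemma sub_tm_case_lift: "sub_tm (case_nat t f) (lift_tm u) = sub_tm f u"
  by (simp add: lift_tm_def sub_tm_sub_tm)

lemma up_Var [simp]: "up Var = Var"
  by (auto simp: lift_tm_def split: nat.splits)

lemma upS_id [simp]: "upS (\<lambda>x. x) = (\<lambda>x. x)" "upS id = (\<lambda>x. x)"
  by (auto split: nat.splits)

lemma up_comp: "(\<lambda>i. sub_tm (up f) (up f' i)) = up (\<lambda>i. sub_tm f (f' i))"
  by (auto simp: sub_tm_up_lift split: nat.splits)

lemma upS_comp: "(\<lambda>i. upS g (upS g' i)) = upS (\<lambda>i. g (g' i))"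
  by (auto split: nat.splits)

text \<open>\<open>lift\<close>, \<open>liftS\<close>, \<open>inst\<close> and \<open>instS\<close>
  are all instances of \<open>sub\<close>, so the commutation laws needed by the quantifier rules
  reduce to this one composition law.\<close>

lemma sub_sub: "sub f g (sub f' g' p) = sub (\<lambda>i. sub_tm f (f' i)) (\<lambda>i. g (g' i)) p"
  by (induction p arbitrary: f g f' g') (simp_all add: sub_tm_sub_tm up_comp upS_comp)

lemma sub_Var_id [simp]: "sub Var (\<lambda>x. x) p = p" "sub Var id p = p"
proof -
  show *: "sub Var (\<lambda>x. x) p = p"
    by (induction p) simp_all
  then show "sub Var id p = p"
    by (simp add: id_def)
qed

lemma sub_up_lift: "sub (up f) g (lift p) = lift (sub f g p)"
  by (simp add: lift_def sub_sub lift_tm_def[symmetric])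

lemma sub_upS_liftS: "sub f (upS g) (liftS p) = liftS (sub f g p)"
  by (simp add: liftS_def sub_sub)

lemma inst_sub: "inst (sub (up f) g p) t = sub (case_nat t f) g p"
proof -
  have "(\<lambda>i. sub_tm (case_nat t Var) (up f i)) = case_nat t f"
    by (auto simp: sub_tm_case_lift split: nat.splits)
  then show ?thesis
    by (simp add: inst_def sub_sub)
qed

lemma instS_sub: "instS (sub f (upS g) p) X = sub f (case_nat X g) p"
proof -
  have "(\<lambda>i. case_nat X id (upS g i)) = case_nat X g"
    by (auto split: nat.splits)
  then show ?thesis
    by (simp add: instS_def sub_sub)
qed

lemma sub_inst: "sub f g (inst p t) = inst (sub (up f) g p) (sub_tm f t)"
proof -
  have "(\<lambda>i. sub_tm f (case_nat t Var i)) = case_nat (sub_tm f t) f"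
    by (auto split: nat.splits)
  then show ?thesis
    by (simp add: inst_sub) (simp add: inst_def sub_sub)
qed

lemma sub_instS: "sub f g (instS p X) = instS (sub f (upS g) p) (g X)"
proof -
  have "(\<lambda>i. g (case_nat X id i)) = case_nat (g X) g"
    by (auto split: nat.splits)
  then show ?thesis
    by (simp add: instS_sub) (simp add: instS_def sub_sub)
qed

text \<open>Finiteness of the set of free variables, stated without defining that set: substitution
  only depends on the first \<open>n\<close> variables of either sort.\<close>

definition support_below :: "nat \<Rightarrow> fm \<Rightarrow> bool" where
  "support_below n p \<longleftrightarrow>
     (\<forall>f f' g g'. (\<forall>i<n. f i = f' i \<and> g i = g' i) \<longrightarrow> sub f g p = sub f' g' p)"

lemma support_belowD:
  "support_below n p \<Longrightarrow> (\<And>i. i < n \<Longrightarrow> f i = f' i \<and> g i = g' i) \<Longrightarrow> sub f g p = sub f' g' p"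
  unfolding support_below_def by blast

lemma support_below_mono: "support_below n p \<Longrightarrow> n \<le> m \<Longrightarrow> support_below m p"
  unfolding support_below_def by (meson less_le_trans)

lemma support_tm: "\<exists>n. \<forall>f f'. (\<forall>i<n. f i = f' i) \<longrightarrow> sub_tm f t = sub_tm f' t"
proof (induction t)
  case (Var x)
  then show ?case by (auto intro!: exI[of _ "Suc x"])
next
  case (Add t u)
  then obtain n m where
    "\<forall>f f'. (\<forall>i<n. f i = f' i) \<longrightarrow> sub_tm f t = sub_tm f' t"
    "\<forall>f f'. (\<forall>i<m. f i = f' i) \<longrightarrow> sub_tm f u = sub_tm f' u" by blast
  then show ?case by (intro exI[of _ "max n m"]) simp
next
  case (Mul t u)
  then obtain n m where
    "\<forall>f f'. (\<forall>i<n. f i = f' i) \<longrightarrow> sub_tm f t = sub_tm f' t"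
    "\<forall>f f'. (\<forall>i<m. f i = f' i) \<longrightarrow> sub_tm f u = sub_tm f' u" by blast
  then show ?case by (intro exI[of _ "max n m"]) simp
qed auto

lemma support_below_exists: "\<exists>n. support_below n p"
proof (induction p)
  case (Eq t u)
  obtain n m where
    "\<forall>f f'. (\<forall>i<n. f i = f' i) \<longrightarrow> sub_tm f t = sub_tm f' t"
    "\<forall>f f'. (\<forall>i<m. f i = f' i) \<longrightarrow> sub_tm f u = sub_tm f' u"
    using support_tm[of t] support_tm[of u] by blast
  then show ?case by (intro exI[of _ "max n m"]) (simp add: support_below_def)
next
  case (Less t u)
  obtain n m where
    "\<forall>f f'. (\<forall>i<n. f i = f' i) \<longrightarrow> sub_tm f t = sub_tm f' t"
    "\<forall>f f'. (\<forall>i<m. f i = f' i) \<longrightarrow> sub_tm f u = sub_tm f' u"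
    using support_tm[of t] support_tm[of u] by blast
  then show ?case by (intro exI[of _ "max n m"]) (simp add: support_below_def)
next
  case (Mem t X)
  obtain n where
    "\<forall>f f'. (\<forall>i<n. f i = f' i) \<longrightarrow> sub_tm f t = sub_tm f' t"
    using support_tm[of t] by blast
  then show ?case by (intro exI[of _ "max n (Suc X)"]) (simp add: support_below_def)
next
  case (Imp p q)
  then obtain n m where "support_below n p" "support_below m q" by blast
  then show ?case by (intro exI[of _ "max n m"]) (simp add: support_below_def)
next
  case (All p)
  then obtain n where n: "support_below n p" by blast
  have "support_below n (All p)"
    unfolding support_below_def
    by (auto intro!: support_belowD[OF n] split: nat.split)
  then show ?case ..
next
  case (AllS p)
  then obtain n where n: "support_below n p" by blast
  have "support_below n (AllS p)"
    unfolding support_below_def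
    by (auto intro!: support_belowD[OF n] split: nat.split)
  then show ?case ..
qed (auto simp: support_below_def)

lemma support_below_finite:
  assumes "finite H"
  shows "\<exists>n. \<forall>p\<in>H. support_below n p"
  using assms
proof induction
  case (insert p H)
  then obtain n m where "\<forall>p\<in>H. support_below n p" "support_below m p"
    using support_below_exists by blast
  then show ?case
    by (intro exI[of _ "max n m"]) (auto intro: support_below_mono)
qed simp

section \<open>Derivations\<close>

lemma deriv_weaken: "deriv T H p \<Longrightarrow> H \<subseteq> H' \<Longrightarrow> deriv T H' p"
proof (induction arbitrary: H' rule: deriv.induct)
  case (ImpI p H q)
  then show ?case by (metis deriv.ImpI insert_mono)
next
  case (ImpE H p q)
  then show ?case by (metis deriv.ImpE)
next
  case (Class p H)
  then show ?case by (metis deriv.Class insert_mono)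
next
  case (AllI H p)
  then show ?case by (metis deriv.AllI image_mono)
next
  case (AllSI H p)
  then show ?case by (metis deriv.AllSI image_mono)
next
  case (EqE H t u p)
  then show ?case by (metis deriv.EqE)
qed (auto intro: deriv.Ax deriv.Hyp deriv.AllE deriv.AllSE deriv.EqI)

lemma deriv_gen: "deriv T {} p \<Longrightarrow> deriv T {} ((All ^^ n) p)"
  by (induction n) (auto intro: deriv.AllI)

lemma deriv_genS: "deriv T {} p \<Longrightarrow> deriv T {} ((AllS ^^ n) p)"
  by (induction n) (auto intro: deriv.AllSI)

lemma deriv_spec:
  "deriv T H ((All ^^ n) p) \<Longrightarrow> deriv T H (sub (\<lambda>i. if i < n then f i else Var (i - n)) (\<lambda>x. x) p)"
proof (induction n arbitrary: p f)
  case (Suc n)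
  let ?f = "\<lambda>i. if i < n then f (Suc i) else Var (i - n)"
  have "deriv T H (sub ?f (\<lambda>x. x) (All p))"
    using Suc.prems by (intro Suc.IH) (simp add: funpow_swap1)
  then have "deriv T H (inst (sub (up ?f) (\<lambda>x. x) p) (f 0))"
    by (intro deriv.AllE) (simp add: id_def)
  moreover have "case_nat (f 0) ?f = (\<lambda>i. if i < Suc n then f i else Var (i - Suc n))"
    by (auto split: nat.split)
  ultimately show ?case by (simp only: inst_sub)
qed simp

lemma deriv_specS:
  "deriv T H ((AllS ^^ n) p) \<Longrightarrow> deriv T H (sub Var (\<lambda>i. if i < n then g i else i - n) p)"
proof (induction n arbitrary: p g)
  case (Suc n)
  let ?g = "\<lambda>i. if i < n then g (Suc i) else i - n"
  have "deriv T H (sub Var ?g (AllS p))"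
    using Suc.prems by (intro Suc.IH) (simp add: funpow_swap1)
  then have "deriv T H (instS (sub Var (upS ?g) p) (g 0))"
    by (intro deriv.AllSE) simp
  moreover have "case_nat (g 0) ?g = (\<lambda>i. if i < Suc n then g i else i - Suc n)"
    by (auto split: nat.split)
  ultimately show ?case by (simp only: instS_sub)
qed simp

text \<open>An axiom with free variables stands for its universal closure. Hence a simultaneous
  substitution is carried out by generalising sufficiently many variables of each sort and
  instantiating them again; what happens to the remaining variables is irrelevant by
  \<open>support_below\<close>. This is the case of axioms in \<open>deriv_sub\<close>.\<close>

lemma deriv_sub_theorem:
  assumes "deriv T {} p"
  shows "deriv T {} (sub f g p)"
proof -
  obtain n where n: "support_below n p" using support_below_exists by blast
  let ?f = "\<lambda>i. if i < n then f i else Var (i - n)"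
  have 1: "deriv T {} (sub ?f (\<lambda>x. x) p)"
    using deriv_spec[OF deriv_gen[OF assms]] .
  obtain m where m: "support_below m (sub ?f (\<lambda>x. x) p)" using support_below_exists by blast
  let ?g = "\<lambda>i. if i < max n m then g i else i - max n m"
  have "deriv T {} (sub Var ?g (sub ?f (\<lambda>x. x) p))"
    using deriv_specS[OF deriv_genS[OF 1]] .
  moreover have "sub Var ?g (sub ?f (\<lambda>x. x) p) = sub f g p"
    unfolding sub_sub by (rule support_belowD[OF n]) auto
  ultimately show ?thesis by simp
qed

lemma deriv_sub: "deriv T H p \<Longrightarrow> deriv T (sub f g ` H) (sub f g p)"
proof (induction arbitrary: f g rule: deriv.induct)
  case (Ax p H)
  then have "deriv T {} p" by (rule deriv.Ax)
  from deriv_sub_theorem[OF this] show ?case by (rule deriv_weaken) simp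
next
  case (Hyp p H)
  then show ?case by (intro deriv.Hyp) simp
next
  case (ImpI p H q)
  show ?case using ImpI.IH[of f g] by (auto intro: deriv.ImpI)
next
  case (ImpE H p q)
  show ?case using ImpE.IH(1)[of f g] ImpE.IH(2)[of f g] by (auto intro: deriv.ImpE)
next
  case (Class p H)
  have "deriv T (insert (Neg (sub f g p)) (sub f g ` H)) Fls"
    using Class.IH[of f g] by (simp add: Neg_def)
  then show ?case by (rule deriv.Class)
next
  case (AllI H p)
  have "sub (up f) g ` lift ` H = lift ` sub f g ` H"
    by (simp add: image_image sub_up_lift)
  then show ?case using AllI.IH[of "up f" g] by (auto intro: deriv.AllI)
next
  case (AllE H p t)
  have "deriv T (sub f g ` H) (All (sub (up f) g p))" using AllE.IH[of f g] by simp
  then show ?case unfolding sub_inst by (rule deriv.AllE)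
next
  case (AllSI H p)
  have "sub f (upS g) ` liftS ` H = liftS ` sub f g ` H"
    by (simp add: image_image sub_upS_liftS)
  then show ?case using AllSI.IH[of f "upS g"] by (auto intro: deriv.AllSI)
next
  case (AllSE H p X)
  have "deriv T (sub f g ` H) (AllS (sub f (upS g) p))" using AllSE.IH[of f g] by simp
  then show ?case unfolding sub_instS by (rule deriv.AllSE)
next
  case (EqI H t)
  show ?case by (auto intro: deriv.EqI)
next
  case (EqE H t u p)
  have "deriv T (sub f g ` H) (Eq (sub_tm f t) (sub_tm f u))" using EqE.IH(1)[of f g] by simp
  then show ?case using EqE.IH(2)[of f g] unfolding sub_inst by (rule deriv.EqE)
qed

lemma deriv_finite: "deriv T H p \<Longrightarrow> \<exists>H0\<subseteq>H. finite H0 \<and> deriv T H0 p"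
proof (induction rule: deriv.induct)
  case (Ax p H)
  then show ?case by (metis deriv.Ax empty_subsetI finite.emptyI)
next
  case (Hyp p H)
  then show ?case by (intro exI[of _ "{p}"]) (auto intro: deriv.Hyp)
next
  case (ImpI p H q)
  then obtain H0 where "H0 \<subseteq> insert p H" "finite H0" "deriv T H0 q" by blast
  then show ?case
    by (intro exI[of _ "H0 - {p}"]) (auto intro!: deriv.ImpI intro: deriv_weaken)
next
  case (ImpE H p q)
  then obtain H1 H2 where "H1 \<subseteq> H" "finite H1" "deriv T H1 (Imp p q)"
    "H2 \<subseteq> H" "finite H2" "deriv T H2 p" by blast
  then show ?case
    by (intro exI[of _ "H1 \<union> H2"]) (auto intro: deriv.ImpE deriv_weaken)
next
  case (Class p H)
  then obtain H0 where "H0 \<subseteq> insert (Neg p) H" "finite H0" "deriv T H0 Fls" by blast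
  then have "deriv T (insert (Neg p) (H0 - {Neg p})) Fls"
    by (auto elim: deriv_weaken)
  then have "deriv T (H0 - {Neg p}) p" by (rule deriv.Class)
  then show ?case using \<open>H0 \<subseteq> insert (Neg p) H\<close> \<open>finite H0\<close>
    by (intro exI[of _ "H0 - {Neg p}"]) auto
next
  case (AllI H p)
  then obtain H0 where "H0 \<subseteq> lift ` H" "finite H0" "deriv T H0 p" by blast
  then show ?case using finite_subset_image[of H0 lift H] deriv.AllI by blast
next
  case (AllSI H p)
  then obtain H0 where "H0 \<subseteq> liftS ` H" "finite H0" "deriv T H0 p" by blast
  then show ?case using finite_subset_image[of H0 liftS H] deriv.AllSI by blast
next
  case (EqE H t u p)
  then obtain H1 H2 where "H1 \<subseteq> H" "finite H1" "deriv T H1 (Eq t u)"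
    "H2 \<subseteq> H" "finite H2" "deriv T H2 (inst p t)" by blast
  then have "deriv T (H1 \<union> H2) (Eq t u)" "deriv T (H1 \<union> H2) (inst p t)"
    by (auto elim!: deriv_weaken)
  then have "deriv T (H1 \<union> H2) (inst p u)" by (rule deriv.EqE)
  then show ?case using \<open>H1 \<subseteq> H\<close> \<open>H2 \<subseteq> H\<close> \<open>finite H1\<close> \<open>finite H2\<close>
    by (intro exI[of _ "H1 \<union> H2"]) simp
qed (blast intro: deriv.AllE deriv.AllSE deriv.EqI)+

text \<open>The eigenvariable rule in named form. The renaming \<open>?f\<close> sends variable
  \<open>n\<close> to \<open>0\<close> and shifts all others; on formulas that do not mention
  \<open>n\<close> this is exactly \<open>lift\<close>, as \<open>AllI\<close> requires.\<close>

lemma deriv_All_fresh: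
  assumes H: "\<And>h. h \<in> H \<Longrightarrow> support_below n h" and q: "support_below n q"
    and "deriv T H (inst q (Var n))"
  shows "deriv T H (All q)"
proof -
  let ?f = "\<lambda>i. if i = n then Var 0 else Var (Suc i)"
  have "sub ?f (\<lambda>x. x) h = lift h" if "h \<in> H" for h
    unfolding lift_def by (rule support_belowD[OF H[OF that]]) simp
  then have "sub ?f (\<lambda>x. x) ` H = lift ` H" by (intro image_cong) simp_all
  moreover have "sub ?f (\<lambda>x. x) (inst q (Var n)) = sub Var id q"
    unfolding inst_def sub_sub by (rule support_belowD[OF q]) (simp split: nat.split)
  ultimately show ?thesis
    using deriv_sub[OF assms(3), of ?f "\<lambda>x. x"] by (simp add: deriv.AllI)
qed

lemma deriv_AllS_fresh:
  assumes H: "\<And>h. h \<in> H \<Longrightarrow> support_below n h" and q: "support_below n q"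
    and "deriv T H (instS q n)"
  shows "deriv T H (AllS q)"
proof -
  let ?g = "\<lambda>i. if i = n then 0 else Suc i"
  have "sub Var ?g h = liftS h" if "h \<in> H" for h
    unfolding liftS_def by (rule support_belowD[OF H[OF that]]) simp
  then have "sub Var ?g ` H = liftS ` H" by (intro image_cong) simp_all
  moreover have "sub Var ?g (instS q n) = sub Var id q"
    unfolding instS_def sub_sub by (rule support_belowD[OF q]) (simp split: nat.split)
  ultimately show ?thesis
    using deriv_sub[OF assms(3), of Var ?g] by (simp add: deriv.AllSI)
qed

section \<open>Completeness\<close>

locale l2_structure =
  fixes num_zero :: 'm and num_one :: 'm
    and num_add :: "'m \<Rightarrow> 'm \<Rightarrow> 'm" (infixl "\<oplus>" 65)
    and num_mul :: "'m \<Rightarrow> 'm \<Rightarrow> 'm" (infixl "\<otimes>" 70)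
    and num_less :: "'m \<Rightarrow> 'm \<Rightarrow> bool" (infix "\<prec>" 50)
    and num_mem :: "'m \<Rightarrow> 's \<Rightarrow> bool" (infix "\<epsilon>" 50)
begin

primrec val :: "(nat \<Rightarrow> 'm) \<Rightarrow> tm \<Rightarrow> 'm" where
  "val e (Var i) = e i"
| "val e Zero = num_zero"
| "val e One = num_one"
| "val e (Add t u) = val e t \<oplus> val e u"
| "val e (Mul t u) = val e t \<otimes> val e u"

primrec sat :: "(nat \<Rightarrow> 'm) \<Rightarrow> (nat \<Rightarrow> 's) \<Rightarrow> fm \<Rightarrow> bool" where
  "sat e f (Eq t u) \<longleftrightarrow> val e t = val e u"
| "sat e f (Less t u) \<longleftrightarrow> val e t \<prec> val e u"
| "sat e f (Mem t X) \<longleftrightarrow> val e t \<epsilon> f X"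
| "sat e f Fls \<longleftrightarrow> False"
| "sat e f (Imp p q) \<longleftrightarrow> (sat e f p \<longrightarrow> sat e f q)"
| "sat e f (All p) \<longleftrightarrow> (\<forall>a. sat (case_nat a e) f p)"
| "sat e f (AllS p) \<longleftrightarrow> (\<forall>X. sat e (case_nat X f) p)"

end

section \<open>Henkin extension of a consistent finite set\<close>

lemma deriv_cut: "deriv T (insert p H) q \<Longrightarrow> deriv T H p \<Longrightarrow> deriv T H q"
  by (meson deriv.ImpE deriv.ImpI)

lemma deriv_consistent_Neg:
  assumes "\<not> deriv T H p"
  shows "\<not> deriv T (insert (Neg p) H) Fls"
  using assms deriv.Class by blast

text \<open>The last two clauses are the Henkin property: a universal formula that is rejected
  receives a counterexample at the same stage.\<close>

definition henkin_decides :: "fm set \<Rightarrow> fm \<Rightarrow> bool" where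
  "henkin_decides H p \<longleftrightarrow> (p \<in> H \<or> Neg p \<in> H) \<and>
    (\<forall>q. p = All q \<longrightarrow> p \<in> H \<or> (\<exists>t. Neg (inst q t) \<in> H)) \<and>
    (\<forall>q. p = AllS q \<longrightarrow> p \<in> H \<or> (\<exists>X. Neg (instS q X) \<in> H))"

lemma henkin_decidesD:
  "henkin_decides H p \<Longrightarrow> p \<in> H \<or> Neg p \<in> H"
  "henkin_decides H (All q) \<Longrightarrow> All q \<in> H \<or> (\<exists>t. Neg (inst q t) \<in> H)"
  "henkin_decides H (AllS r) \<Longrightarrow> AllS r \<in> H \<or> (\<exists>X. Neg (instS r X) \<in> H)"
  by (simp_all add: henkin_decides_def)

lemma henkin_step:
  assumes fin: "finite H" and cons: "\<not> deriv T H Fls"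
  shows "\<exists>H'. finite H' \<and> \<not> deriv T H' Fls \<and> H \<subseteq> H' \<and> henkin_decides H' p"
proof (cases "deriv T (insert p H) Fls")
  case False
  then show ?thesis
    using fin by (intro exI[of _ "insert p H"]) (auto simp: henkin_decides_def)
next
  case True
  let ?H = "insert (Neg p) H"
  have np: "\<not> deriv T H p" using True cons deriv_cut by blast
  then have H: "\<not> deriv T ?H Fls" by (rule deriv_consistent_Neg)
  \<comment> \<open>The eigenvariable argument is applied over \<open>?H\<close>, so underivability
    of \<open>p\<close> over \<open>H\<close> alone would not suffice.\<close>
  have p: "\<not> deriv T ?H p"
  proof
    assume "deriv T ?H p"
    moreover have "deriv T ?H (Neg p)" by (intro deriv.Hyp) simp
    ultimately show False using H unfolding Neg_def by (meson deriv.ImpE)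
  qed
  consider q where "p = All q" | q where "p = AllS q" | "\<forall>q. p \<noteq> All q \<and> p \<noteq> AllS q" by blast
  then show ?thesis
  proof cases
    case (1 q)
    obtain n where n: "\<forall>h\<in>insert q ?H. support_below n h"
      using support_below_finite[of "insert q ?H"] fin by auto
    have "\<not> deriv T ?H (inst q (Var n))"
      using deriv_All_fresh[of ?H n q T] n p 1 by auto
    then have "\<not> deriv T (insert (Neg (inst q (Var n))) ?H) Fls"
      by (rule deriv_consistent_Neg)
    then show ?thesis
      using fin 1 by (intro exI[of _ "insert (Neg (inst q (Var n))) ?H"]) (auto simp: henkin_decides_def)
  next
    case (2 q)
    obtain n where n: "\<forall>h\<in>insert q ?H. support_below n h"
      using support_below_finite[of "insert q ?H"] fin by auto
    have "\<not> deriv T ?H (instS q n)"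
      using deriv_AllS_fresh[of ?H n q T] n p 2 by auto
    then have "\<not> deriv T (insert (Neg (instS q n)) ?H) Fls"
      by (rule deriv_consistent_Neg)
    then show ?thesis
      using fin 2 by (intro exI[of _ "insert (Neg (instS q n)) ?H"]) (auto simp: henkin_decides_def)
  next
    case 3
    then show ?thesis
      using fin H by (intro exI[of _ ?H]) (auto simp: henkin_decides_def)
  qed
qed

text \<open>Stage \<open>n + 1\<close> treats the formula with number \<open>n\<close>. Every stage
  is finite, which is what leaves a fresh variable for the witness; consistency survives in the
  union because a derivation uses finitely many hypotheses.\<close>

lemma henkin_extension:
  assumes "finite H" "\<not> deriv T H Fls"
  obtains \<Gamma> where "H \<subseteq> \<Gamma>" "\<not> deriv T \<Gamma> Fls" "\<And>p. p \<in> \<Gamma> \<or> Neg p \<in> \<Gamma>"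
    "\<And>q. All q \<in> \<Gamma> \<or> (\<exists>t. Neg (inst q t) \<in> \<Gamma>)"
    "\<And>q. AllS q \<in> \<Gamma> \<or> (\<exists>X. Neg (instS q X) \<in> \<Gamma>)"
proof -
  have "\<exists>S. \<forall>n. (finite (S n) \<and> \<not> deriv T (S n) Fls \<and> (n = 0 \<longrightarrow> S n = H)) \<and>
    S n \<subseteq> S (Suc n) \<and> henkin_decides (S (Suc n)) (from_nat n)"
  proof (rule dependent_nat_choice)
    show "\<exists>x. finite x \<and> \<not> deriv T x Fls \<and> ((0::nat) = 0 \<longrightarrow> x = H)" using assms by blast
    fix A and n :: nat assume "finite A \<and> \<not> deriv T A Fls \<and> (n = 0 \<longrightarrow> A = H)"
    then show "\<exists>B. (finite B \<and> \<not> deriv T B Fls \<and> (Suc n = 0 \<longrightarrow> B = H)) \<and>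
        A \<subseteq> B \<and> henkin_decides B (from_nat n)"
      using henkin_step[of A T "from_nat n"] by auto
  qed
  then obtain S where "\<forall>n. (finite (S n) \<and> \<not> deriv T (S n) Fls \<and> (n = 0 \<longrightarrow> S n = H)) \<and>
    S n \<subseteq> S (Suc n) \<and> henkin_decides (S (Suc n)) (from_nat n)" by (rule exE)
  then have S: "\<And>n. finite (S n)" "\<And>n. \<not> deriv T (S n) Fls" "S 0 = H"
    "\<And>n. S n \<subseteq> S (Suc n)" "\<And>n. henkin_decides (S (Suc n)) (from_nat n)" by simp_all
  have mono: "S m \<subseteq> S n" if "m \<le> n" for m n
    using lift_Suc_mono_le[of S, OF S(4)] that by blast
  let ?G = "\<Union>n. S n"
  show thesis
  proof (rule that[of ?G])
    show "H \<subseteq> ?G" using S(3) by blast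
    show "\<not> deriv T ?G Fls"
    proof
      assume "deriv T ?G Fls"
      then obtain H0 where H0: "H0 \<subseteq> ?G" "finite H0" "deriv T H0 Fls" using deriv_finite[of T ?G Fls] by metis
      have "\<exists>n. H0 \<subseteq> S n"
        using H0(2,1)
      proof (induction H0)
        case (insert h H0)
        then obtain n m where "H0 \<subseteq> S n" "h \<in> S m" by auto
        then have "insert h H0 \<subseteq> S (max n m)" using mono[of n "max n m"] mono[of m "max n m"] by auto
        then show ?case ..
      qed simp
      then obtain n where "H0 \<subseteq> S n" ..
      then show False using deriv_weaken[OF H0(3)] S(2)[of n] by simp
    qed
    show "p \<in> ?G \<or> Neg p \<in> ?G" for p
      using henkin_decidesD(1)[OF S(5)[of "to_nat p", unfolded from_nat_to_nat]] by blast
    show "All q \<in> ?G \<or> (\<exists>t. Neg (inst q t) \<in> ?G)" for q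
      using henkin_decidesD(2)[OF S(5)[of "to_nat (All q)", unfolded from_nat_to_nat]] by blast
    show "AllS q \<in> ?G \<or> (\<exists>X. Neg (instS q X) \<in> ?G)" for q
      using henkin_decidesD(3)[OF S(5)[of "to_nat (AllS q)", unfolded from_nat_to_nat]] by blast
  qed
qed

section \<open>The term model of a complete theory with witnesses\<close>

locale henkin_theory =
  fixes T :: "fm set" and \<Gamma> :: "fm set"
  assumes basic: "basic_axioms \<subseteq> T"
    and consistent: "\<not> deriv T \<Gamma> Fls"
    and complete: "p \<in> \<Gamma> \<or> Neg p \<in> \<Gamma>"
    and witness: "All q \<in> \<Gamma> \<or> (\<exists>t. Neg (inst q t) \<in> \<Gamma>)"
    and witnessS: "AllS q \<in> \<Gamma> \<or> (\<exists>X. Neg (instS q X) \<in> \<Gamma>)"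
begin

lemma Neg_iff: "Neg p \<in> \<Gamma> \<longleftrightarrow> p \<notin> \<Gamma>"
  using complete consistent unfolding Neg_def by (metis deriv.Hyp deriv.ImpE)

lemma closed: "deriv T \<Gamma> p \<Longrightarrow> p \<in> \<Gamma>"
  using Neg_iff consistent unfolding Neg_def by (metis deriv.Hyp deriv.ImpE)

lemma closed_sub:
  assumes "p \<in> T"
  shows "sub f g p \<in> \<Gamma>"
proof -
  have "deriv T {} p" using assms by (rule deriv.Ax)
  then have "deriv T {} (sub f g p)" by (rule deriv_sub_theorem)
  then show ?thesis by (intro closed) (rule deriv_weaken, assumption, simp)
qed

lemma Imp_iff: "Imp p q \<in> \<Gamma> \<longleftrightarrow> (p \<in> \<Gamma> \<longrightarrow> q \<in> \<Gamma>)"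
proof
  assume "Imp p q \<in> \<Gamma>"
  then show "p \<in> \<Gamma> \<longrightarrow> q \<in> \<Gamma>" using closed by (metis deriv.Hyp deriv.ImpE)
next
  assume *: "p \<in> \<Gamma> \<longrightarrow> q \<in> \<Gamma>"
  have "deriv T (insert p \<Gamma>) q"
  proof (cases "p \<in> \<Gamma>")
    case True
    then show ?thesis using * by (simp add: deriv.Hyp)
  next
    case False
    then have "Imp p Fls \<in> \<Gamma>" using Neg_iff Neg_def by simp
    then have "deriv T (insert (Neg q) (insert p \<Gamma>)) (Imp p Fls)"
      "deriv T (insert (Neg q) (insert p \<Gamma>)) p" by (simp_all add: deriv.Hyp)
    then have "deriv T (insert (Neg q) (insert p \<Gamma>)) Fls" by (rule deriv.ImpE)
    then show ?thesis by (rule deriv.Class)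
  qed
  then show "Imp p q \<in> \<Gamma>" by (intro closed deriv.ImpI)
qed

lemma All_iff: "All q \<in> \<Gamma> \<longleftrightarrow> (\<forall>t. inst q t \<in> \<Gamma>)"
  using witness[of q] Neg_iff closed by (metis deriv.Hyp deriv.AllE)

lemma AllS_iff: "AllS q \<in> \<Gamma> \<longleftrightarrow> (\<forall>X. instS q X \<in> \<Gamma>)"
  using witnessS[of q] Neg_iff closed by (metis deriv.Hyp deriv.AllSE)

definition equiv_tm :: "tm \<Rightarrow> tm \<Rightarrow> bool" (infix "\<approx>" 50) where
  "t \<approx> u \<longleftrightarrow> Eq t u \<in> \<Gamma>"

text \<open>All congruence laws below come from this rule, applied to a formula with one hole
  \<open>Var 0\<close> in which every other term is lifted past the hole.\<close>

lemma equiv_subst: "t \<approx> u \<Longrightarrow> inst p t \<in> \<Gamma> \<Longrightarrow> inst p u \<in> \<Gamma>"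
  unfolding equiv_tm_def using closed by (metis deriv.EqE deriv.Hyp)

lemma Eq_refl [simp]: "Eq t t \<in> \<Gamma>"
  by (intro closed deriv.EqI)

lemma equiv_refl [simp]: "t \<approx> t"
  by (simp add: equiv_tm_def)

lemma inst_lift_tm [simp]: "sub_tm (case_nat t Var) (lift_tm u) = u"
  by (simp add: sub_tm_case_lift)

lemma equiv_sym: "t \<approx> u \<Longrightarrow> u \<approx> t"
  using equiv_subst[of t u "Eq (Var 0) (lift_tm t)"]
  by (simp add: inst_def equiv_tm_def)

lemma equiv_trans: "t \<approx> u \<Longrightarrow> u \<approx> v \<Longrightarrow> t \<approx> v"
  using equiv_subst[of u v "Eq (lift_tm t) (Var 0)"]
  by (simp add: inst_def equiv_tm_def)

lemma equiv_Add: "t \<approx> t' \<Longrightarrow> u \<approx> u' \<Longrightarrow> Add t u \<approx> Add t' u'"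
  using equiv_subst[of t t' "Eq (lift_tm (Add t u)) (Add (Var 0) (lift_tm u))"]
    equiv_subst[of u u' "Eq (lift_tm (Add t u)) (Add (lift_tm t') (Var 0))"]
  by (simp add: inst_def equiv_tm_def)

lemma equiv_Mul: "t \<approx> t' \<Longrightarrow> u \<approx> u' \<Longrightarrow> Mul t u \<approx> Mul t' u'"
  using equiv_subst[of t t' "Eq (lift_tm (Mul t u)) (Mul (Var 0) (lift_tm u))"]
    equiv_subst[of u u' "Eq (lift_tm (Mul t u)) (Mul (lift_tm t') (Var 0))"]
  by (simp add: inst_def equiv_tm_def)

lemma equiv_Less: "t \<approx> t' \<Longrightarrow> u \<approx> u' \<Longrightarrow> Less t u \<in> \<Gamma> \<Longrightarrow> Less t' u' \<in> \<Gamma>"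
  using equiv_subst[of t t' "Less (Var 0) (lift_tm u)"] equiv_subst[of u u' "Less (lift_tm t') (Var 0)"]
  by (simp add: inst_def)

lemma equiv_Mem: "t \<approx> t' \<Longrightarrow> Mem t X \<in> \<Gamma> \<Longrightarrow> Mem t' X \<in> \<Gamma>"
  using equiv_subst[of t t' "Mem (Var 0) X"]
  by (simp add: inst_def)

definition numeral_tm :: "nat \<Rightarrow> tm" where
  "numeral_tm n = ((\<lambda>t. Add t One) ^^ n) Zero"

text \<open>Here the arithmetical axioms enter completeness: successor is injective and never zero,
  so the term model is infinite and can be carried by the type of natural numbers.\<close>

lemma numeral_tm_inj: "numeral_tm m \<approx> numeral_tm n \<Longrightarrow> m = n"
proof (induction m arbitrary: n)
  have S0: "\<not> Add t One \<approx> Zero" for t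
    using closed_sub[of "Neg (Eq (Add (Var 1) One) Zero)" "\<lambda>_. t" id] basic Neg_iff
    by (auto simp: basic_axioms_def Let_def equiv_tm_def Neg_def)
  {
    case (0 n)
    then show ?case using S0 equiv_sym by (cases n) (auto simp: numeral_tm_def)
  next
    case (Suc m)
    have SS: "t \<approx> u" if "Add t One \<approx> Add u One" for t u
      using closed_sub[of "Imp (Eq (Add (Var 0) One) (Add (Var 1) One)) (Eq (Var 0) (Var 1))"
          "case_nat t (\<lambda>_. u)" id] basic that
      by (auto simp: basic_axioms_def Let_def equiv_tm_def Imp_iff)
    show ?case using Suc S0 SS by (cases n) (auto simp: numeral_tm_def)
  }
qed

text \<open>The premise of \<open>completeness\<close> ranges over structures on one fixed type, as
  HOL cannot quantify over types. There are countably many terms and infinitely many classes, hence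
  a numbering of the classes that is onto.\<close>

lemma quotient_map: "\<exists>c :: tm \<Rightarrow> nat. surj c \<and> (\<forall>t u. c t = c u \<longleftrightarrow> t \<approx> u)"
proof -
  define cls where "cls t = {u. t \<approx> u}" for t
  have cls: "cls t = cls u \<longleftrightarrow> t \<approx> u" for t u
    unfolding cls_def using equiv_refl equiv_sym equiv_trans by blast
  have "inj (\<lambda>n. cls (numeral_tm n))"
    using cls numeral_tm_inj by (auto intro!: injI)
  then have "infinite (range (\<lambda>n. cls (numeral_tm n)))" by (simp add: finite_image_iff)
  then have "infinite (range cls)" by (rule contrapos_nn) (auto elim: finite_subset[rotated])
  then have bij: "bij_betw (to_nat_on (range cls)) (range cls) UNIV"
    by (intro to_nat_on_infinite) auto
  show ?thesis
  proof (intro exI[of _ "\<lambda>t. to_nat_on (range cls) (cls t)"] conjI allI)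
    show "surj (\<lambda>t. to_nat_on (range cls) (cls t))"
      using bij unfolding bij_betw_def by (auto simp: image_image)
    show "to_nat_on (range cls) (cls t) = to_nat_on (range cls) (cls u) \<longleftrightarrow> t \<approx> u" for t u
      unfolding cls[symmetric] using bij unfolding bij_betw_def by (auto dest: inj_onD)
  qed
qed

definition cls :: "tm \<Rightarrow> nat" where
  "cls = (SOME c. surj c \<and> (\<forall>t u. c t = c u \<longleftrightarrow> t \<approx> u))"

lemma cls_surj: "surj cls" and cls_eq: "cls t = cls u \<longleftrightarrow> t \<approx> u"
  using someI_ex[OF quotient_map] unfolding cls_def by blast+

definition rep :: "nat \<Rightarrow> tm" where "rep = inv cls"

lemma cls_rep [simp]: "cls (rep a) = a"
  unfolding rep_def using cls_surj by (rule surj_f_inv_f)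

lemma rep_cls: "rep (cls t) \<approx> t"
  by (simp flip: cls_eq)

text \<open>Set variables themselves serve as the sets of the model. The language has no equality of
  sets, so only the number terms are divided by an equivalence.\<close>

sublocale M: l2_structure "cls Zero" "cls One" "\<lambda>a b. cls (Add (rep a) (rep b))"
  "\<lambda>a b. cls (Mul (rep a) (rep b))" "\<lambda>a b. Less (rep a) (rep b) \<in> \<Gamma>"
  "\<lambda>a X. Mem (rep a) X \<in> \<Gamma>" .

lemma val_M: "M.val (\<lambda>i. cls (f i)) t = cls (sub_tm f t)"
  using rep_cls by (induction t) (auto simp: cls_eq intro: equiv_Add equiv_Mul)

text \<open>The truth lemma, for all assignments by terms at once. Its quantifier case rests on the
  Henkin witnesses and on every class being the class of a term.\<close>

lemma sat_M: "M.sat (\<lambda>i. cls (f i)) g p \<longleftrightarrow> sub f g p \<in> \<Gamma>"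
proof (induction p arbitrary: f g)
  case (Eq t u)
  then show ?case by (simp add: val_M cls_eq equiv_tm_def)
next
  case (Less t u)
  then show ?case using rep_cls equiv_sym equiv_Less by (simp add: val_M) blast
next
  case (Mem t X)
  then show ?case using rep_cls equiv_sym equiv_Mem by (simp add: val_M) blast
next
  case Fls
  then show ?case using consistent deriv.Hyp by auto
next
  case (Imp p q)
  then show ?case by (simp add: Imp_iff)
next
  case (All p)
  have "case_nat (cls t) (\<lambda>i. cls (f i)) = (\<lambda>i. cls (case_nat t f i))" for t
    by (auto split: nat.split)
  then have *: "M.sat (case_nat (cls t) (\<lambda>i. cls (f i))) g p \<longleftrightarrow> sub (case_nat t f) g p \<in> \<Gamma>" for t
    using All.IH by simp
  have "M.sat (\<lambda>i. cls (f i)) g (All p) \<longleftrightarrow> (\<forall>t. sub (case_nat t f) g p \<in> \<Gamma>)"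
    unfolding *[symmetric] by (simp, metis cls_rep)
  then show ?case by (simp add: All_iff inst_sub)
next
  case (AllS p)
  have "case_nat X g = (\<lambda>i. case_nat X g i)" for X by simp
  then show ?case using AllS.IH by (simp add: AllS_iff instS_sub)
qed

lemma sat_M_axiom:
  assumes "p \<in> T"
  shows "M.sat e f p"
  using sat_M[of "\<lambda>i. rep (e i)" f p] closed_sub[OF assms] by simp

lemma sat_M_theory: "M.sat (\<lambda>i. cls (Var i)) (\<lambda>i. i) p \<longleftrightarrow> p \<in> \<Gamma>"
  using sat_M[of Var "\<lambda>i. i" p] by simp

end

theorem completeness:
  assumes basic: "basic_axioms \<subseteq> T"
    and valid: "\<And>(z :: nat) o' pl ti le (el :: nat \<Rightarrow> nat \<Rightarrow> bool) e f.
      (\<And>p e f. p \<in> T \<Longrightarrow> l2_structure.sat z o' pl ti le el e f p) \<Longrightarrow>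
      l2_structure.sat z o' pl ti le el e f \<phi>"
  shows "T \<turnstile> \<phi>"
proof (rule ccontr)
  assume "\<not> T \<turnstile> \<phi>"
  then have "\<not> deriv T {Neg \<phi>} Fls"
    unfolding provable_def by (rule deriv_consistent_Neg)
  then obtain \<Gamma> where \<Gamma>: "{Neg \<phi>} \<subseteq> \<Gamma>" "\<not> deriv T \<Gamma> Fls" "\<And>p. p \<in> \<Gamma> \<or> Neg p \<in> \<Gamma>"
    "\<And>q. All q \<in> \<Gamma> \<or> (\<exists>t. Neg (inst q t) \<in> \<Gamma>)"
    "\<And>q. AllS q \<in> \<Gamma> \<or> (\<exists>X. Neg (instS q X) \<in> \<Gamma>)"
    using henkin_extension[of "{Neg \<phi>}" T] by (metis finite.emptyI finite.insertI)
  interpret henkin_theory T \<Gamma> using basic \<Gamma> by unfold_locales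
  have "M.sat (\<lambda>i. cls (Var i)) (\<lambda>i. i) \<phi>"
    by (rule valid) (rule sat_M_axiom)
  then show False using \<Gamma>(1) Neg_iff by (simp add: sat_M_theory)
qed

section \<open>Models of RCA0 and bounded definability\<close>

lemma Delta0_sub: "Delta0 p \<Longrightarrow> Delta0 (sub f g p)"
proof (induction arbitrary: f g rule: Delta0.induct)
  case (6 p t)
  then show ?case using Delta0.intros(6)[of "sub (up f) g p" "sub_tm f t"]
    by (simp add: sub_tm_up_lift)
qed (auto intro: Delta0.intros)

context l2_structure
begin

lemma val_sub_tm: "val e (sub_tm f t) = val (\<lambda>i. val e (f i)) t"
  by (induction t) auto

lemma val_lift_tm [simp]: "val (case_nat a e) (lift_tm t) = val e t"
  by (simp add: lift_tm_def val_sub_tm)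

lemma sat_sub: "sat e f (sub s g p) \<longleftrightarrow> sat (\<lambda>i. val e (s i)) (\<lambda>i. f (g i)) p"
proof (induction p arbitrary: e f s g)
  case (All p)
  have "(\<lambda>i. val (case_nat a e) (up s i)) = case_nat a (\<lambda>i. val e (s i))" for a
    by (auto split: nat.split)
  then show ?case by (simp add: All.IH)
next
  case (AllS p)
  have "(\<lambda>i. case_nat X f (upS g i)) = case_nat X (\<lambda>i. f (g i))" for X
    by (auto split: nat.split)
  then show ?case by (simp add: AllS.IH)
qed (simp_all add: val_sub_tm)

lemma sat_connectives [simp]:
  "sat e f (Neg p) \<longleftrightarrow> \<not> sat e f p"
  "sat e f (Con p q) \<longleftrightarrow> sat e f p \<and> sat e f q"
  "sat e f (Dis p q) \<longleftrightarrow> sat e f p \<or> sat e f q"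
  "sat e f (Iff p q) \<longleftrightarrow> (sat e f p \<longleftrightarrow> sat e f q)"
  "sat e f (Exi p) \<longleftrightarrow> (\<exists>a. sat (case_nat a e) f p)"
  "sat e f (ExiS p) \<longleftrightarrow> (\<exists>X. sat e (case_nat X f) p)"
  by (auto simp: Neg_def Con_def Dis_def Iff_def Exi_def ExiS_def)

lemma sat_liftS [simp]: "sat e (case_nat X f) (liftS p) \<longleftrightarrow> sat e f p"
  by (simp add: liftS_def sat_sub)

lemma sat_induction_axiom:
  "sat e f (induction_axiom p) \<longleftrightarrow>
     (sat (case_nat num_zero e) f p \<and>
      (\<forall>a. sat (case_nat a e) f p \<longrightarrow> sat (case_nat (a \<oplus> num_one) e) f p) \<longrightarrow>
      (\<forall>a. sat (case_nat a e) f p))"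
proof -
  have "(\<lambda>i. val e (case_nat Zero Var i)) = case_nat num_zero e"
    "(\<lambda>i. val (case_nat a e) (case_nat (Add (Var 0) One) (\<lambda>i. Var (Suc i)) i)) =
      case_nat (a \<oplus> num_one) e" for a
    by (auto split: nat.split)
  then show ?thesis by (simp add: induction_axiom_def inst_def sat_sub)
qed

text \<open>A predicate on valuations is bounded definable if it is given by a \<open>\<Delta>\<^sup>0\<^sub>0\<close> formula with
  parameters of both sorts. A slot of the formula reads either a variable of the valuation or a
  number parameter.\<close>

definition slots :: "(nat \<Rightarrow> nat + 'm) \<Rightarrow> (nat \<Rightarrow> 'm) \<Rightarrow> nat \<Rightarrow> 'm" where
  "slots h e i = (case h i of Inl j \<Rightarrow> e j | Inr c \<Rightarrow> c)"

definition d0_term :: "((nat \<Rightarrow> 'm) \<Rightarrow> 'm) \<Rightarrow> bool" where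
  "d0_term t \<longleftrightarrow> (\<exists>u h. \<forall>e. val (slots h e) u = t e)"

definition d0 :: "((nat \<Rightarrow> 'm) \<Rightarrow> bool) \<Rightarrow> bool" where
  "d0 P \<longleftrightarrow> (\<exists>p h f. Delta0 p \<and> (\<forall>e. sat (slots h e) f p = P e))"

text \<open>Puts two formulas over a common table of parameters: one reads the even slots, the other
  the odd slots.\<close>

definition interleave :: "(nat \<Rightarrow> 'a) \<Rightarrow> (nat \<Rightarrow> 'a) \<Rightarrow> nat \<Rightarrow> 'a" where
  "interleave f g i = (if even i then f (i div 2) else g (i div 2))"

lemma interleave_simps [simp]:
  "interleave f g (2 * i) = f i" "interleave f g (Suc (2 * i)) = g i"
  by (auto simp: interleave_def)

lemma slots_interleave [simp]:
  "slots (interleave h h') e (2 * i) = slots h e i"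
  "slots (interleave h h') e (Suc (2 * i)) = slots h' e i"
  by (simp_all add: slots_def)

lemma d0_term_pair:
  assumes "d0_term t" "d0_term t'"
  obtains u u' h where "\<And>e. val (slots h e) u = t e" "\<And>e. val (slots h e) u' = t' e"
proof -
  obtain u h where u: "\<And>e. val (slots h e) u = t e" using assms(1) d0_term_def by auto
  obtain u' h' where u': "\<And>e. val (slots h' e) u' = t' e" using assms(2) d0_term_def by auto
  show thesis
    by (rule that[of "interleave h h'" "sub_tm (\<lambda>i. Var (2 * i)) u" "sub_tm (\<lambda>i. Var (Suc (2 * i))) u'"])
      (simp_all add: val_sub_tm u[symmetric] u'[symmetric])
qed

lemma d0_pair:
  assumes "d0 P" "d0 Q"
  obtains p q h f where "Delta0 p" "Delta0 q" "\<And>e. sat (slots h e) f p = P e"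
    "\<And>e. sat (slots h e) f q = Q e"
proof -
  obtain p h f where p: "Delta0 p" "\<And>e. sat (slots h e) f p = P e"
    using assms(1) d0_def by auto
  obtain q h' f' where q: "Delta0 q" "\<And>e. sat (slots h' e) f' q = Q e"
    using assms(2) d0_def by auto
  show thesis
    by (rule that[of "sub (\<lambda>i. Var (2 * i)) (\<lambda>i. 2 * i) p"
          "sub (\<lambda>i. Var (Suc (2 * i))) (\<lambda>i. Suc (2 * i)) q" "interleave h h'" "interleave f f'"])
      (simp_all add: sat_sub p(1) q(1) Delta0_sub p(2)[symmetric] q(2)[symmetric])
qed

lemma d0_term_var: "d0_term (\<lambda>e. e i)"
  unfolding d0_term_def by (intro exI[of _ "Var 0"] exI[of _ "\<lambda>_. Inl i"]) (simp add: slots_def)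

lemma d0_term_const: "d0_term (\<lambda>e. c)"
  unfolding d0_term_def by (intro exI[of _ "Var 0"] exI[of _ "\<lambda>_. Inr c"]) (simp add: slots_def)

lemma d0_term_add:
  assumes "d0_term t" "d0_term u" shows "d0_term (\<lambda>e. t e \<oplus> u e)"
  using assms
proof (rule d0_term_pair)
  fix v w h assume "\<And>e. val (slots h e) v = t e" "\<And>e. val (slots h e) w = u e"
  then show ?thesis unfolding d0_term_def
    by (intro exI[of _ "Add v w"] exI[of _ h]) simp
qed

lemma d0_term_mul:
  assumes "d0_term t" "d0_term u" shows "d0_term (\<lambda>e. t e \<otimes> u e)"
  using assms
proof (rule d0_term_pair)
  fix v w h assume "\<And>e. val (slots h e) v = t e" "\<And>e. val (slots h e) w = u e"
  then show ?thesis unfolding d0_term_def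
    by (intro exI[of _ "Mul v w"] exI[of _ h]) simp
qed

lemma d0_eq:
  assumes "d0_term t" "d0_term u" shows "d0 (\<lambda>e. t e = u e)"
  using assms
proof (rule d0_term_pair)
  fix v w h assume "\<And>e. val (slots h e) v = t e" "\<And>e. val (slots h e) w = u e"
  then show ?thesis unfolding d0_def
    by (intro exI[of _ "Eq v w"] exI[of _ h]) (simp add: Delta0.intros)
qed

lemma d0_less:
  assumes "d0_term t" "d0_term u" shows "d0 (\<lambda>e. t e \<prec> u e)"
  using assms
proof (rule d0_term_pair)
  fix v w h assume "\<And>e. val (slots h e) v = t e" "\<And>e. val (slots h e) w = u e"
  then show ?thesis unfolding d0_def
    by (intro exI[of _ "Less v w"] exI[of _ h]) (simp add: Delta0.intros)
qed

lemma d0_mem: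
  assumes "d0_term t" shows "d0 (\<lambda>e. t e \<epsilon> X)"
proof -
  obtain u h where "\<And>e. val (slots h e) u = t e" using assms d0_term_def by auto
  then show ?thesis unfolding d0_def
    by (intro exI[of _ "Mem u 0"] exI[of _ h] exI[of _ "\<lambda>_. X"]) (simp add: Delta0.intros)
qed

lemma d0_prop: "d0 (\<lambda>e. C)"
proof (cases C)
  case True
  then show ?thesis using d0_eq[OF d0_term_const[of undefined] d0_term_const[of undefined]] by simp
next
  case False
  then show ?thesis unfolding d0_def
    by (intro exI[of _ Fls]) (simp add: Delta0.intros)
qed

lemma d0_imp:
  assumes "d0 P" "d0 Q" shows "d0 (\<lambda>e. P e \<longrightarrow> Q e)"
  using assms
proof (rule d0_pair)
  fix p q h f assume "Delta0 p" "Delta0 q" "\<And>e. sat (slots h e) f p = P e"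
    "\<And>e. sat (slots h e) f q = Q e"
  then show ?thesis unfolding d0_def
    by (intro exI[of _ "Imp p q"] exI[of _ h] exI[of _ f]) (simp add: Delta0.intros)
qed

lemma d0_neg: "d0 P \<Longrightarrow> d0 (\<lambda>e. \<not> P e)"
  using d0_imp[OF _ d0_prop[of False]] by simp

lemma d0_conj: "d0 P \<Longrightarrow> d0 Q \<Longrightarrow> d0 (\<lambda>e. P e \<and> Q e)"
  using d0_neg[OF d0_imp[OF _ d0_neg]] by simp

lemma d0_disj: "d0 P \<Longrightarrow> d0 Q \<Longrightarrow> d0 (\<lambda>e. P e \<or> Q e)"
  using d0_imp[OF d0_neg] by (simp add: disj_imp)

lemma d0_iff: "d0 P \<Longrightarrow> d0 Q \<Longrightarrow> d0 (\<lambda>e. P e \<longleftrightarrow> Q e)"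
  unfolding iff_conv_conj_imp by (intro d0_conj d0_imp)

lemma d0_ball:
  assumes "d0_term t" "d0 (\<lambda>e. Q (e 0) (\<lambda>i. e (Suc i)))"
  shows "d0 (\<lambda>e. \<forall>a. a \<prec> t e \<longrightarrow> Q a e)"
proof -
  obtain u h where u: "\<And>e. val (slots h e) u = t e" using assms(1) d0_term_def by auto
  obtain p h' f where p: "Delta0 p" "\<And>e. sat (slots h' e) f p = Q (e 0) (\<lambda>i. e (Suc i))"
    using assms(2) d0_def by auto
  \<comment> \<open>In the merged table the body owns the odd slots, which the quantifier shifts by
    one more: hence \<open>Suc (Suc (2 * i))\<close>. Slots that read the bound variable go to
    \<open>Var 0\<close> instead, so the junk value of \<open>k\<close> at these slots is never
    read.\<close>
  define r where "r i = (if h' i = Inl 0 then Var 0 else Var (Suc (Suc (2 * i))))" for i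
  define k where "k i = (case h' i of Inl j \<Rightarrow> Inl (j - 1) | Inr c \<Rightarrow> Inr c)" for i
  let ?h = "interleave h k"
  let ?p = "All (Imp (Less (Var 0) (lift_tm (sub_tm (\<lambda>i. Var (2 * i)) u))) (sub r (\<lambda>i. i) p))"
  have "Delta0 ?p" using p(1) by (intro Delta0.intros Delta0_sub)
  moreover have "sat (slots ?h e) f ?p \<longleftrightarrow> (\<forall>a. a \<prec> t e \<longrightarrow> Q a e)" for e
  proof -
    have "(\<lambda>i. val (case_nat a (slots ?h e)) (r i)) = slots h' (case_nat a e)" for a
      by (auto simp: r_def k_def slots_def split: sum.split nat.split)
    then show ?thesis by (simp add: val_sub_tm sat_sub u p(2))
  qed
  ultimately show ?thesis unfolding d0_def by blast
qed

lemma d0_bex: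
  assumes "d0_term t" "d0 (\<lambda>e. Q (e 0) (\<lambda>i. e (Suc i)))"
  shows "d0 (\<lambda>e. \<exists>a. a \<prec> t e \<and> Q a e)"
  using d0_neg[OF d0_ball[of t "\<lambda>a e. \<not> Q a e", OF assms(1) d0_neg[OF assms(2)]]] by simp

lemma slots_shift:
  "slots (\<lambda>i. case h i of Inl j \<Rightarrow> Inl (Suc j) | Inr c \<Rightarrow> Inr c) e = slots h (\<lambda>i. e (Suc i))"
  by (auto simp: slots_def split: sum.split)

lemma d0_term_shift: "d0_term t \<Longrightarrow> d0_term (\<lambda>e. t (\<lambda>i. e (Suc i)))"
  unfolding d0_term_def by (metis slots_shift)

lemma d0_shift: "d0 P \<Longrightarrow> d0 (\<lambda>e. P (\<lambda>i. e (Suc i)))"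
  unfolding d0_def by (metis slots_shift)

text \<open>With these rules a HOL predicate is certified by following its syntax; below a bounded
  quantifier, entry \<open>0\<close> of the valuation is the bound variable and the others move up
  by one.\<close>

lemmas d0_intros = d0_prop d0_eq d0_less d0_mem d0_neg d0_imp d0_conj d0_disj d0_iff d0_ball d0_bex
  d0_term_var d0_term_const d0_term_add d0_term_mul

text \<open>Variables of the valuation other than \<open>0\<close> and \<open>1\<close> are frozen at an arbitrary value.\<close>

lemma slots_freeze2:
  assumes "\<And>e. sat (slots h e) f p = Q (e 0) (e 1)"
  shows "sat (case_nat y (case_nat x (slots h (\<lambda>_. undefined)))) f
      (sub (\<lambda>i. if h i = Inl 0 then Var 0 else if h i = Inl 1 then Var 1 else Var (Suc (Suc i))) (\<lambda>i. i) p)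
    \<longleftrightarrow> Q y x"
proof -
  have "sat (\<lambda>i. val (case_nat y (case_nat x (slots h (\<lambda>_. undefined))))
      (if h i = Inl 0 then Var 0 else if h i = Inl 1 then Var 1 else Var (Suc (Suc i)))) f p =
    sat (slots h (case_nat y (case_nat x (\<lambda>_. undefined)))) f p"
    by (rule arg_cong[where f = "\<lambda>e. sat e f p"])
      (auto simp: slots_def split: sum.split nat.split)
  then show ?thesis by (simp add: sat_sub assms)
qed

lemma d0_pair2:
  assumes "d0 (\<lambda>e. P (e 0) (e 1))" "d0 (\<lambda>e. Q (e 0) (e 1))"
  obtains p q e f where "Delta0 p" "Delta0 q"
    "\<And>y x. sat (case_nat y (case_nat x e)) f p = P y x"
    "\<And>y x. sat (case_nat y (case_nat x e)) f q = Q y x"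
proof -
  obtain p q h f where pq: "Delta0 p" "Delta0 q" "\<And>e. sat (slots h e) f p = P (e 0) (e 1)"
    "\<And>e. sat (slots h e) f q = Q (e 0) (e 1)"
    using d0_pair[OF assms] by metis
  show thesis
    by (rule that[OF Delta0_sub[OF pq(1)] Delta0_sub[OF pq(2)]
          slots_freeze2[of h f p P, OF pq(3)] slots_freeze2[of h f q Q, OF pq(4)]])
qed

end

section \<open>The axiom schemes as rules about bounded definable predicates\<close>

locale rca0_model = l2_structure num_zero num_one num_add num_mul num_less num_mem
  for num_zero :: 'm ("\<zero>") and num_one :: 'm ("\<one>")
    and num_add :: "'m \<Rightarrow> 'm \<Rightarrow> 'm" (infixl "\<oplus>" 65)
    and num_mul :: "'m \<Rightarrow> 'm \<Rightarrow> 'm" (infixl "\<otimes>" 70)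
    and num_less :: "'m \<Rightarrow> 'm \<Rightarrow> bool" (infix "\<prec>" 50)
    and num_mem :: "'m \<Rightarrow> 's \<Rightarrow> bool" (infix "\<epsilon>" 50) +
  assumes RCA0: "p \<in> RCA0 \<Longrightarrow> sat e f p"
begin

text \<open>Entry \<open>0\<close> is the existential witness and entry \<open>1\<close> the
  induction variable, in the order in which \<open>Exi\<close> and the induction axiom bind
  them.\<close>

lemma sigma1_induct [consumes 0, case_names definable zero step]:
  assumes "d0 (\<lambda>e. Q (e 0) (e 1))" and "\<exists>y. Q y \<zero>" and "\<And>x. \<exists>y. Q y x \<Longrightarrow> \<exists>y. Q y (x \<oplus> \<one>)"
  shows "\<exists>y. Q y x"
proof -
  obtain p e f where p: "Delta0 p" "\<And>y x. sat (case_nat y (case_nat x e)) f p = Q y x"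
    using d0_pair2[OF assms(1) assms(1)] by metis
  have "induction_axiom (Exi p) \<in> RCA0"
    using Sigma1.intros[OF p(1)] unfolding RCA0_def by blast
  then have "sat e f (induction_axiom (Exi p))" by (rule RCA0)
  then show ?thesis using assms(2,3) by (simp add: sat_induction_axiom p(2))
qed

lemma d0_induct [consumes 0, case_names definable zero step]:
  assumes "d0 (\<lambda>e. P (e 0))" and "P \<zero>" and "\<And>x. P x \<Longrightarrow> P (x \<oplus> \<one>)"
  shows "P x"
proof -
  have "d0 (\<lambda>e. P (e 1))" using d0_shift[OF assms(1)] by simp
  then show ?thesis
    using sigma1_induct[of "\<lambda>_. P"] assms(2,3) by simp
qed

lemma delta1_comprehension:
  assumes "d0 (\<lambda>e. P (e 0) (e 1))" "d0 (\<lambda>e. Q (e 0) (e 1))"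
    and "\<And>x. (\<exists>y. P y x) \<longleftrightarrow> (\<forall>y. Q y x)"
  shows "\<exists>X. \<forall>x. x \<epsilon> X \<longleftrightarrow> (\<exists>y. P y x)"
proof -
  obtain p q e f where p: "Delta0 p" "Delta0 q"
    "\<And>y x. sat (case_nat y (case_nat x e)) f p = P y x"
    "\<And>y x. sat (case_nat y (case_nat x e)) f q = Q y x"
    using d0_pair2[OF assms(1,2)] by metis
  have "comprehension_axiom (Exi p) (All q) \<in> RCA0"
    using Sigma1.intros[OF p(1)] Pi1.intros[OF p(2)] unfolding RCA0_def by blast
  then have "sat e f (comprehension_axiom (Exi p) (All q))" by (rule RCA0)
  then show ?thesis using assms(3) by (simp add: comprehension_axiom_def p(3,4))
qed

lemma d0_comprehension:
  assumes "d0 (\<lambda>e. P (e 0))"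
  shows "\<exists>X. \<forall>x. x \<epsilon> X \<longleftrightarrow> P x"
proof -
  have "d0 (\<lambda>e. P (e 1))" using d0_shift[OF assms] by simp
  then show ?thesis
    using delta1_comprehension[of "\<lambda>_. P" "\<lambda>_. P"] by simp
qed

lemma basic_axioms:
  "x \<oplus> \<one> \<noteq> \<zero>" "x \<oplus> \<one> = y \<oplus> \<one> \<longleftrightarrow> x = y" "x \<oplus> \<zero> = x" "x \<oplus> (y \<oplus> \<one>) = (x \<oplus> y) \<oplus> \<one>"
  "x \<otimes> \<zero> = \<zero>" "x \<otimes> (y \<oplus> \<one>) = x \<otimes> y \<oplus> x" "\<not> x \<prec> \<zero>" "x \<prec> y \<oplus> \<one> \<longleftrightarrow> x \<prec> y \<or> x = y"
proof -
  have *: "sat (case_nat a (\<lambda>_. b)) undefined p" if "p \<in> basic_axioms" for p a b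
    using that RCA0 unfolding RCA0_def by blast
  show "x \<oplus> \<one> \<noteq> \<zero>"
    using *[of "Neg (Eq (Add (Var 1) One) Zero)" x x] by (simp add: basic_axioms_def Let_def)
  show "x \<oplus> \<one> = y \<oplus> \<one> \<longleftrightarrow> x = y"
    using *[of "Imp (Eq (Add (Var 0) One) (Add (Var 1) One)) (Eq (Var 0) (Var 1))" x y]
    by (auto simp add: basic_axioms_def Let_def)
  show "x \<oplus> \<zero> = x"
    using *[of "Eq (Add (Var 0) Zero) (Var 0)" x x] by (simp add: basic_axioms_def Let_def)
  show "x \<oplus> (y \<oplus> \<one>) = (x \<oplus> y) \<oplus> \<one>"
    using *[of "Eq (Add (Var 0) (Add (Var 1) One)) (Add (Add (Var 0) (Var 1)) One)" x y]
    by (simp add: basic_axioms_def Let_def)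
  show "x \<otimes> \<zero> = \<zero>"
    using *[of "Eq (Mul (Var 0) Zero) Zero" x x] by (simp add: basic_axioms_def Let_def)
  show "x \<otimes> (y \<oplus> \<one>) = x \<otimes> y \<oplus> x"
    using *[of "Eq (Mul (Var 0) (Add (Var 1) One)) (Add (Mul (Var 0) (Var 1)) (Var 0))" x y]
    by (simp add: basic_axioms_def Let_def)
  show "\<not> x \<prec> \<zero>"
    using *[of "Neg (Less (Var 0) Zero)" x x] by (simp add: basic_axioms_def Let_def)
  show "x \<prec> y \<oplus> \<one> \<longleftrightarrow> x \<prec> y \<or> x = y"
    using *[of "Iff (Less (Var 0) (Add (Var 1) One)) (Dis (Less (Var 0) (Var 1)) (Eq (Var 0) (Var 1)))" x y]
    by (simp add: basic_axioms_def Let_def)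
qed

end

section \<open>Arithmetic in a model\<close>

context rca0_model
begin

lemma num_add_assoc: "(x \<oplus> y) \<oplus> z = x \<oplus> (y \<oplus> z)"
proof (induction z rule: d0_induct)
  case definable
  show ?case by (intro d0_intros)
qed (simp_all add: basic_axioms)

lemma num_zero_add: "\<zero> \<oplus> x = x"
proof (induction x rule: d0_induct)
  case definable
  show ?case by (intro d0_intros)
qed (simp_all add: basic_axioms)

lemma num_one_add: "\<one> \<oplus> x = x \<oplus> \<one>"
proof (induction x rule: d0_induct)
  case definable
  show ?case by (intro d0_intros)
qed (simp_all add: basic_axioms num_zero_add)

lemma num_add_commute: "x \<oplus> y = y \<oplus> x"
proof (induction y rule: d0_induct)
  case definable
  show ?case by (intro d0_intros)
next
  case (step y)
  then show ?case by (metis basic_axioms(4) num_add_assoc num_one_add)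
qed (simp add: basic_axioms num_zero_add)

lemma num_add_cancel: "x \<oplus> y = x \<oplus> z \<Longrightarrow> y = z"
proof -
  have "y \<oplus> x = z \<oplus> x \<longrightarrow> y = z"
  proof (induction x rule: d0_induct)
    case definable
    show ?case by (intro d0_intros)
  next
    case (step x)
    then show ?case by (simp add: basic_axioms(2,4))
  qed (simp add: basic_axioms)
  then show "x \<oplus> y = x \<oplus> z \<Longrightarrow> y = z" using num_add_commute by metis
qed

lemma num_distrib: "(x \<oplus> y) \<otimes> z = x \<otimes> z \<oplus> y \<otimes> z"
proof (induction z rule: d0_induct)
  case definable
  show ?case by (intro d0_intros)
next
  case (step z)
  then show ?case by (simp add: basic_axioms) (metis num_add_assoc num_add_commute)
qed (simp add: basic_axioms)

lemma num_zero_mul: "\<zero> \<otimes> x = \<zero>"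
proof (induction x rule: d0_induct)
  case definable
  show ?case by (intro d0_intros)
qed (simp_all add: basic_axioms)

lemma num_one_mul: "\<one> \<otimes> x = x"
proof (induction x rule: d0_induct)
  case definable
  show ?case by (intro d0_intros)
qed (simp_all add: basic_axioms)

lemma num_mul_commute: "x \<otimes> y = y \<otimes> x"
proof (induction y rule: d0_induct)
  case definable
  show ?case by (intro d0_intros)
qed (simp_all add: basic_axioms num_zero_mul num_distrib num_one_mul)

lemma num_mul_assoc: "(x \<otimes> y) \<otimes> z = x \<otimes> (y \<otimes> z)"
proof (induction z rule: d0_induct)
  case definable
  show ?case by (intro d0_intros)
next
  case (step z)
  have "x \<otimes> (a \<oplus> b) = x \<otimes> a \<oplus> x \<otimes> b" for a b
    using num_distrib num_mul_commute by metis
  then show ?case using step by (simp add: basic_axioms)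
qed (simp add: basic_axioms)

lemma num_cases: "x = \<zero> \<or> (\<exists>y. x = y \<oplus> \<one>)"
proof -
  have "\<exists>y. x = \<zero> \<or> x = y \<oplus> \<one>"
  proof (induction x rule: sigma1_induct)
    case definable
    show ?case by (intro d0_intros)
  qed auto
  then show ?thesis by blast
qed

section \<open>Order and the ordered semiring structure\<close>

lemma num_less_iff: "x \<prec> y \<longleftrightarrow> (\<exists>z. y = (x \<oplus> z) \<oplus> \<one>)"
proof
  \<comment> \<open>The hypothesis stands below the quantifier so that the induction formula has the
    shape required by Sigma^0_1 induction.\<close>
  have "\<exists>z. x \<prec> y \<longrightarrow> y = (x \<oplus> z) \<oplus> \<one>"
  proof (induction y rule: sigma1_induct)
    case definable
    show ?case by (intro d0_intros)
  next
    case (step y)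
    then obtain z where z: "x \<prec> y \<longrightarrow> y = (x \<oplus> z) \<oplus> \<one>" by blast
    show ?case
    proof (cases "x \<prec> y")
      case True
      then show ?thesis using z by (intro exI[of _ "z \<oplus> \<one>"]) (simp add: basic_axioms(4))
    next
      case False
      then show ?thesis by (intro exI[of _ \<zero>]) (simp add: basic_axioms)
    qed
  qed (simp add: basic_axioms)
  then show "x \<prec> y \<Longrightarrow> \<exists>z. y = (x \<oplus> z) \<oplus> \<one>" by blast
next
  have "x \<prec> (x \<oplus> z) \<oplus> \<one>" for z
  proof (induction z rule: d0_induct)
    case definable
    show ?case by (intro d0_intros)
  qed (simp_all add: basic_axioms)
  then show "\<exists>z. y = (x \<oplus> z) \<oplus> \<one> \<Longrightarrow> x \<prec> y" by blast
qed

lemma num_less_linear: "x \<prec> y \<or> x = y \<or> y \<prec> x"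
proof (induction x rule: d0_induct)
  case definable
  show ?case by (intro d0_intros)
next
  case zero
  then show ?case using num_cases[of y] by (auto simp: num_less_iff num_zero_add)
next
  case (step x)
  have "x \<oplus> \<one> \<prec> y \<or> x \<oplus> \<one> = y" if less: "x \<prec> y"
  proof -
    obtain z where z: "y = (x \<oplus> z) \<oplus> \<one>" using num_less_iff[THEN iffD1, OF less] by blast
    show ?thesis
    proof (cases "z = \<zero>")
      case True
      then show ?thesis using z basic_axioms(3) by metis
    next
      case False
      then obtain w where w: "z = w \<oplus> \<one>" using num_cases by blast
      have "y = ((x \<oplus> \<one>) \<oplus> w) \<oplus> \<one>"
        unfolding z w num_one_add[symmetric, of w] num_add_assoc ..
      then show ?thesis using num_less_iff[of "x \<oplus> \<one>" y] by blast
    qed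
  qed
  then show ?case using step basic_axioms(8)[of y x] by blast
qed

definition num_le :: "'m \<Rightarrow> 'm \<Rightarrow> bool" (infix "\<preceq>" 50) where
  "x \<preceq> y \<longleftrightarrow> x \<prec> y \<or> x = y"

text \<open>Truncated subtraction completes the signature of \<open>linordered_semidom\<close>. It
  is not a term of the language and is therefore kept out of bounded formulas.\<close>

definition num_minus :: "'m \<Rightarrow> 'm \<Rightarrow> 'm" (infixl "\<ominus>" 65) where
  "x \<ominus> y = (if \<exists>z. x = y \<oplus> z then THE z. x = y \<oplus> z else \<zero>)"

lemma num_le_iff: "x \<preceq> y \<longleftrightarrow> (\<exists>z. y = x \<oplus> z)"
  unfolding num_le_def num_less_iff using num_cases
  by (metis basic_axioms(3) num_add_assoc)

lemma num_le_antisym: "x \<preceq> y \<Longrightarrow> y \<preceq> x \<Longrightarrow> x = y"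
proof -
  assume "x \<preceq> y" "y \<preceq> x"
  then obtain z w where zw: "y = x \<oplus> z" "x = y \<oplus> w" using num_le_iff by auto
  then have "x \<oplus> (z \<oplus> w) = x \<oplus> \<zero>" by (metis num_add_assoc basic_axioms(3))
  then have "z \<oplus> w = \<zero>" by (rule num_add_cancel)
  then have "w = \<zero>" using num_cases[of w] basic_axioms(1,4) by metis
  then show ?thesis using zw(2) by (simp add: basic_axioms(3))
qed

lemma num_less_le: "x \<prec> y \<longleftrightarrow> x \<preceq> y \<and> \<not> y \<preceq> x"
proof -
  have "\<not> x \<prec> x" for x
  proof
    assume "x \<prec> x"
    then obtain z where "x \<oplus> (z \<oplus> \<one>) = x \<oplus> \<zero>"
      by (metis basic_axioms(3,4) num_less_iff)
    then show False using num_add_cancel basic_axioms(1) by blast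
  qed
  then show ?thesis using num_le_antisym num_le_def by metis
qed

lemma num_add_minus: "(x \<oplus> y) \<ominus> x = y"
proof -
  have "(THE z. x \<oplus> y = x \<oplus> z) = y" using num_add_cancel by blast
  then show ?thesis unfolding num_minus_def by auto
qed

lemma num_minus_not_le: "\<not> y \<preceq> x \<Longrightarrow> x \<ominus> y = \<zero>"
  by (auto simp: num_minus_def num_le_iff)

lemma num_mul_strict_mono:
  assumes "x \<prec> y" "\<zero> \<prec> z"
  shows "z \<otimes> x \<prec> z \<otimes> y"
proof -
  obtain a b where "y = (x \<oplus> a) \<oplus> \<one>" "z = b \<oplus> \<one>"
    using assms by (metis basic_axioms(3) num_add_commute num_less_iff)
  then have "z \<otimes> y = (z \<otimes> x \<oplus> (z \<otimes> a \<oplus> b)) \<oplus> \<one>"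
    by (metis basic_axioms(4,6) num_add_assoc num_distrib num_mul_commute)
  then show ?thesis using num_less_iff[of "z \<otimes> x" "z \<otimes> y"] by blast
qed

lemma num_minus_minus: "x \<ominus> y \<ominus> z = x \<ominus> (y \<oplus> z)"
proof (cases "y \<oplus> z \<preceq> x")
  case True
  then obtain w where "x = y \<oplus> (z \<oplus> w)" using num_le_iff num_add_assoc by metis
  then show ?thesis by (metis num_add_assoc num_add_minus)
next
  case False
  show ?thesis
  proof (cases "y \<preceq> x")
    case True
    then obtain w where w: "x = y \<oplus> w" using num_le_iff by auto
    then have "\<not> z \<preceq> w" using False num_le_iff num_add_assoc by metis
    then show ?thesis using w False by (simp add: num_add_minus num_minus_not_le)
  next
    case y: False
    have "\<zero> \<ominus> z = \<zero>"
      using num_minus_not_le num_add_minus[of z \<zero>] num_le_antisym[of z \<zero>] num_le_iff[of \<zero> z] num_zero_add basic_axioms(3)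
      by metis
    then show ?thesis using y False by (simp add: num_minus_not_le)
  qed
qed

lemma num_mul_minus: "x \<otimes> (y \<ominus> z) = x \<otimes> y \<ominus> x \<otimes> z"
proof (cases "z \<preceq> y")
  case True
  then obtain w where w: "y = z \<oplus> w" using num_le_iff by auto
  moreover have "x \<otimes> y = x \<otimes> z \<oplus> x \<otimes> w" unfolding w by (metis num_distrib num_mul_commute)
  ultimately show ?thesis by (simp add: num_add_minus)
next
  case False
  show ?thesis
  proof (cases "x = \<zero>")
    case True
    then show ?thesis using num_add_minus[of \<zero> \<zero>] by (simp add: num_zero_mul num_zero_add)
  next
    case x: False
    then have "\<zero> \<prec> x" using num_cases[of x] by (auto simp: num_less_iff num_zero_add)
    moreover have "y \<prec> z" using False num_less_linear num_le_def by blast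
    ultimately have "\<not> x \<otimes> z \<preceq> x \<otimes> y" using num_mul_strict_mono num_less_le by blast
    then show ?thesis using False by (simp add: num_minus_not_le basic_axioms(5))
  qed
qed

text \<open>Transfers the general theory of ordered semirings to an arbitrary, possibly nonstandard,
  model.\<close>

sublocale M: linordered_semidom num_add num_minus num_le num_less num_zero num_mul num_one
proof unfold_locales
  fix a b c :: 'm
  show "a \<oplus> b \<oplus> c = a \<oplus> (b \<oplus> c)" by (rule num_add_assoc)
  show "a \<oplus> b = b \<oplus> a" by (rule num_add_commute)
  show "a \<oplus> b \<ominus> a = b" by (rule num_add_minus)
  show "a \<ominus> b \<ominus> c = a \<ominus> (b \<oplus> c)" by (rule num_minus_minus)
  show "\<zero> \<oplus> a = a" by (rule num_zero_add)
  show "a \<otimes> b \<otimes> c = a \<otimes> (b \<otimes> c)" by (rule num_mul_assoc)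
  show "a \<otimes> b = b \<otimes> a" by (rule num_mul_commute)
  show "\<one> \<otimes> a = a" by (rule num_one_mul)
  show "(a \<oplus> b) \<otimes> c = a \<otimes> c \<oplus> b \<otimes> c" by (rule num_distrib)
  show "a \<otimes> (b \<oplus> c) = a \<otimes> b \<oplus> a \<otimes> c" by (metis num_distrib num_mul_commute)
  show "\<zero> \<otimes> a = \<zero>" by (rule num_zero_mul)
  show "a \<otimes> \<zero> = \<zero>" by (rule basic_axioms)
  show "\<zero> \<noteq> \<one>" by (metis basic_axioms(1) num_zero_add)
  show "a \<otimes> (b \<ominus> c) = a \<otimes> b \<ominus> a \<otimes> c" by (rule num_mul_minus)
  show "(a \<prec> b) = (a \<preceq> b \<and> \<not> b \<preceq> a)" by (rule num_less_le)
  show "a \<preceq> a" by (simp add: num_le_def)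
  show "a \<preceq> b \<Longrightarrow> b \<preceq> c \<Longrightarrow> a \<preceq> c" by (metis num_le_iff num_add_assoc)
  show "a \<preceq> b \<Longrightarrow> b \<preceq> a \<Longrightarrow> a = b" by (rule num_le_antisym)
  show "a \<preceq> b \<or> b \<preceq> a" using num_less_linear num_le_def by blast
  show "a \<preceq> b \<Longrightarrow> c \<oplus> a \<preceq> c \<oplus> b" by (metis num_le_iff num_add_assoc)
  show "a \<prec> b \<Longrightarrow> \<zero> \<prec> c \<Longrightarrow> c \<otimes> a \<prec> c \<otimes> b" by (rule num_mul_strict_mono)
  show "\<zero> \<prec> \<one>" using basic_axioms(8)[of \<zero> \<zero>] by (simp add: num_zero_add)
  show "b \<preceq> a \<Longrightarrow> a \<ominus> b \<oplus> b = a" by (metis num_add_commute num_add_minus num_le_iff)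
  show "a \<noteq> \<zero> \<Longrightarrow> b \<noteq> \<zero> \<Longrightarrow> a \<otimes> b \<noteq> \<zero>"
    using num_cases[of a] num_cases[of b] by (auto simp: basic_axioms basic_axioms(1)[THEN not_sym])
qed

lemma less_add_one_iff: "x \<prec> y \<oplus> \<one> \<longleftrightarrow> x \<preceq> y"
  by (simp add: basic_axioms(8) num_le_def)

lemma add_one_le_iff: "x \<oplus> \<one> \<preceq> y \<longleftrightarrow> x \<prec> y"
  using less_add_one_iff[of y x] by (metis M.not_le)

lemma zero_le [simp]: "\<zero> \<preceq> x"
  using basic_axioms(7) M.not_le by blast

lemma d0_le: "d0_term t \<Longrightarrow> d0_term u \<Longrightarrow> d0 (\<lambda>e. t e \<preceq> u e)"
  unfolding less_add_one_iff[symmetric] by (intro d0_intros)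

lemma d0_ball_le:
  "d0_term t \<Longrightarrow> d0 (\<lambda>e. Q (e 0) (\<lambda>i. e (Suc i))) \<Longrightarrow> d0 (\<lambda>e. \<forall>a. a \<preceq> t e \<longrightarrow> Q a e)"
  unfolding less_add_one_iff[symmetric] by (intro d0_intros)

lemma d0_bex_le:
  "d0_term t \<Longrightarrow> d0 (\<lambda>e. Q (e 0) (\<lambda>i. e (Suc i))) \<Longrightarrow> d0 (\<lambda>e. \<exists>a. a \<preceq> t e \<and> Q a e)"
  unfolding less_add_one_iff[symmetric] by (intro d0_intros)

subsection \<open>Pairs\<close>

definition num_pair :: "'m \<Rightarrow> 'm \<Rightarrow> 'm" where
  "num_pair x y = (x \<oplus> y) \<otimes> (x \<oplus> y) \<oplus> x"

lemma d0_term_num_pair: "d0_term t \<Longrightarrow> d0_term u \<Longrightarrow> d0_term (\<lambda>e. num_pair (t e) (u e))"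
  unfolding num_pair_def by (intro d0_intros)

lemma le_square: "x \<preceq> x \<otimes> x"
proof (cases "x = \<zero>")
  case False
  then have "\<one> \<preceq> x" using add_one_le_iff[of \<zero> x] zero_le[of x] by (simp add: M.less_le)
  then show ?thesis using M.mult_left_mono[of \<one> x x] by simp
qed simp

lemma le_num_pair: "x \<preceq> num_pair x y" "y \<preceq> num_pair x y"
proof -
  have "y \<preceq> x \<oplus> y" using M.add_right_mono[of \<zero> x y] by simp
  also have "\<dots> \<preceq> (x \<oplus> y) \<otimes> (x \<oplus> y)" by (rule le_square)
  also have "\<dots> \<preceq> num_pair x y"
    unfolding num_pair_def using M.add_left_mono[OF zero_le] by simp
  finally show "y \<preceq> num_pair x y" .
  show "x \<preceq> num_pair x y"
    unfolding num_pair_def using M.add_right_mono[OF zero_le] by simp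
qed

text \<open>The pairs with sum \<open>s\<close> have codes between \<open>s^2\<close> and
  \<open>s^2 + s\<close>, and this interval ends before \<open>(s + 1)^2\<close>. Both injectivity
  of pairing and the bound on pairs of small numbers follow from this.\<close>

lemma num_pair_sum_less:
  assumes "x \<oplus> y \<prec> x' \<oplus> y'"
  shows "num_pair x y \<prec> num_pair x' y'"
proof -
  let ?s = "x \<oplus> y" and ?t = "x' \<oplus> y'"
  have "x \<preceq> ?s" using M.add_left_mono[OF zero_le[of y], of x] by simp
  then have "num_pair x y \<preceq> ?s \<otimes> ?s \<oplus> ?s"
    unfolding num_pair_def by (rule M.add_left_mono)
  also have "\<dots> \<prec> (?s \<oplus> \<one>) \<otimes> (?s \<oplus> \<one>)"
  proof -
    have "(?s \<oplus> \<one>) \<otimes> (?s \<oplus> \<one>) = (?s \<otimes> ?s \<oplus> ?s) \<oplus> (?s \<oplus> \<one>)"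
      by (simp only: M.distrib_left M.distrib_right M.mult_1_left M.mult_1_right M.add.assoc M.add.commute M.add.left_commute)
    moreover have "\<zero> \<prec> ?s \<oplus> \<one>" by (simp only: less_add_one_iff zero_le)
    ultimately show ?thesis
      using M.add_strict_left_mono[of \<zero> "?s \<oplus> \<one>" "?s \<otimes> ?s \<oplus> ?s"] by (simp only: M.add_0_right)
  qed
  also have "\<dots> \<preceq> ?t \<otimes> ?t"
    using assms by (intro M.mult_mono) (simp_all only: add_one_le_iff zero_le)
  also have "\<dots> \<preceq> num_pair x' y'"
    unfolding num_pair_def using M.add_left_mono[OF zero_le] by simp
  finally show ?thesis .
qed

lemma num_pair_eq [simp]: "num_pair x y = num_pair x' y' \<longleftrightarrow> x = x' \<and> y = y'"
proof
  assume *: "num_pair x y = num_pair x' y'"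
  then have s: "x \<oplus> y = x' \<oplus> y'"
    using num_pair_sum_less[of x y x' y'] num_pair_sum_less[of x' y' x y] M.less_irrefl
      M.less_linear by metis
  then have "x = x'" using * unfolding num_pair_def by simp
  then show "x = x' \<and> y = y'" using s by simp
qed simp

lemma num_pair_mono:
  assumes "x \<preceq> x'" "y \<preceq> y'"
  shows "num_pair x y \<preceq> num_pair x' y'"
  unfolding num_pair_def using assms by (intro M.add_mono M.mult_mono zero_le)

end

section \<open>Codes of finite sets\<close>

context rca0_model
begin

lemma le_add: "x \<preceq> x \<oplus> y" "y \<preceq> x \<oplus> y"
  using M.add_left_mono[OF zero_le[of y], of x] M.add_right_mono[OF zero_le[of x], of y] by simp_all

text \<open>If there were no least element up to \<open>x\<close>, induction on \<open>x'\<close>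
  would show that nothing below \<open>x'\<close> satisfies \<open>P\<close>, as long as
  \<open>x'\<close> is at most \<open>x + 1\<close>; at \<open>x + 1\<close> this contradicts
  \<open>P x\<close>.\<close>

lemma d0_least:
  assumes "d0 (\<lambda>e. P (e 0))" "P x"
  shows "\<exists>y. P y \<and> y \<preceq> x \<and> (\<forall>z. z \<prec> y \<longrightarrow> \<not> P z)"
proof (rule ccontr)
  obtain X where X: "\<And>x. x \<epsilon> X \<longleftrightarrow> P x" using d0_comprehension[OF assms(1)] by blast
  assume *: "\<not> ?thesis"
  have "x' \<preceq> x \<oplus> \<one> \<longrightarrow> (\<forall>z. z \<prec> x' \<longrightarrow> \<not> z \<epsilon> X)" for x'
  proof (induction x' rule: d0_induct)
    case definable
    show ?case by (intro d0_intros d0_le)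
  next
    case zero
    show ?case by (simp add: basic_axioms(7))
  next
    case (step x')
    show ?case
    proof (intro impI allI)
      fix z assume "x' \<oplus> \<one> \<preceq> x \<oplus> \<one>" and z: "z \<prec> x' \<oplus> \<one>"
      then have x': "x' \<preceq> x" by simp
      then have "x' \<preceq> x \<oplus> \<one>" using less_add_one_iff M.less_imp_le by blast
      then have "\<And>z. z \<prec> x' \<Longrightarrow> \<not> z \<epsilon> X" using step by blast
      then show "\<not> z \<epsilon> X" using * x' z X basic_axioms(8) by blast
    qed
  qed
  from this[of "x \<oplus> \<one>"] show False using assms(2) X basic_axioms(8) by auto
qed

section \<open>Divisibility and the beta function\<close>

definition num_dvd :: "'m \<Rightarrow> 'm \<Rightarrow> bool" where
  "num_dvd a b \<longleftrightarrow> (\<exists>q. b = a \<otimes> q)"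

lemma le_mul: "\<zero> \<prec> a \<Longrightarrow> q \<preceq> a \<otimes> q"
  using M.mult_right_mono[of \<one> a q] add_one_le_iff[of \<zero> a] by simp

lemma num_dvd_bounded: "num_dvd a b \<longleftrightarrow> (\<exists>q. q \<preceq> b \<and> b = a \<otimes> q)"
proof
  assume "num_dvd a b"
  then obtain q where q: "b = a \<otimes> q" unfolding num_dvd_def by blast
  show "\<exists>q. q \<preceq> b \<and> b = a \<otimes> q"
  \<comment> \<open>For a zero divisor the given quotient need not be bounded by the product, so it
    is replaced by zero.\<close>
  proof (cases "a = \<zero>")
    case True
    then show ?thesis using q by (intro exI[of _ \<zero>]) simp
  next
    case False
    then have "\<zero> \<prec> a" using zero_le[of a] by (simp add: M.less_le)
    then show ?thesis using q le_mul by blast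
  qed
qed (auto simp: num_dvd_def)

lemma d0_dvd: "d0_term t \<Longrightarrow> d0_term u \<Longrightarrow> d0 (\<lambda>e. num_dvd (t e) (u e))"
  unfolding num_dvd_bounded by (intro d0_intros d0_bex_le d0_term_shift)

lemma num_dvd_mult: "num_dvd a b \<Longrightarrow> num_dvd a (b \<otimes> c)"
  unfolding num_dvd_def by (metis M.mult.assoc)

lemma num_dvd_mult2: "num_dvd a b \<Longrightarrow> num_dvd a (c \<otimes> b)"
  using num_dvd_mult M.mult.commute by metis

lemma num_dvd_add_iff:
  assumes "num_dvd a b"
  shows "num_dvd a (b \<oplus> c) \<longleftrightarrow> num_dvd a c"
proof
  assume "num_dvd a (b \<oplus> c)"
  then obtain p q where "b = a \<otimes> p" "b \<oplus> c = a \<otimes> q" using assms num_dvd_def by auto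
  then have "c = a \<otimes> (q \<ominus> p)" using num_mul_minus num_add_minus by metis
  then show "num_dvd a c" unfolding num_dvd_def by blast
next
  assume "num_dvd a c"
  then show "num_dvd a (b \<oplus> c)" using assms unfolding num_dvd_def by (metis M.distrib_left)
qed

text \<open>Products of variable length are not terms of the language, so the multiple is built by
  Sigma^0_1 induction. It is needed for the numbers \<open>i + 1\<close>, which makes the moduli
  coprime, and for the moduli themselves, which gives a uniform bound.\<close>

lemma common_multiple:
  assumes g: "d0_term (\<lambda>e. g (e 0))" and pos: "\<And>i. \<zero> \<prec> g i"
  shows "\<exists>N. \<zero> \<prec> N \<and> (\<forall>i. i \<prec> b \<longrightarrow> num_dvd (g i) N)"
proof (induction b rule: sigma1_induct)
  case definable
  show ?case by (intro d0_intros d0_dvd g)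
next
  case zero
  show ?case by (intro exI[of _ \<one>]) (simp add: basic_axioms(7))
next
  case (step b)
  then obtain N where N: "\<zero> \<prec> N" "\<And>i. i \<prec> b \<Longrightarrow> num_dvd (g i) N" by blast
  have "num_dvd (g b) (N \<otimes> g b)" unfolding num_dvd_def using M.mult.commute by blast
  then show ?case
    using N pos by (intro exI[of _ "N \<otimes> g b"]) (auto simp: basic_axioms(8) intro: num_dvd_mult)
qed

definition beta :: "'m \<Rightarrow> 'm \<Rightarrow> 'm" where
  "beta m i = m \<otimes> (i \<oplus> \<one>) \<oplus> \<one>"

lemma d0_term_beta: "d0_term t \<Longrightarrow> d0_term u \<Longrightarrow> d0_term (\<lambda>e. beta (t e) (u e))"
  unfolding beta_def by (intro d0_intros)

lemma beta_pos: "\<zero> \<prec> beta m i"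
  unfolding beta_def less_add_one_iff by (rule zero_le)

text \<open>Coprimality of two moduli without a theory of gcds. The numbers
  \<open>(i + 1) beta m j\<close> and \<open>(j + 1) beta m i\<close> differ by the distance of
  \<open>i\<close> and \<open>j\<close>. So \<open>beta m i\<close> divides \<open>n\<close> times
  this distance, hence \<open>n m\<close>, since the distance divides \<open>m\<close>, and hence
  \<open>n\<close>, since \<open>n beta m i = n m (i + 1) + n\<close>.\<close>

lemma num_dvd_beta_cancel_less:
  assumes b: "\<And>i. i \<prec> b \<Longrightarrow> num_dvd (i \<oplus> \<one>) m"
    and d: "i = j \<oplus> (d \<oplus> \<one>) \<or> j = i \<oplus> (d \<oplus> \<one>)" "d \<prec> b"
    and dvd: "num_dvd (beta m i) (n \<otimes> beta m j)"
  shows "num_dvd (beta m i) n"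
proof -
  let ?d = "d \<oplus> \<one>"
  have 1: "num_dvd (beta m i) (n \<otimes> ((i \<oplus> \<one>) \<otimes> beta m j))"
    using num_dvd_mult2[OF dvd, of "i \<oplus> \<one>"] by (simp only: M.mult.left_commute)
  have 2: "num_dvd (beta m i) (n \<otimes> ((j \<oplus> \<one>) \<otimes> beta m i))"
    unfolding num_dvd_def by (metis M.mult.commute M.mult.assoc)
  have "num_dvd (beta m i) (n \<otimes> ?d)"
    using d(1)
  proof
    assume i: "i = j \<oplus> ?d"
    have "(i \<oplus> \<one>) \<otimes> beta m j = (j \<oplus> \<one>) \<otimes> beta m i \<oplus> ?d"
      unfolding beta_def i
      by (simp only: M.distrib_left M.distrib_right M.mult_1_left M.mult_1_right
          M.add.assoc M.add.commute M.add.left_commute M.mult.assoc M.mult.commute M.mult.left_commute)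
    then show ?thesis using 1 num_dvd_add_iff[OF 2] by (simp only: M.distrib_left)
  next
    assume j: "j = i \<oplus> ?d"
    have "(j \<oplus> \<one>) \<otimes> beta m i = (i \<oplus> \<one>) \<otimes> beta m j \<oplus> ?d"
      unfolding beta_def j
      by (simp only: M.distrib_left M.distrib_right M.mult_1_left M.mult_1_right
          M.add.assoc M.add.commute M.add.left_commute M.mult.assoc M.mult.commute M.mult.left_commute)
    then show ?thesis using 2 num_dvd_add_iff[OF 1] by (simp only: M.distrib_left)
  qed
  moreover obtain q where "m = ?d \<otimes> q" using b[OF d(2)] num_dvd_def by auto
  ultimately have "num_dvd (beta m i) (n \<otimes> m)"
    using num_dvd_mult M.mult.assoc by metis
  then have "num_dvd (beta m i) (n \<otimes> m \<otimes> (i \<oplus> \<one>))" by (rule num_dvd_mult)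
  moreover have "n \<otimes> beta m i = n \<otimes> m \<otimes> (i \<oplus> \<one>) \<oplus> n"
    unfolding beta_def by (simp only: M.distrib_left M.mult_1_right M.mult.assoc)
  moreover have "num_dvd (beta m i) (n \<otimes> beta m i)"
    unfolding num_dvd_def using M.mult.commute by blast
  ultimately show ?thesis using num_dvd_add_iff by metis
qed

lemma num_dvd_beta_cancel:
  assumes b: "\<And>i. i \<prec> b \<Longrightarrow> num_dvd (i \<oplus> \<one>) m" and "i \<prec> b" "j \<prec> b" "i \<noteq> j"
    and dvd: "num_dvd (beta m i) (n \<otimes> beta m j)"
  shows "num_dvd (beta m i) n"
proof -
  have *: "\<exists>d. y = x \<oplus> (d \<oplus> \<one>) \<and> d \<prec> b" if less: "x \<prec> y" and y: "y \<prec> b" for x y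
  proof -
    obtain d where "y = x \<oplus> d \<oplus> \<one>" using num_less_iff[THEN iffD1, OF less] by blast
    then have d: "y = x \<oplus> (d \<oplus> \<one>)" "y = d \<oplus> x \<oplus> \<one>"
      using M.add.commute M.add.assoc by simp_all
    then have "d \<prec> y" using num_less_iff[of d y] by blast
    then show ?thesis using d y M.less_trans by blast
  qed
  obtain d where "i = j \<oplus> (d \<oplus> \<one>) \<or> j = i \<oplus> (d \<oplus> \<one>)" "d \<prec> b"
    using *[of i j] *[of j i] assms(2-4) num_less_linear[of i j] by blast
  then show ?thesis using num_dvd_beta_cancel_less[OF b _ _ dvd] by blast
qed

lemma division:
  assumes "\<zero> \<prec> N"
  shows "\<exists>q r. n = N \<otimes> q \<oplus> r \<and> r \<prec> N"
proof -
  have "\<exists>q. q \<preceq> n \<and> (\<exists>r. r \<prec> N \<and> n = N \<otimes> q \<oplus> r)"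
  proof (induction n rule: d0_induct)
    case definable
    show ?case by (intro d0_intros d0_bex_le)
  next
    case zero
    show ?case using assms by (intro exI[of _ \<zero>]) simp
  next
    case (step n)
    then obtain q r where q: "q \<preceq> n" "r \<prec> N" "n = N \<otimes> q \<oplus> r" by blast
    show ?case
    proof (cases "r \<oplus> \<one> \<prec> N")
      case True
      moreover have "n \<oplus> \<one> = N \<otimes> q \<oplus> (r \<oplus> \<one>)" using q(3) M.add.assoc by simp
      moreover have "q \<preceq> n \<oplus> \<one>" using q(1) less_add_one_iff M.less_imp_le by blast
      ultimately show ?thesis by blast
    next
      case False
      then have "r \<oplus> \<one> = N" using q(2) add_one_le_iff[of r N] num_le_def by blast
      then have "n \<oplus> \<one> = N \<otimes> (q \<oplus> \<one>) \<oplus> \<zero>" using q(3) M.add.assoc basic_axioms(3,6) by metis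
      then show ?thesis using assms q(1) by (intro exI[of _ "q \<oplus> \<one>"]) (auto intro: le_mul)
    qed
  qed
  then show ?thesis by blast
qed

text \<open>The bound \<open>N\<close> does not depend on the set: a number coding a subset of \<open>[0, b)\<close> may be
  reduced modulo a common multiple of the moduli. Hence the power set of a finite set, and so the
  class of weak orders, is bounded.\<close>

lemma beta_exists:
  "\<exists>m N. \<forall>X. \<exists>n. n \<preceq> N \<and> (\<forall>i. i \<prec> b \<longrightarrow> (num_dvd (beta m i) n \<longleftrightarrow> i \<epsilon> X))"
proof -
  have pos: "\<zero> \<prec> i \<oplus> \<one>" for i by (simp only: less_add_one_iff zero_le)
  obtain m where m: "\<zero> \<prec> m" "\<And>i. i \<prec> b \<Longrightarrow> num_dvd (i \<oplus> \<one>) m"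
    using common_multiple[of "\<lambda>i. i \<oplus> \<one>" b, OF d0_term_add[OF d0_term_var d0_term_const] pos] by blast
  obtain N where N: "\<zero> \<prec> N" "\<And>i. i \<prec> b \<Longrightarrow> num_dvd (beta m i) N"
    using common_multiple[of "beta m" b, OF d0_term_beta[OF d0_term_const d0_term_var] beta_pos] by blast
  have "\<exists>n. n \<preceq> N \<and> (\<forall>i. i \<prec> b \<longrightarrow> (num_dvd (beta m i) n \<longleftrightarrow> i \<epsilon> X))" for X
  proof -
    have "\<exists>n. \<forall>i. i \<prec> b \<longrightarrow> (num_dvd (beta m i) n \<longleftrightarrow> i \<epsilon> X \<and> i \<prec> j)" if "j \<preceq> b" for j
    proof -
      have "\<exists>n. j \<preceq> b \<longrightarrow> (\<forall>i. i \<prec> b \<longrightarrow> (num_dvd (beta m i) n \<longleftrightarrow> i \<epsilon> X \<and> i \<prec> j))"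
      proof (induction j rule: sigma1_induct)
        case definable
        show ?case by (intro d0_intros d0_dvd d0_le d0_term_beta)
      next
        case zero
        \<comment> \<open>The number one codes the empty set: as \<open>m\<close> is positive, every
          modulus exceeds one.\<close>
        have "\<not> num_dvd (beta m i) \<one>" for i
        proof
          assume "num_dvd (beta m i) \<one>"
          then obtain q where q: "\<one> = beta m i \<otimes> q" unfolding num_dvd_def by blast
          then have "q \<noteq> \<zero>" by auto
          then have "\<zero> \<prec> q" using zero_le[of q] num_le_def by auto
          then have "beta m i \<preceq> q \<otimes> beta m i" by (rule le_mul)
          also have "\<dots> = \<one>" unfolding M.mult.commute[of q] by (rule q[symmetric])
          finally have "beta m i \<preceq> \<one>" .
          then have "m \<otimes> (i \<oplus> \<one>) \<preceq> \<zero>"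
            unfolding beta_def using M.add_le_cancel_right[of _ \<one> \<zero>] by simp
          moreover have "\<zero> \<prec> m \<otimes> (i \<oplus> \<one>)"
            using m(1) pos by (rule M.mult_pos_pos)
          ultimately show False using M.not_le by blast
        qed
        then show ?case by (intro exI[of _ \<one>]) (simp add: basic_axioms(7))
      next
        case (step j)
        show ?case
        proof (cases "j \<prec> b")
          case True
          then obtain n where n: "\<And>i. i \<prec> b \<Longrightarrow> num_dvd (beta m i) n \<longleftrightarrow> i \<epsilon> X \<and> i \<prec> j"
            using step num_le_def by blast
          show ?thesis
          proof (cases "j \<epsilon> X")
            case j: True
            \<comment> \<open>Multiplication by the modulus of \<open>j\<close> adds
              \<open>j\<close> to the coded set and, by coprimality, nothing else.\<close>
            have "num_dvd (beta m i) (n \<otimes> beta m j) \<longleftrightarrow> i \<epsilon> X \<and> i \<prec> j \<oplus> \<one>" if i: "i \<prec> b" for i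
            proof (cases "i = j")
              case True
              then show ?thesis using j M.mult.commute basic_axioms(8) num_dvd_def by blast
            next
              case False
              then have "num_dvd (beta m i) (n \<otimes> beta m j) \<longleftrightarrow> num_dvd (beta m i) n"
                using num_dvd_beta_cancel[OF m(2) i \<open>j \<prec> b\<close>] num_dvd_mult by blast
              then show ?thesis using n[OF i] False basic_axioms(8) by blast
            qed
            then show ?thesis by blast
          next
            case False
            then show ?thesis using n basic_axioms(8) by blast
          qed
        next
          case False
          then show ?thesis using add_one_le_iff by blast
        qed
      qed
      then show ?thesis using that by blast
    qed
    from this[of b] obtain n where n: "\<And>i. i \<prec> b \<Longrightarrow> num_dvd (beta m i) n \<longleftrightarrow> i \<epsilon> X" by auto
    obtain q r where r: "n = N \<otimes> q \<oplus> r" "r \<prec> N" using division[OF N(1)] by blast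
    have "num_dvd (beta m i) r \<longleftrightarrow> i \<epsilon> X" if "i \<prec> b" for i
      using n[OF that] num_dvd_add_iff[OF num_dvd_mult[OF N(2)[OF that]], of q r] r(1) by simp
    then show ?thesis using r(2) num_le_def by blast
  qed
  then show ?thesis by blast
qed

text \<open>The predicates \<open>in_code\<close> and \<open>set_code\<close>, read in the model.\<close>

definition in_cd :: "'m \<Rightarrow> 'm \<Rightarrow> bool" where
  "in_cd i c \<longleftrightarrow> (\<exists>k m n. c = num_pair k (num_pair m n) \<and> i \<prec> k \<and>
     (\<exists>q. n = (m \<otimes> (i \<oplus> \<one>) \<oplus> \<one>) \<otimes> q))"

definition represents :: "'m \<Rightarrow> bool" where
  "represents c \<longleftrightarrow> (\<exists>k m n. c = num_pair k (num_pair m n))"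

definition set_cd :: "'m \<Rightarrow> bool" where
  "set_cd c \<longleftrightarrow> represents c \<and>
     (\<forall>d. d \<prec> c \<and> represents d \<longrightarrow> \<not> (\<forall>i. in_cd i d \<longleftrightarrow> in_cd i c))"

lemma in_cd_less: "in_cd i c \<Longrightarrow> i \<prec> c"
  unfolding in_cd_def using le_num_pair M.less_le_trans by blast

lemma le_num_triple:
  assumes "c = num_pair k (num_pair m n)"
  shows "k \<preceq> c" "m \<preceq> c" "n \<preceq> c"
  unfolding assms
  using le_num_pair M.order_trans[OF le_num_pair(1) le_num_pair(2)] M.order_trans[OF le_num_pair(2) le_num_pair(2)]
  by auto

lemma in_cd_bounded: "in_cd i c \<longleftrightarrow> (\<exists>k. k \<preceq> c \<and> (\<exists>m. m \<preceq> c \<and> (\<exists>n. n \<preceq> c \<and>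
    c = num_pair k (num_pair m n) \<and> i \<prec> k \<and> num_dvd (beta m i) n)))"
proof
  assume "in_cd i c"
  then obtain k m n where *: "c = num_pair k (num_pair m n)" "i \<prec> k" "num_dvd (beta m i) n"
    unfolding in_cd_def num_dvd_def beta_def by auto
  show "\<exists>k. k \<preceq> c \<and> (\<exists>m. m \<preceq> c \<and> (\<exists>n. n \<preceq> c \<and>
      c = num_pair k (num_pair m n) \<and> i \<prec> k \<and> num_dvd (beta m i) n))"
    using * le_num_triple[OF *(1)]
    by (intro exI[of _ k] exI[of _ m] exI[of _ n] conjI)
qed (auto simp: in_cd_def num_dvd_def beta_def)

lemma represents_bounded: "represents c \<longleftrightarrow> (\<exists>k. k \<preceq> c \<and> (\<exists>m. m \<preceq> c \<and> (\<exists>n. n \<preceq> c \<and>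
    c = num_pair k (num_pair m n))))"
proof
  assume "represents c"
  then obtain k m n where *: "c = num_pair k (num_pair m n)" unfolding represents_def by auto
  show "\<exists>k. k \<preceq> c \<and> (\<exists>m. m \<preceq> c \<and> (\<exists>n. n \<preceq> c \<and> c = num_pair k (num_pair m n)))"
    using * le_num_triple[OF *(1)]
    by (intro exI[of _ k] exI[of _ m] exI[of _ n] conjI)
qed (auto simp: represents_def)

lemma d0_in_cd: "d0_term t \<Longrightarrow> d0_term u \<Longrightarrow> d0 (\<lambda>e. in_cd (t e) (u e))"
  unfolding in_cd_bounded
  by (intro d0_intros d0_bex_le d0_dvd d0_term_beta d0_term_num_pair d0_term_shift)

lemma d0_represents: "d0_term t \<Longrightarrow> d0 (\<lambda>e. represents (t e))"
  unfolding represents_bounded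
  by (intro d0_intros d0_bex_le d0_term_num_pair d0_term_shift)

lemma set_cd_bounded: "set_cd c \<longleftrightarrow> represents c \<and> (\<forall>d. d \<prec> c \<longrightarrow> represents d \<longrightarrow>
    \<not> (\<forall>i. i \<prec> c \<longrightarrow> (in_cd i d \<longleftrightarrow> in_cd i c)))"
proof -
  have "(\<forall>i. in_cd i d \<longleftrightarrow> in_cd i c) \<longleftrightarrow> (\<forall>i. i \<prec> c \<longrightarrow> (in_cd i d \<longleftrightarrow> in_cd i c))" if "d \<prec> c" for d
    using in_cd_less[of _ c] M.less_trans[OF in_cd_less[of _ d] that] by blast
  then show ?thesis unfolding set_cd_def by blast
qed

lemma d0_set_cd: "d0_term t \<Longrightarrow> d0 (\<lambda>e. set_cd (t e))"
  unfolding set_cd_bounded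
  by (intro d0_intros d0_in_cd d0_represents d0_term_shift)

lemma set_cd_unique:
  assumes "set_cd c" "set_cd d" "\<And>i. in_cd i c \<longleftrightarrow> in_cd i d"
  shows "c = d"
  using assms num_less_linear[of c d] unfolding set_cd_def by blast

text \<open>One bound serves all subsets of \<open>[0, b)\<close>: the components \<open>b\<close>
  and \<open>m\<close> of a representing triple are fixed and the third is at most \<open>N\<close>.
  The code itself is the least representative, hence no larger than the triple found.\<close>

lemma set_cd_exists_bounded:
  "\<exists>B. \<forall>X. (\<forall>x. x \<epsilon> X \<longrightarrow> x \<prec> b) \<longrightarrow> (\<exists>c. c \<preceq> B \<and> set_cd c \<and> (\<forall>x. in_cd x c \<longleftrightarrow> x \<epsilon> X))"
proof -
  obtain m N where N: "\<And>X. \<exists>n. n \<preceq> N \<and> (\<forall>i. i \<prec> b \<longrightarrow> (num_dvd (beta m i) n \<longleftrightarrow> i \<epsilon> X))"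
    using beta_exists by blast
  have "\<exists>c. c \<preceq> num_pair b (num_pair m N) \<and> set_cd c \<and> (\<forall>x. in_cd x c \<longleftrightarrow> x \<epsilon> X)"
    if X: "\<And>x. x \<epsilon> X \<Longrightarrow> x \<prec> b" for X
  proof -
    obtain n where n: "n \<preceq> N" "\<And>i. i \<prec> b \<Longrightarrow> num_dvd (beta m i) n \<longleftrightarrow> i \<epsilon> X"
      using N by blast
    let ?c = "num_pair b (num_pair m n)"
    \<comment> \<open>Elements of a code lie below the code, and those of \<open>X\<close> below
      \<open>b\<close>; comparing up to \<open>c \<oplus> b\<close> therefore compares the sets
      entirely while \<open>?P\<close> stays bounded.\<close>
    let ?P = "\<lambda>c. represents c \<and> (\<forall>i. i \<prec> c \<oplus> b \<longrightarrow> (in_cd i c \<longleftrightarrow> i \<epsilon> X))"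
    have P: "?P c \<longleftrightarrow> represents c \<and> (\<forall>i. in_cd i c \<longleftrightarrow> i \<epsilon> X)" for c
    proof -
      have "i \<prec> c \<oplus> b" if "in_cd i c \<or> i \<epsilon> X" for i
        using that X[of i] in_cd_less[of i c] M.less_le_trans[OF _ le_add(1), of i c b]
          M.less_le_trans[OF _ le_add(2), of i b c] by blast
      then show ?thesis by blast
    qed
    have "?P ?c"
      unfolding P using n(2) X unfolding represents_def in_cd_def num_dvd_def beta_def by auto
    moreover have "d0 (\<lambda>e. ?P (e 0))"
      by (intro d0_intros d0_represents d0_in_cd)
    ultimately obtain c where c: "?P c" "c \<preceq> ?c" "\<And>d. d \<prec> c \<Longrightarrow> \<not> ?P d"
      using d0_least[of ?P ?c] by blast
    have "set_cd c"
      using c(1,3) unfolding P set_cd_def by simp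
    moreover have "c \<preceq> num_pair b (num_pair m N)"
      using c(2) num_pair_mono[OF M.order_refl num_pair_mono[OF M.order_refl n(1)]] M.order_trans by blast
    ultimately show ?thesis using c(1) P by blast
  qed
  then show ?thesis by blast
qed

lemma set_cd_exists:
  assumes "\<And>x. x \<epsilon> X \<Longrightarrow> x \<prec> b"
  obtains c where "set_cd c" "\<And>x. in_cd x c \<longleftrightarrow> x \<epsilon> X"
  using set_cd_exists_bounded[of b] assms by blast

end

section \<open>Societies in a model\<close>

text \<open>Each predicate is the reading in the model of one of the defining formulas, kept so close to
  it that the two agree after unfolding.\<close>

context rca0_model
begin

definition prod_cls :: "('m \<Rightarrow> bool) \<Rightarrow> ('m \<Rightarrow> bool) \<Rightarrow> 'm \<Rightarrow> bool" where
  "prod_cls C D z \<longleftrightarrow> (\<exists>x y. C x \<and> D y \<and> z = num_pair x y)"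

definition fun_cls :: "('m \<Rightarrow> bool) \<Rightarrow> ('m \<Rightarrow> bool) \<Rightarrow> ('m \<Rightarrow> bool) \<Rightarrow> bool" where
  "fun_cls G C D \<longleftrightarrow>
     (\<forall>z. G z \<longrightarrow> prod_cls C D z) \<and>
     (\<forall>x y y'. G (num_pair x y) \<and> G (num_pair x y') \<longrightarrow> y = y') \<and>
     (\<forall>x. C x \<longrightarrow> (\<exists>y. D y \<and> G (num_pair x y)))"

definition seq_len :: "'m \<Rightarrow> 'm \<Rightarrow> bool" where
  "seq_len s l \<longleftrightarrow> set_cd s \<and> fun_cls (\<lambda>z. in_cd z s) (\<lambda>i. i \<prec> l) (\<lambda>x. x = x)"

definition enum_cls :: "'m \<Rightarrow> ('m \<Rightarrow> bool) \<Rightarrow> bool" where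
  "enum_cls s C \<longleftrightarrow> (\<exists>l. seq_len s l) \<and>
     (\<forall>i a. in_cd (num_pair i a) s \<longrightarrow> C a) \<and>
     (\<forall>a. C a \<longrightarrow> (\<exists>i. in_cd (num_pair i a) s \<and> (\<forall>j. in_cd (num_pair j a) s \<longrightarrow> j = i)))"

definition card_cls :: "('m \<Rightarrow> bool) \<Rightarrow> 'm \<Rightarrow> bool" where
  "card_cls C k \<longleftrightarrow> (\<exists>s. seq_len s k \<and> enum_cls s C)"

definition is_algebra :: "'s \<Rightarrow> 's \<Rightarrow> bool" where
  "is_algebra V A \<longleftrightarrow>
     (\<forall>i v. num_pair i v \<epsilon> A \<longrightarrow> v \<epsilon> V) \<and>
     (\<exists>k. \<forall>v. num_pair k v \<epsilon> A \<longleftrightarrow> v \<epsilon> V) \<and>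
     (\<forall>i j. \<exists>k. \<forall>v. num_pair k v \<epsilon> A \<longleftrightarrow> num_pair i v \<epsilon> A \<or> num_pair j v \<epsilon> A) \<and>
     (\<forall>i j. \<exists>k. \<forall>v. num_pair k v \<epsilon> A \<longleftrightarrow> num_pair i v \<epsilon> A \<and> num_pair j v \<epsilon> A) \<and>
     (\<forall>i. \<exists>k. \<forall>v. num_pair k v \<epsilon> A \<longleftrightarrow> v \<epsilon> V \<and> \<not> num_pair i v \<epsilon> A)"

definition is_atomic :: "'s \<Rightarrow> 's \<Rightarrow> bool" where
  "is_atomic V A \<longleftrightarrow> (\<forall>v. v \<epsilon> V \<longrightarrow> (\<exists>k. \<forall>w. num_pair k w \<epsilon> A \<longleftrightarrow> w = v))"

definition is_ultrafilter :: "'s \<Rightarrow> 's \<Rightarrow> 's \<Rightarrow> bool" where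
  "is_ultrafilter V A U \<longleftrightarrow>
     (\<forall>i. (\<forall>v. num_pair i v \<epsilon> A \<longleftrightarrow> v \<epsilon> V) \<longrightarrow> i \<epsilon> U) \<and>
     (\<forall>i. (\<forall>v. \<not> num_pair i v \<epsilon> A) \<longrightarrow> \<not> i \<epsilon> U) \<and>
     (\<forall>i j. i \<epsilon> U \<and> (\<forall>v. num_pair i v \<epsilon> A \<longrightarrow> num_pair j v \<epsilon> A) \<longrightarrow> j \<epsilon> U) \<and>
     (\<forall>i j k. i \<epsilon> U \<and> j \<epsilon> U \<and>
        (\<forall>v. num_pair k v \<epsilon> A \<longleftrightarrow> num_pair i v \<epsilon> A \<and> num_pair j v \<epsilon> A) \<longrightarrow> k \<epsilon> U) \<and>
     (\<forall>i j. (\<forall>v. num_pair j v \<epsilon> A \<longleftrightarrow> v \<epsilon> V \<and> \<not> num_pair i v \<epsilon> A) \<longrightarrow> i \<epsilon> U \<or> j \<epsilon> U)"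

definition principal_uf :: "'s \<Rightarrow> 's \<Rightarrow> bool" where
  "principal_uf A U \<longleftrightarrow> (\<exists>k d. k \<epsilon> U \<and> (\<forall>v. num_pair k v \<epsilon> A \<longleftrightarrow> v = d))"

definition strict_rel :: "('m \<Rightarrow> 'm \<Rightarrow> bool) \<Rightarrow> 'm \<Rightarrow> 'm \<Rightarrow> bool" where
  "strict_rel R x y \<longleftrightarrow> R x y \<and> \<not> R y x"

definition weak_order_cd :: "'s \<Rightarrow> 'm \<Rightarrow> bool" where
  "weak_order_cd X r \<longleftrightarrow> set_cd r \<and>
     (\<forall>z. in_cd z r \<longrightarrow> prod_cls (\<lambda>x. x \<epsilon> X) (\<lambda>x. x \<epsilon> X) z) \<and>
     (\<forall>x y z. in_cd (num_pair x y) r \<and> in_cd (num_pair y z) r \<longrightarrow> in_cd (num_pair x z) r) \<and>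
     (\<forall>x y. x \<epsilon> X \<and> y \<epsilon> X \<longrightarrow> in_cd (num_pair x y) r \<or> in_cd (num_pair y x) r)"

definition prefers :: "'s \<Rightarrow> 'm \<Rightarrow> 'm \<Rightarrow> 'm \<Rightarrow> 'm \<Rightarrow> bool" where
  "prefers F i v x y \<longleftrightarrow> (\<exists>r. num_pair i (num_pair v r) \<epsilon> F \<and> in_cd (num_pair x y) r)"

definition strict_on :: "'s \<Rightarrow> 'm \<Rightarrow> ('m \<Rightarrow> bool) \<Rightarrow> 'm \<Rightarrow> 'm \<Rightarrow> bool" where
  "strict_on F i C x y \<longleftrightarrow> (\<forall>v. C v \<longrightarrow> strict_rel (prefers F i v) x y)"

definition agree_on :: "('m \<Rightarrow> 'm \<Rightarrow> bool) \<Rightarrow> ('m \<Rightarrow> 'm \<Rightarrow> bool) \<Rightarrow> 'm \<Rightarrow> 'm \<Rightarrow> bool" where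
  "agree_on R R' x y \<longleftrightarrow>
     (\<forall>a b. (a = x \<or> a = y) \<and> (b = x \<or> b = y) \<longrightarrow> (R a b \<longleftrightarrow> R' a b))"

definition measurable_by :: "'s \<Rightarrow> 's \<Rightarrow> 's \<Rightarrow> 's \<Rightarrow> bool" where
  "measurable_by V X A F \<longleftrightarrow> (\<exists>\<mu>.
     fun_cls (\<lambda>x. x \<epsilon> \<mu>) (prod_cls (\<lambda>x. x = x) (prod_cls (\<lambda>x. x \<epsilon> X) (\<lambda>x. x \<epsilon> X))) (\<lambda>x. x = x) \<and>
     (\<forall>n x y v. x \<epsilon> X \<and> y \<epsilon> X \<and> v \<epsilon> V \<longrightarrow>
        (prefers F n v x y \<longleftrightarrow>
          (\<exists>k. num_pair (num_pair n (num_pair x y)) k \<epsilon> \<mu> \<and> num_pair k v \<epsilon> A))))"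

definition qpart_cls :: "'s \<Rightarrow> 'm \<Rightarrow> bool" where
  "qpart_cls X s \<longleftrightarrow> (\<exists>l k. seq_len s l \<and> card_cls (weak_order_cd X) k \<and>
     (\<one> \<prec> l \<or> \<one> = l) \<and> (l \<prec> k \<or> l = k))"

definition selects :: "'s \<Rightarrow> 'm \<Rightarrow> 'm \<Rightarrow> 'm \<Rightarrow> 'm \<Rightarrow> bool" where
  "selects A s l v i \<longleftrightarrow> i \<prec> l \<and> (\<exists>a. in_cd (num_pair i a) s \<and> num_pair a v \<epsilon> A)"

definition embedding :: "'s \<Rightarrow> 's \<Rightarrow> 's \<Rightarrow> 's \<Rightarrow> 's \<Rightarrow> bool" where
  "embedding V X A F e \<longleftrightarrow>
     fun_cls (\<lambda>x. x \<epsilon> e) (prod_cls (\<lambda>p. enum_cls p (weak_order_cd X)) (qpart_cls X)) (\<lambda>x. x = x) \<and>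
     (\<forall>p s n l v. num_pair (num_pair p s) n \<epsilon> e \<and> seq_len s (l \<oplus> \<one>) \<and> v \<epsilon> V \<longrightarrow>
       (\<forall>i. selects A s l v i \<and> (\<forall>j. selects A s l v j \<longrightarrow> j = i) \<longrightarrow>
          (\<exists>r. in_cd (num_pair i r) p \<and> num_pair n (num_pair v r) \<epsilon> F)) \<and>
       (\<not> (\<exists>i. selects A s l v i \<and> (\<forall>j. selects A s l v j \<longrightarrow> j = i)) \<longrightarrow>
          (\<exists>r. in_cd (num_pair l r) p \<and> num_pair n (num_pair v r) \<epsilon> F)))"

definition society :: "'s \<Rightarrow> 's \<Rightarrow> 's \<Rightarrow> 's \<Rightarrow> bool" where
  "society V X A F \<longleftrightarrow>
     (\<exists>v. v \<epsilon> V) \<and> (\<exists>b. \<forall>x. x \<epsilon> X \<longrightarrow> x \<prec> b) \<and>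
     (\<exists>k. card_cls (\<lambda>x. x \<epsilon> X) k \<and> (\<one> \<oplus> \<one> \<oplus> \<one> \<prec> k \<or> \<one> \<oplus> \<one> \<oplus> \<one> = k)) \<and>
     is_algebra V A \<and> is_atomic V A \<and>
     (\<forall>i. fun_cls (\<lambda>x. num_pair i x \<epsilon> F) (\<lambda>x. x \<epsilon> V) (weak_order_cd X)) \<and>
     measurable_by V X A F \<and> (\<exists>e. embedding V X A F e)"

definition social :: "'s \<Rightarrow> 'm \<Rightarrow> 'm \<Rightarrow> 'm \<Rightarrow> bool" where
  "social \<sigma> i x y \<longleftrightarrow> (\<exists>r. num_pair i r \<epsilon> \<sigma> \<and> in_cd (num_pair x y) r)"

definition welfare_function :: "'s \<Rightarrow> 's \<Rightarrow> 's \<Rightarrow> 's \<Rightarrow> bool" where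
  "welfare_function V X F \<sigma> \<longleftrightarrow>
     fun_cls (\<lambda>x. x \<epsilon> \<sigma>) (\<lambda>x. x = x) (weak_order_cd X) \<and>
     (\<forall>x y i. x \<epsilon> X \<and> y \<epsilon> X \<longrightarrow> strict_on F i (\<lambda>v. v \<epsilon> V) x y \<longrightarrow> strict_rel (social \<sigma> i) x y) \<and>
     (\<forall>x y i j. x \<epsilon> X \<and> y \<epsilon> X \<longrightarrow>
        (\<forall>v. v \<epsilon> V \<longrightarrow> agree_on (prefers F i v) (prefers F j v) x y) \<longrightarrow>
        agree_on (social \<sigma> i) (social \<sigma> j) x y)"

definition dictator_free :: "'s \<Rightarrow> 's \<Rightarrow> 's \<Rightarrow> 's \<Rightarrow> bool" where
  "dictator_free V X F \<sigma> \<longleftrightarrow> (\<forall>v. v \<epsilon> V \<longrightarrow>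
     (\<exists>i x y. x \<epsilon> X \<and> y \<epsilon> X \<and> strict_rel (prefers F i v) x y \<and> social \<sigma> i y x))"

definition decisive_pair :: "'s \<Rightarrow> 's \<Rightarrow> 's \<Rightarrow> 'm \<Rightarrow> 'm \<Rightarrow> 'm \<Rightarrow> bool" where
  "decisive_pair A F \<sigma> n x y \<longleftrightarrow>
     (\<forall>i. strict_on F i (\<lambda>v. num_pair n v \<epsilon> A) x y \<longrightarrow> strict_rel (social \<sigma> i) x y)"

definition decisive_set :: "'s \<Rightarrow> 's \<Rightarrow> 's \<Rightarrow> 's \<Rightarrow> 'm \<Rightarrow> bool" where
  "decisive_set X A F \<sigma> n \<longleftrightarrow> (\<forall>x y. x \<epsilon> X \<and> y \<epsilon> X \<longrightarrow> decisive_pair A F \<sigma> n x y)"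

text \<open>Because the model predicates mirror the formulas clause by clause, unfolding leaves only
  the conversion of quantifier levels into de Bruijn indices, which is subtraction of
  successors.\<close>

lemma sat_theorem:
  "sat e f (sentence
    (\<^bold>\<forall>\<^sub>S V X A F \<sigma>. countable_society V X A F \<^bold>\<and> social_welfare_function V X F \<sigma> \<^bold>\<longrightarrow>
      (\<^bold>\<exists>\<^sub>S U. (\<^bold>\<forall>i. i \<^bold>\<in> U \<^bold>\<longleftrightarrow> decisive X A F \<sigma> i) \<^bold>\<and>
        ultrafilter V A U \<^bold>\<and>
        (is_principal A U \<^bold>\<longleftrightarrow> dictatorial V X F \<sigma>)))) \<longleftrightarrow>
   (\<forall>V X A F \<sigma>. society V X A F \<and> welfare_function V X F \<sigma> \<longrightarrow>
     (\<exists>U. (\<forall>i. i \<epsilon> U \<longleftrightarrow> decisive_set X A F \<sigma> i) \<and> is_ultrafilter V A U \<and>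
       (principal_uf A U \<longleftrightarrow> \<not> dictator_free V X F \<sigma>)))"
  unfolding sentence_def countable_society_def social_welfare_function_def decisive_def
    ultrafilter_def is_principal_def dictatorial_def non_dictatorial_def decisive_for_def
    independence_def unanimity_def social_pref_def quasi_partition_embedded_def qpart_W_def perm_W_def
    uniformly_measurable_def agree_def strict_pref_on_def pref_def profile_value_def profiles_def
    weak_order_def strict_def rel_of_code_def atomic_def countable_algebra_def finite_set_def
    has_card_def enumerates_def seq_of_length_def seq_at_def set_code_def represents_set_def in_code_def
    is_fun_def cprod_def section_of_def naturals_def elts_def pair_def leq_def ex1_def Let_def
    exiS_def allS_def exi_def all_def iff_def imp_def dis_def con_def neg_def fls_def mem_def less_def eq_def
    mul_def add_def one_def zero_def
  unfolding society_def welfare_function_def decisive_set_def is_ultrafilter_def principal_uf_def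
    dictator_free_def decisive_pair_def social_def embedding_def selects_def qpart_cls_def measurable_by_def
    agree_on_def strict_on_def prefers_def weak_order_cd_def strict_rel_def is_atomic_def is_algebra_def
    card_cls_def enum_cls_def seq_len_def fun_cls_def prod_cls_def set_cd_def represents_def in_cd_def num_pair_def
  by (simp only: sat.simps val.simps sat_connectives diff_Suc_Suc diff_zero diff_self_eq_0 Suc_diff_diff
      nat.case One_nat_def)

end

section \<open>Sequences and permutations\<close>

context rca0_model
begin

lemma set_cd_exists_d0:
  assumes "d0 (\<lambda>e. P (e 0))" "\<And>x. P x \<Longrightarrow> x \<prec> b"
  obtains c where "set_cd c" "\<And>x. in_cd x c \<longleftrightarrow> P x"
proof -
  obtain Y where Y: "\<And>x. x \<epsilon> Y \<longleftrightarrow> P x" using d0_comprehension[OF assms(1)] by blast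
  obtain c where "set_cd c" "\<And>x. in_cd x c \<longleftrightarrow> x \<epsilon> Y"
    using set_cd_exists[of Y b] Y assms(2) by blast
  then show thesis using that Y by blast
qed

lemma seq_lenI:
  assumes "set_cd s" "\<And>z. in_cd z s \<Longrightarrow> \<exists>i a. i \<prec> l \<and> z = num_pair i a"
    "\<And>i a a'. in_cd (num_pair i a) s \<Longrightarrow> in_cd (num_pair i a') s \<Longrightarrow> a = a'"
    "\<And>i. i \<prec> l \<Longrightarrow> \<exists>a. in_cd (num_pair i a) s"
  shows "seq_len s l"
  unfolding seq_len_def fun_cls_def prod_cls_def using assms by blast

lemma seq_lenD:
  assumes "seq_len s l"
  shows "set_cd s" "\<And>z. in_cd z s \<Longrightarrow> \<exists>i a. i \<prec> l \<and> z = num_pair i a"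
    "\<And>i a a'. in_cd (num_pair i a) s \<Longrightarrow> in_cd (num_pair i a') s \<Longrightarrow> a = a'"
    "\<And>i. i \<prec> l \<Longrightarrow> \<exists>a. in_cd (num_pair i a) s"
    "\<And>i a. in_cd (num_pair i a) s \<Longrightarrow> i \<prec> l"
proof -
  show "set_cd s" "\<And>i a a'. in_cd (num_pair i a) s \<Longrightarrow> in_cd (num_pair i a') s \<Longrightarrow> a = a'"
    "\<And>i. i \<prec> l \<Longrightarrow> \<exists>a. in_cd (num_pair i a) s"
    using assms unfolding seq_len_def fun_cls_def by blast+
  show *: "\<And>z. in_cd z s \<Longrightarrow> \<exists>i a. i \<prec> l \<and> z = num_pair i a"
    using assms unfolding seq_len_def fun_cls_def prod_cls_def by blast
  show "\<And>i a. in_cd (num_pair i a) s \<Longrightarrow> i \<prec> l"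
    using * by fastforce
qed

lemma in_cd_pair_less:
  assumes "in_cd (num_pair i a) s"
  shows "i \<prec> s" "a \<prec> s"
  using in_cd_less[OF assms] le_num_pair M.le_less_trans by blast+

lemma seq_len_bounded: "seq_len s l \<longleftrightarrow> set_cd s \<and>
    (\<forall>z. z \<prec> s \<longrightarrow> in_cd z s \<longrightarrow> (\<exists>i. i \<prec> l \<and> (\<exists>a. a \<prec> s \<and> z = num_pair i a))) \<and>
    (\<forall>i. i \<prec> l \<longrightarrow> (\<exists>a. a \<prec> s \<and> in_cd (num_pair i a) s)) \<and>
    (\<forall>i. i \<prec> l \<longrightarrow> (\<forall>a. a \<prec> s \<longrightarrow> (\<forall>a'. a' \<prec> s \<longrightarrow>
      in_cd (num_pair i a) s \<longrightarrow> in_cd (num_pair i a') s \<longrightarrow> a = a')))" (is "_ \<longleftrightarrow> ?R")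
proof
  assume s: "seq_len s l"
  have "\<exists>i. i \<prec> l \<and> (\<exists>a. a \<prec> s \<and> z = num_pair i a)" if z: "in_cd z s" for z
  proof -
    obtain i a where "i \<prec> l" "z = num_pair i a" using seq_lenD(2)[OF s z] by blast
    then show ?thesis using in_cd_pair_less z by blast
  qed
  moreover have "\<exists>a. a \<prec> s \<and> in_cd (num_pair i a) s" if i: "i \<prec> l" for i
    using seq_lenD(4)[OF s i] in_cd_pair_less by blast
  ultimately show ?R using seq_lenD(1,3)[OF s] by blast
next
  assume r: ?R
  then have z: "\<exists>i a. i \<prec> l \<and> z = num_pair i a" if "in_cd z s" for z
    using in_cd_less[OF that] that by blast
  show "seq_len s l"
  proof (rule seq_lenI)
    fix i a a' assume a: "in_cd (num_pair i a) s" "in_cd (num_pair i a') s"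
    have "i \<prec> l" using z[OF a(1)] by auto
    then show "a = a'" using r a in_cd_pair_less[OF a(1)] in_cd_pair_less[OF a(2)] by blast
  qed (use r z in blast)+
qed

lemma d0_seq_len: "d0_term t \<Longrightarrow> d0_term u \<Longrightarrow> d0 (\<lambda>e. seq_len (t e) (u e))"
  unfolding seq_len_bounded
  by (intro d0_intros d0_set_cd d0_in_cd d0_term_num_pair d0_term_shift)

abbreviation num_two :: 'm ("\<two>") where "\<two> \<equiv> \<one> \<oplus> \<one>"
abbreviation num_three :: 'm ("\<three>") where "\<three> \<equiv> \<one> \<oplus> \<one> \<oplus> \<one>"

lemma less_four_iff: "i \<prec> \<three> \<oplus> \<one> \<longleftrightarrow> i = \<zero> \<or> i = \<one> \<or> i = \<two> \<or> i = \<three>"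
  using basic_axioms(8)[of i \<three>] basic_axioms(8)[of i \<two>] basic_axioms(8)[of i \<one>]
    basic_axioms(8)[of i \<zero>] basic_axioms(7)[of i]
  by (simp only: num_zero_add) blast

lemma small_numbers_less:
  "\<zero> \<prec> \<one>" "\<zero> \<prec> \<two>" "\<zero> \<prec> \<three>" "\<one> \<prec> \<two>" "\<one> \<prec> \<three>" "\<two> \<prec> \<three>"
proof -
  have *: "x \<prec> x \<oplus> \<one>" for x by (simp add: basic_axioms(8))
  show "\<zero> \<prec> \<one>" using *[of \<zero>] by (simp only: num_zero_add)
  show "\<one> \<prec> \<two>" "\<two> \<prec> \<three>" by (rule *)+
  then show "\<one> \<prec> \<three>" by (rule M.less_trans)
  then show "\<zero> \<prec> \<three>" using \<open>\<zero> \<prec> \<one>\<close> by (rule M.less_trans[rotated])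
  show "\<zero> \<prec> \<two>" using \<open>\<zero> \<prec> \<one>\<close> \<open>\<one> \<prec> \<two>\<close> by (rule M.less_trans)
qed

lemma small_numbers_neq:
  "\<zero> \<noteq> \<one>" "\<zero> \<noteq> \<two>" "\<zero> \<noteq> \<three>" "\<one> \<noteq> \<two>" "\<one> \<noteq> \<three>" "\<two> \<noteq> \<three>"
  "\<one> \<noteq> \<zero>" "\<two> \<noteq> \<zero>" "\<three> \<noteq> \<zero>" "\<two> \<noteq> \<one>" "\<three> \<noteq> \<one>" "\<three> \<noteq> \<two>"
  using small_numbers_less[THEN M.less_imp_neq] small_numbers_less[THEN M.less_imp_neq, THEN not_sym]
  by blast+

section \<open>Sequences of length four\<close>

definition is_seq4 :: "'m \<Rightarrow> 'm \<Rightarrow> 'm \<Rightarrow> 'm \<Rightarrow> 'm \<Rightarrow> bool" where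
  "is_seq4 s a b c d \<longleftrightarrow> set_cd s \<and> (\<forall>z. in_cd z s \<longleftrightarrow>
     z = num_pair \<zero> a \<or> z = num_pair \<one> b \<or> z = num_pair \<two> c \<or> z = num_pair \<three> d)"

lemma is_seq4_bounded: "is_seq4 s a b c d \<longleftrightarrow> set_cd s \<and>
    in_cd (num_pair \<zero> a) s \<and> in_cd (num_pair \<one> b) s \<and> in_cd (num_pair \<two> c) s \<and>
    in_cd (num_pair \<three> d) s \<and> (\<forall>z. z \<prec> s \<longrightarrow> in_cd z s \<longrightarrow>
     z = num_pair \<zero> a \<or> z = num_pair \<one> b \<or> z = num_pair \<two> c \<or> z = num_pair \<three> d)"
  unfolding is_seq4_def using in_cd_less by blast

lemma d0_is_seq4:
  "d0_term s \<Longrightarrow> d0_term a \<Longrightarrow> d0_term b \<Longrightarrow> d0_term c \<Longrightarrow> d0_term d \<Longrightarrow>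
    d0 (\<lambda>e. is_seq4 (s e) (a e) (b e) (c e) (d e))"
  unfolding is_seq4_bounded
  by (intro d0_intros d0_set_cd d0_in_cd d0_term_num_pair d0_term_shift)

lemma is_seq4_exists: "\<exists>s. is_seq4 s a b c d"
proof -
  let ?P = "\<lambda>z. z = num_pair \<zero> a \<or> z = num_pair \<one> b \<or> z = num_pair \<two> c \<or> z = num_pair \<three> d"
  let ?a = "num_pair \<zero> a" and ?b = "num_pair \<one> b" and ?c = "num_pair \<two> c" and ?d = "num_pair \<three> d"
  let ?s = "?a \<oplus> ?b \<oplus> (?c \<oplus> ?d)"
  have "?a \<preceq> ?s" "?b \<preceq> ?s" "?c \<preceq> ?s" "?d \<preceq> ?s"
    by (rule M.order_trans[OF le_add(1) le_add(1)] M.order_trans[OF le_add(2) le_add(1)]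
        M.order_trans[OF le_add(1) le_add(2)] M.order_trans[OF le_add(2) le_add(2)])+
  then have b: "x \<prec> ?s \<oplus> \<one>" if "?P x" for x
    unfolding less_add_one_iff using that by blast
  show ?thesis
  proof (rule set_cd_exists_d0[of ?P, OF _ b])
    show "d0 (\<lambda>e. ?P (e 0))" by (intro d0_intros)
    show "\<And>c. set_cd c \<Longrightarrow> (\<And>x. in_cd x c \<longleftrightarrow> ?P x) \<Longrightarrow> ?thesis"
      unfolding is_seq4_def by blast
  qed
qed

text \<open>Codes are least representatives, so the quasi-partition is a function of its entries.
  The computation that decides membership in the ultrafilter is single-valued for this
  reason.\<close>

lemma is_seq4_unique: "is_seq4 s a b c d \<Longrightarrow> is_seq4 s' a b c d \<Longrightarrow> s = s'"
  unfolding is_seq4_def using set_cd_unique by blast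

lemma seq_at_seq4:
  assumes "is_seq4 s a b c d"
  shows "in_cd (num_pair i x) s \<longleftrightarrow>
    i = \<zero> \<and> x = a \<or> i = \<one> \<and> x = b \<or> i = \<two> \<and> x = c \<or> i = \<three> \<and> x = d"
  using assms unfolding is_seq4_def by simp

lemma seq_len_seq4:
  assumes "is_seq4 s a b c d"
  shows "seq_len s (\<three> \<oplus> \<one>)"
proof (rule seq_lenI)
  show "set_cd s" using assms is_seq4_def by blast
  show "\<exists>i a. i \<prec> \<three> \<oplus> \<one> \<and> z = num_pair i a" if "in_cd z s" for z
  proof -
    have "z = num_pair \<zero> a \<or> z = num_pair \<one> b \<or> z = num_pair \<two> c \<or> z = num_pair \<three> d"
      using assms that is_seq4_def by blast
    then show ?thesis using less_four_iff by blast
  qed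
  show "\<exists>x. in_cd (num_pair i x) s" if "i \<prec> \<three> \<oplus> \<one>" for i
    using that[unfolded less_four_iff] unfolding seq_at_seq4[OF assms] by blast
  show "x = x'" if "in_cd (num_pair i x) s" "in_cd (num_pair i x') s" for i x x'
    using that small_numbers_neq unfolding seq_at_seq4[OF assms] by auto
qed

text \<open>The class may have nonstandard size, so the enumeration is constructed inside the model:
  starting from the prefix, all numbers up to \<open>B\<close> are scanned and each member that is
  still missing is appended. Pairwise distinctness of the prefix keeps the sequence free of
  repetitions.\<close>

lemma enumeration_with_prefix:
  assumes C: "\<And>t. d0_term t \<Longrightarrow> d0 (\<lambda>e. C (t e))" and bound: "\<And>x. C x \<Longrightarrow> x \<preceq> B"
    and R: "C a" "C b" "C c" "C d" "a \<noteq> b" "a \<noteq> c" "a \<noteq> d" "b \<noteq> c" "b \<noteq> d" "c \<noteq> d"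
  obtains s l where "enum_cls s C" "seq_len s l" "\<three> \<prec> l" "in_cd (num_pair \<zero> a) s"
    "in_cd (num_pair \<one> b) s" "in_cd (num_pair \<two> c) s" "in_cd (num_pair \<three> d) s"
proof -
  define E where "E s l j \<longleftrightarrow> seq_len s l \<and> \<three> \<prec> l \<and>
    in_cd (num_pair \<zero> a) s \<and> in_cd (num_pair \<one> b) s \<and> in_cd (num_pair \<two> c) s \<and>
    in_cd (num_pair \<three> d) s \<and>
    (\<forall>i. i \<prec> l \<longrightarrow> (\<forall>x. x \<prec> s \<longrightarrow> in_cd (num_pair i x) s \<longrightarrow> C x)) \<and>
    (\<forall>i. i \<prec> l \<longrightarrow> (\<forall>i'. i' \<prec> l \<longrightarrow> (\<forall>x. x \<prec> s \<longrightarrow>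
      in_cd (num_pair i x) s \<longrightarrow> in_cd (num_pair i' x) s \<longrightarrow> i = i'))) \<and>
    (\<forall>x. x \<prec> j \<longrightarrow> C x \<longrightarrow> (\<exists>i. i \<prec> l \<and> in_cd (num_pair i x) s))" for s l j
  have EI: "E s l j" if "seq_len s l" "\<three> \<prec> l" "in_cd (num_pair \<zero> a) s"
    "in_cd (num_pair \<one> b) s" "in_cd (num_pair \<two> c) s" "in_cd (num_pair \<three> d) s"
    "\<And>i x. in_cd (num_pair i x) s \<Longrightarrow> C x"
    "\<And>i i' x. in_cd (num_pair i x) s \<Longrightarrow> in_cd (num_pair i' x) s \<Longrightarrow> i = i'"
    "\<And>x. x \<prec> j \<Longrightarrow> C x \<Longrightarrow> \<exists>i. in_cd (num_pair i x) s" for s l j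
    unfolding E_def using that seq_lenD(5)[OF that(1)] by blast
  have ED: "seq_len s l" "\<three> \<prec> l" "in_cd (num_pair \<zero> a) s"
    "in_cd (num_pair \<one> b) s" "in_cd (num_pair \<two> c) s" "in_cd (num_pair \<three> d) s"
    "\<And>i x. in_cd (num_pair i x) s \<Longrightarrow> C x"
    "\<And>i i' x. in_cd (num_pair i x) s \<Longrightarrow> in_cd (num_pair i' x) s \<Longrightarrow> i = i'"
    "\<And>x. x \<prec> j \<Longrightarrow> C x \<Longrightarrow> \<exists>i. in_cd (num_pair i x) s" if "E s l j" for s l j
  proof -
    show s: "seq_len s l" and "\<three> \<prec> l" "in_cd (num_pair \<zero> a) s"
      "in_cd (num_pair \<one> b) s" "in_cd (num_pair \<two> c) s" "in_cd (num_pair \<three> d) s"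
      using that unfolding E_def by simp_all
    show "C x" if "in_cd (num_pair i x) s" for i x
      using \<open>E s l j\<close> that seq_lenD(5)[OF s that] in_cd_pair_less[OF that] unfolding E_def by blast
    show "i = i'" if i: "in_cd (num_pair i x) s" "in_cd (num_pair i' x) s" for i i' x
      using \<open>E s l j\<close> i seq_lenD(5)[OF s i(1)] seq_lenD(5)[OF s i(2)] in_cd_pair_less[OF i(1)]
      unfolding E_def by blast
    show "\<exists>i. in_cd (num_pair i x) s" if "x \<prec> j" "C x" for x
      using \<open>E s l j\<close> that unfolding E_def by blast
  qed
  \<comment> \<open>Sequence and length are placed below one number \<open>y\<close>, so that the
    induction formula has a single unbounded quantifier.\<close>
  have wit: "\<exists>y. \<exists>s. s \<preceq> y \<and> (\<exists>l. l \<preceq> y \<and> E s l j)" if E: "E s l j" for s l j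
    by (rule exI[of _ "s \<oplus> l"], rule exI[of _ s], rule conjI, rule le_add(1),
        rule exI[of _ l], rule conjI, rule le_add(2), rule E)
  have "\<exists>y. \<exists>s. s \<preceq> y \<and> (\<exists>l. l \<preceq> y \<and> E s l j)" for j
  proof (induction j rule: sigma1_induct)
    case definable
    show ?case unfolding E_def
      by (intro d0_intros d0_bex_le d0_seq_len d0_in_cd d0_term_num_pair C)
  next
    case zero
    obtain s where s: "is_seq4 s a b c d" using is_seq4_exists by blast
    have "E s (\<three> \<oplus> \<one>) \<zero>"
    proof (rule EI)
      show "seq_len s (\<three> \<oplus> \<one>)" using s by (rule seq_len_seq4)
      show "\<three> \<prec> \<three> \<oplus> \<one>" by (rule basic_axioms(8)[THEN iffD2]) simp
    qed (use R basic_axioms(7) in \<open>auto simp: seq_at_seq4[OF s]\<close>)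
    then show ?case by (rule wit)
  next
    case (step j)
    then obtain s l where E: "E s l j" by blast
    show ?case
    proof (cases "C j \<and> \<not> (\<exists>i. in_cd (num_pair i j) s)")
      case False
      then have "E s l (j \<oplus> \<one>)"
        using ED[OF E] by (intro EI) (auto simp: basic_axioms(8))
      then show ?thesis by (rule wit)
    next
      case True
      \<comment> \<open>The new entry takes position \<open>l\<close>, the old length, which is the
        first free one.\<close>
      let ?P = "\<lambda>z. in_cd z s \<or> z = num_pair l j"
      have "x \<prec> s \<oplus> num_pair l j \<oplus> \<one>" if "?P x" for x
        unfolding less_add_one_iff
        using that M.order_trans[OF M.less_imp_le[OF in_cd_less[of x s]] le_add(1)[of s "num_pair l j"]]
          le_add(2)[where x = s and y = "num_pair l j"] by blast
      moreover have "d0 (\<lambda>e. ?P (e 0))" by (intro d0_intros d0_in_cd)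
      ultimately obtain s' where s': "set_cd s'" "\<And>x. in_cd x s' \<longleftrightarrow> ?P x"
        using set_cd_exists_d0[of ?P] by blast
      have l: "in_cd (num_pair i x) s \<Longrightarrow> i \<noteq> l" for i x
        using seq_lenD(5)[OF ED(1)[OF E]] M.less_irrefl by blast
      have "seq_len s' (l \<oplus> \<one>)"
      proof (rule seq_lenI)
        show "\<exists>i a. i \<prec> l \<oplus> \<one> \<and> z = num_pair i a" if "in_cd z s'" for z
          using that seq_lenD(2)[OF ED(1)[OF E], of z] unfolding s'(2) basic_axioms(8) by blast
        show "x = x'" if "in_cd (num_pair i x) s'" "in_cd (num_pair i x') s'" for i x x'
          using that l seq_lenD(3)[OF ED(1)[OF E]] unfolding s'(2) num_pair_eq by blast
        show "\<exists>x. in_cd (num_pair i x) s'" if "i \<prec> l \<oplus> \<one>" for i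
          using that seq_lenD(4)[OF ED(1)[OF E], of i] unfolding s'(2) basic_axioms(8) by blast
      qed (rule s'(1))
      then have "E s' (l \<oplus> \<one>) (j \<oplus> \<one>)"
      proof (rule EI)
        show "\<three> \<prec> l \<oplus> \<one>" using ED(2)[OF E] basic_axioms(8) by blast
        show "C x" if "in_cd (num_pair i x) s'" for i x
          using that ED(7)[OF E] True unfolding s'(2) num_pair_eq by blast
        show "i = i'" if "in_cd (num_pair i x) s'" "in_cd (num_pair i' x) s'" for i i' x
          using that ED(8)[OF E] True unfolding s'(2) num_pair_eq by blast
        show "\<exists>i. in_cd (num_pair i x) s'" if "x \<prec> j \<oplus> \<one>" "C x" for x
          using that ED(9)[OF E, of x] unfolding s'(2) num_pair_eq basic_axioms(8) by blast
      qed (use ED(3-6)[OF E] s'(2) in blast)+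
      then show ?thesis by (rule wit)
    qed
  qed
  then obtain s l where E: "E s l (B \<oplus> \<one>)" by blast
  have "enum_cls s C"
    unfolding enum_cls_def
  proof (intro conjI allI impI)
    show "\<exists>l. seq_len s l" using ED(1)[OF E] by blast
    show "C x" if "in_cd (num_pair i x) s" for i x using ED(7)[OF E that] .
    fix x assume x: "C x"
    then have "x \<prec> B \<oplus> \<one>" using bound less_add_one_iff by blast
    then show "\<exists>i. in_cd (num_pair i x) s \<and> (\<forall>j. in_cd (num_pair j x) s \<longrightarrow> j = i)"
      using ED(8)[OF E] ED(9)[OF E _ x] by blast
  qed
  then show thesis using that ED[OF E] by blast
qed

end

section \<open>The theorem in a model\<close>

text \<open>The weak order ranking \<open>p\<close> and \<open>q\<close> first, then \<open>t\<close>, then everything else. Repetitions among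
  \<open>p\<close>, \<open>q\<close> and \<open>t\<close> give all the orders that the argument needs.\<close>

definition tier :: "'a \<Rightarrow> 'a \<Rightarrow> 'a \<Rightarrow> 'a \<Rightarrow> nat" where
  "tier p q t x = (if x = p \<or> x = q then 0 else if x = t then 1 else 2)"

text \<open>Ranks are natural numbers of HOL and not elements of the model. This form replaces their
  comparison by equations between alternatives, which are bounded definable.\<close>

lemma tier_le:
  "tier p q t x \<le> tier p q t y \<longleftrightarrow>
     (y = p \<or> y = q \<longrightarrow> x = p \<or> x = q) \<and>
     (y = p \<or> y = q \<or> y = t \<longrightarrow> x = p \<or> x = q \<or> x = t)"
  by (auto simp: tier_def)

section \<open>Weak orders on a finite set of alternatives\<close>

context rca0_model
begin

lemma weak_order_cdD:
  assumes "weak_order_cd X r"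
  shows "set_cd r" "x \<epsilon> X \<Longrightarrow> y \<epsilon> X \<Longrightarrow> in_cd (num_pair x y) r \<or> in_cd (num_pair y x) r"
    "in_cd (num_pair x y) r \<Longrightarrow> in_cd (num_pair y z) r \<Longrightarrow> in_cd (num_pair x z) r"
  using assms unfolding weak_order_cd_def by blast+

lemma weak_order_cd_bounded:
  assumes X: "\<forall>x. x \<epsilon> X \<longrightarrow> x \<prec> b"
  shows "weak_order_cd X r \<longleftrightarrow> set_cd r \<and>
    (\<forall>z. z \<prec> r \<longrightarrow> in_cd z r \<longrightarrow>
      (\<exists>x. x \<prec> b \<and> (\<exists>y. y \<prec> b \<and> x \<epsilon> X \<and> y \<epsilon> X \<and> z = num_pair x y))) \<and>
    (\<forall>x. x \<prec> b \<longrightarrow> (\<forall>y. y \<prec> b \<longrightarrow> (\<forall>z. z \<prec> b \<longrightarrow>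
      in_cd (num_pair x y) r \<longrightarrow> in_cd (num_pair y z) r \<longrightarrow> in_cd (num_pair x z) r))) \<and>
    (\<forall>x. x \<prec> b \<longrightarrow> (\<forall>y. y \<prec> b \<longrightarrow> x \<epsilon> X \<longrightarrow> y \<epsilon> X \<longrightarrow>
      in_cd (num_pair x y) r \<or> in_cd (num_pair y x) r))" (is "_ \<longleftrightarrow> ?R")
proof
  assume r: "weak_order_cd X r"
  have "\<exists>x. x \<prec> b \<and> (\<exists>y. y \<prec> b \<and> x \<epsilon> X \<and> y \<epsilon> X \<and> z = num_pair x y)" if "in_cd z r" for z
    using r that X unfolding weak_order_cd_def prod_cls_def by blast
  then show ?R using r unfolding weak_order_cd_def by blast
next
  assume r: ?R
  then have z: "\<exists>x y. x \<epsilon> X \<and> y \<epsilon> X \<and> z = num_pair x y" if "in_cd z r" for z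
    using in_cd_less[OF that] that by blast
  then have xy: "x \<epsilon> X \<and> y \<epsilon> X" if "in_cd (num_pair x y) r" for x y
    using that by fastforce
  show "weak_order_cd X r"
    unfolding weak_order_cd_def prod_cls_def
  proof (intro conjI allI impI)
    fix x y z assume "in_cd (num_pair x y) r \<and> in_cd (num_pair y z) r"
    moreover from this have "x \<prec> b" "y \<prec> b" "z \<prec> b" using X xy by blast+
    ultimately show "in_cd (num_pair x z) r" using r by blast
  qed (use r z X in blast)+
qed

lemma d0_weak_order_cd:
  assumes "\<forall>x. x \<epsilon> X \<longrightarrow> x \<prec> b" "d0_term t"
  shows "d0 (\<lambda>e. weak_order_cd X (t e))"
  unfolding weak_order_cd_bounded[OF assms(1)]
  by (intro d0_intros d0_set_cd d0_in_cd d0_term_num_pair d0_term_shift assms(2))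

text \<open>A weak order is a subset of the pairs from \<open>[0, b)\<close>, all of which are below
  \<open>num_pair b b\<close>; the uniform bound on codes of subsets then applies, codes being
  unique.\<close>

lemma weak_order_cd_bound:
  assumes X: "\<forall>x. x \<epsilon> X \<longrightarrow> x \<prec> b"
  obtains B where "\<And>r. weak_order_cd X r \<Longrightarrow> r \<preceq> B"
proof -
  obtain B where B: "\<And>Y. (\<And>x. x \<epsilon> Y \<Longrightarrow> x \<prec> num_pair b b) \<Longrightarrow>
      \<exists>c. c \<preceq> B \<and> set_cd c \<and> (\<forall>x. in_cd x c \<longleftrightarrow> x \<epsilon> Y)"
    using set_cd_exists_bounded[of "num_pair b b"] by blast
  have "r \<preceq> B" if r: "weak_order_cd X r" for r
  proof -
    obtain Y where Y: "\<And>x. x \<epsilon> Y \<longleftrightarrow> in_cd x r"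
      using d0_comprehension[of "\<lambda>x. in_cd x r", OF d0_in_cd[OF d0_term_var d0_term_const]] by blast
    have "z \<prec> num_pair b b" if "z \<epsilon> Y" for z
    proof -
      have "in_cd z r" using \<open>z \<epsilon> Y\<close> Y by blast
      then obtain x y where xy: "x \<prec> b" "y \<prec> b" and z: "z = num_pair x y"
        using r X unfolding weak_order_cd_def prod_cls_def by blast
      show ?thesis unfolding z using num_pair_sum_less[OF M.add_strict_mono[OF xy]] .
    qed
    then obtain c where "c \<preceq> B" "set_cd c" "\<And>x. in_cd x c \<longleftrightarrow> x \<epsilon> Y" using B by blast
    moreover have "set_cd r" using r by (rule weak_order_cdD(1))
    ultimately show ?thesis using set_cd_unique[of c r] Y by blast
  qed
  then show thesis by (rule that)
qed

lemma tier_order_exists: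
  assumes X: "\<forall>x. x \<epsilon> X \<longrightarrow> x \<prec> b"
  shows "\<exists>r. weak_order_cd X r \<and> (\<forall>x y. x \<epsilon> X \<longrightarrow> y \<epsilon> X \<longrightarrow>
    (in_cd (num_pair x y) r \<longleftrightarrow> tier p q t x \<le> tier p q t y))"
proof -
  let ?P = "\<lambda>z. \<exists>x. x \<prec> b \<and> (\<exists>y. y \<prec> b \<and> x \<epsilon> X \<and> y \<epsilon> X \<and> z = num_pair x y \<and>
    tier p q t x \<le> tier p q t y)"
  have "d0 (\<lambda>e. ?P (e 0))"
    unfolding tier_le by (intro d0_intros d0_term_num_pair)
  moreover have "z \<prec> num_pair b b" if "?P z" for z
    using that num_pair_sum_less[OF M.add_strict_mono, of _ b _ b] by blast
  ultimately obtain r where r: "set_cd r" "\<And>z. in_cd z r \<longleftrightarrow> ?P z"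
    using set_cd_exists_d0[of ?P] by blast
  have xy: "in_cd (num_pair x y) r \<longleftrightarrow> x \<epsilon> X \<and> y \<epsilon> X \<and> tier p q t x \<le> tier p q t y" for x y
    unfolding r(2) num_pair_eq using X by blast
  have "\<exists>x y. x \<epsilon> X \<and> y \<epsilon> X \<and> z = num_pair x y" if "in_cd z r" for z
    using that unfolding r(2) by blast
  then have "weak_order_cd X r"
    unfolding weak_order_cd_def prod_cls_def xy using r(1) by (auto intro: order_trans)
  then show ?thesis using xy by blast
qed

end

section \<open>Preferences, independence and the algebra of coalitions\<close>

locale social_model = rca0_model +
  fixes V X A F e \<sigma>
  assumes society: "society V X A F" and embedding: "embedding V X A F e"
    and welfare: "welfare_function V X F \<sigma>"
begin

abbreviation elem :: "'a \<Rightarrow> 'a \<Rightarrow> bool" where "elem v n \<equiv> num_pair n v \<epsilon> A"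

abbreviation strictly :: "'a \<Rightarrow> 'a \<Rightarrow> 'a \<Rightarrow> 'a \<Rightarrow> bool" where
  "strictly i v \<equiv> strict_rel (prefers F i v)"

abbreviation strictly_social :: "'a \<Rightarrow> 'a \<Rightarrow> 'a \<Rightarrow> bool" where
  "strictly_social i \<equiv> strict_rel (social \<sigma> i)"

lemma X_bound: obtains b where "\<forall>x. x \<epsilon> X \<longrightarrow> x \<prec> b"
  using society society_def by blast

lemma three_alternatives:
  obtains x y z where "x \<epsilon> X" "y \<epsilon> X" "z \<epsilon> X" "x \<noteq> y" "x \<noteq> z" "y \<noteq> z"
proof -
  obtain k where c: "card_cls (\<lambda>x. x \<epsilon> X) k" and "\<three> \<prec> k \<or> \<three> = k"
    using society society_def by blast
  then have k: "\<three> \<preceq> k" unfolding num_le_def by blast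
  obtain s where s: "seq_len s k" "enum_cls s (\<lambda>x. x \<epsilon> X)"
    using c card_cls_def by blast
  have s2: "in_cd (num_pair i x) s \<Longrightarrow> x \<epsilon> X" for i x
    using s(2) unfolding enum_cls_def by blast
  have s3: "in_cd (num_pair i x) s \<Longrightarrow> in_cd (num_pair j x) s \<Longrightarrow> i = j" for i j x
    using s(2) unfolding enum_cls_def by metis
  have "\<zero> \<prec> k" "\<one> \<prec> k" "\<two> \<prec> k"
    using M.less_le_trans[OF _ k] small_numbers_less by blast+
  then obtain x y z where xyz: "in_cd (num_pair \<zero> x) s" "in_cd (num_pair \<one> y) s" "in_cd (num_pair \<two> z) s"
    using seq_lenD(4)[OF s(1)] by metis
  have "x \<noteq> y" "x \<noteq> z" "y \<noteq> z"
    using s3[OF xyz(1), of \<one>] s3[OF xyz(1), of \<two>] s3[OF xyz(2), of \<two>] xyz small_numbers_neq by blast+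
  then show thesis by (rule that[OF s2[OF xyz(1)] s2[OF xyz(2)] s2[OF xyz(3)]])
qed

lemma profile_function: "fun_cls (\<lambda>x. num_pair i x \<epsilon> F) (\<lambda>x. x \<epsilon> V) (weak_order_cd X)"
  using society society_def by blast

lemma profile_value:
  assumes "v \<epsilon> V"
  obtains r where "weak_order_cd X r" "num_pair i (num_pair v r) \<epsilon> F"
  using that assms profile_function[of i] unfolding fun_cls_def by blast

lemma prefers_iff:
  assumes "num_pair i (num_pair v r) \<epsilon> F"
  shows "prefers F i v x y \<longleftrightarrow> in_cd (num_pair x y) r"
proof -
  have "num_pair i (num_pair v r') \<epsilon> F \<Longrightarrow> r' = r" for r'
    using assms profile_function[of i] unfolding fun_cls_def by blast
  then show ?thesis using assms unfolding prefers_def by blast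
qed

lemma prefers_total:
  assumes "v \<epsilon> V" "x \<epsilon> X" "y \<epsilon> X"
  shows "prefers F i v x y \<or> prefers F i v y x"
proof -
  obtain r where r: "weak_order_cd X r" "num_pair i (num_pair v r) \<epsilon> F"
    using assms(1) by (rule profile_value)
  show ?thesis using weak_order_cdD(2)[OF r(1) assms(2,3)] unfolding prefers_iff[OF r(2)] .
qed

lemma social_value:
  obtains r where "weak_order_cd X r" "\<And>x y. social \<sigma> i x y \<longleftrightarrow> in_cd (num_pair x y) r"
proof -
  have f: "fun_cls (\<lambda>x. x \<epsilon> \<sigma>) (\<lambda>x. x = x) (weak_order_cd X)"
    using welfare welfare_function_def by blast
  then obtain r where r: "weak_order_cd X r" "num_pair i r \<epsilon> \<sigma>"
    unfolding fun_cls_def by blast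
  then have "num_pair i r' \<epsilon> \<sigma> \<Longrightarrow> r' = r" for r'
    using f unfolding fun_cls_def by blast
  then show thesis using that r unfolding social_def by blast
qed

lemma social_total: "x \<epsilon> X \<Longrightarrow> y \<epsilon> X \<Longrightarrow> social \<sigma> i x y \<or> social \<sigma> i y x"
  by (rule social_value[of i]) (simp add: weak_order_cdD(2))

lemma social_trans: "social \<sigma> i x y \<Longrightarrow> social \<sigma> i y z \<Longrightarrow> social \<sigma> i x z"
  by (rule social_value[of i]) (simp, rule weak_order_cdD(3))

lemma strictly_social_trans:
  "strictly_social i x y \<Longrightarrow> strictly_social i y z \<Longrightarrow> strictly_social i x z"
  "social \<sigma> i x y \<Longrightarrow> strictly_social i y z \<Longrightarrow> strictly_social i x z"
  unfolding strict_rel_def using social_trans by blast+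

lemma unanimity:
  "x \<epsilon> X \<Longrightarrow> y \<epsilon> X \<Longrightarrow> (\<And>v. v \<epsilon> V \<Longrightarrow> strictly i v x y) \<Longrightarrow> strictly_social i x y"
  using welfare unfolding welfare_function_def strict_on_def by blast

lemma independence:
  assumes "x \<epsilon> X" "y \<epsilon> X"
    and "\<And>v. v \<epsilon> V \<Longrightarrow> prefers F i v x y \<longleftrightarrow> prefers F j v x y"
    and "\<And>v. v \<epsilon> V \<Longrightarrow> prefers F i v y x \<longleftrightarrow> prefers F j v y x"
  shows "strictly_social i x y \<longleftrightarrow> strictly_social j x y"
proof -
  have "agree_on (prefers F i v) (prefers F j v) x y" if v: "v \<epsilon> V" for v
  proof -
    \<comment> \<open>\<open>agree_on\<close> also compares each alternative with itself; there both
      profiles agree by totality.\<close>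
    have "prefers F k v z z" if "z = x \<or> z = y" for k z
      using prefers_total[OF v, of z z k] assms(1,2) that by blast
    then show ?thesis
      using assms(3,4)[OF v] unfolding agree_on_def by auto
  qed
  then have "agree_on (social \<sigma> i) (social \<sigma> j) x y"
    using welfare assms(1,2) unfolding welfare_function_def by blast
  then show ?thesis
    unfolding agree_on_def strict_rel_def by blast
qed

lemma algebra: "is_algebra V A"
  using society society_def by blast

lemma elem_V: "elem v n \<Longrightarrow> v \<epsilon> V"
  by (rule algebra[unfolded is_algebra_def, THEN conjunct1, rule_format])

lemma alg_int: obtains k where "\<And>v. elem v k \<longleftrightarrow> elem v i \<and> elem v j"
proof -
  obtain k where "\<forall>v. elem v k \<longleftrightarrow> elem v i \<and> elem v j"
    using algebra[unfolded is_algebra_def, THEN conjunct2, THEN conjunct2, THEN conjunct2, THEN conjunct1, THEN spec, of i, THEN spec, of j] ..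
  then show thesis using that[of k] by blast
qed

lemma alg_compl: obtains k where "\<And>v. elem v k \<longleftrightarrow> v \<epsilon> V \<and> \<not> elem v i"
proof -
  obtain k where "\<forall>v. elem v k \<longleftrightarrow> v \<epsilon> V \<and> \<not> elem v i"
    using algebra[unfolded is_algebra_def, THEN conjunct2, THEN conjunct2, THEN conjunct2, THEN conjunct2, THEN spec, of i] ..
  then show thesis using that[of k] by blast
qed

lemma alg_diff: obtains k where "\<And>v. elem v k \<longleftrightarrow> elem v i \<and> \<not> elem v j"
proof -
  obtain l where l: "\<And>v. elem v l \<longleftrightarrow> v \<epsilon> V \<and> \<not> elem v j" by (rule alg_compl[of j]) blast
  obtain k where "\<And>v. elem v k \<longleftrightarrow> elem v i \<and> elem v l" by (rule alg_int[of i l]) blast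
  then show thesis using that l elem_V by blast
qed

lemma alg_empty: obtains k where "\<And>v. \<not> elem v k"
proof -
  \<comment> \<open>\<open>undefined\<close> is merely some index: any set of the algebra minus
    itself is empty.\<close>
  obtain k where "\<And>v. elem v k \<longleftrightarrow> elem v undefined \<and> \<not> elem v undefined" by (rule alg_diff[of undefined undefined]) blast
  then show thesis using that by blast
qed

lemma society_measurable: "measurable_by V X A F"
  using society society_def by blast

lemma measurable:
  assumes "x \<epsilon> X" "y \<epsilon> X"
  obtains k where "\<And>v. v \<epsilon> V \<Longrightarrow> elem v k \<longleftrightarrow> prefers F i v x y"
proof -
  obtain \<mu> where m: "fun_cls (\<lambda>x. x \<epsilon> \<mu>)
      (prod_cls (\<lambda>x. x = x) (prod_cls (\<lambda>x. x \<epsilon> X) (\<lambda>x. x \<epsilon> X))) (\<lambda>x. x = x)"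
    "\<And>n x y v. x \<epsilon> X \<Longrightarrow> y \<epsilon> X \<Longrightarrow> v \<epsilon> V \<Longrightarrow> prefers F n v x y \<longleftrightarrow>
          (\<exists>k. num_pair (num_pair n (num_pair x y)) k \<epsilon> \<mu> \<and> num_pair k v \<epsilon> A)"
    using society_measurable unfolding measurable_by_def by blast
  have "prod_cls (\<lambda>x. x = x) (prod_cls (\<lambda>x. x \<epsilon> X) (\<lambda>x. x \<epsilon> X)) (num_pair i (num_pair x y))"
    unfolding prod_cls_def using assms by blast
  then obtain k where k: "num_pair (num_pair i (num_pair x y)) k \<epsilon> \<mu>"
    using m(1) unfolding fun_cls_def by blast
  moreover have "num_pair (num_pair i (num_pair x y)) k' \<epsilon> \<mu> \<Longrightarrow> k' = k" for k'
    using m(1) k unfolding fun_cls_def by blast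
  ultimately show thesis using that[of k] m(2)[OF assms] by blast
qed

section \<open>Profiles with four prescribed values\<close>

definition tier_order :: "'a \<Rightarrow> 'a \<Rightarrow> 'a \<Rightarrow> 'a" where
  "tier_order p q t = (SOME r. weak_order_cd X r \<and> (\<forall>x y. x \<epsilon> X \<longrightarrow> y \<epsilon> X \<longrightarrow>
    (in_cd (num_pair x y) r \<longleftrightarrow> tier p q t x \<le> tier p q t y)))"

lemma tier_order: "weak_order_cd X (tier_order p q t)"
  and in_tier_order: "x \<epsilon> X \<Longrightarrow> y \<epsilon> X \<Longrightarrow>
    in_cd (num_pair x y) (tier_order p q t) \<longleftrightarrow> tier p q t x \<le> tier p q t y"
proof -
  obtain b where b: "\<forall>x. x \<epsilon> X \<longrightarrow> x \<prec> b" by (rule X_bound)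
  have "weak_order_cd X (tier_order p q t) \<and> (\<forall>x y. x \<epsilon> X \<longrightarrow> y \<epsilon> X \<longrightarrow>
    (in_cd (num_pair x y) (tier_order p q t) \<longleftrightarrow> tier p q t x \<le> tier p q t y))"
    unfolding tier_order_def by (rule someI_ex[OF tier_order_exists[OF b]])
  then show "weak_order_cd X (tier_order p q t)" and "x \<epsilon> X \<Longrightarrow> y \<epsilon> X \<Longrightarrow>
    in_cd (num_pair x y) (tier_order p q t) \<longleftrightarrow> tier p q t x \<le> tier p q t y"
    by blast+
qed

lemma tier_order_neqI:
  assumes "x \<epsilon> X" "y \<epsilon> X" "tier p q t x \<le> tier p q t y \<longleftrightarrow> \<not> tier p' q' t' x \<le> tier p' q' t' y"
  shows "tier_order p q t \<noteq> tier_order p' q' t'"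
  using in_tier_order[OF assms(1,2)] assms(3) by metis

text \<open>The length condition says that there are at least four weak orders, so that sequences of
  length four are admissible quasi-partitions.\<close>

definition starts_with :: "'a \<Rightarrow> 'a \<Rightarrow> 'a \<Rightarrow> 'a \<Rightarrow> 'a \<Rightarrow> bool" where
  "starts_with p a b c d \<longleftrightarrow> enum_cls p (weak_order_cd X) \<and> (\<exists>l. seq_len p l \<and> \<three> \<prec> l) \<and>
     in_cd (num_pair \<zero> a) p \<and> in_cd (num_pair \<one> b) p \<and> in_cd (num_pair \<two> c) p \<and>
     in_cd (num_pair \<three> d) p"

lemma starts_with_exists:
  assumes "weak_order_cd X a" "weak_order_cd X b" "weak_order_cd X c" "weak_order_cd X d"
    and "a \<noteq> b" "a \<noteq> c" "a \<noteq> d" "b \<noteq> c" "b \<noteq> d" "c \<noteq> d"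
  obtains p where "starts_with p a b c d"
proof -
  obtain b' where b': "\<forall>x. x \<epsilon> X \<longrightarrow> x \<prec> b'" by (rule X_bound)
  obtain B where B: "\<And>r. weak_order_cd X r \<Longrightarrow> r \<preceq> B" using weak_order_cd_bound[OF b'] by blast
  obtain p l where "enum_cls p (weak_order_cd X)" "seq_len p l" "\<three> \<prec> l" "in_cd (num_pair \<zero> a) p"
    "in_cd (num_pair \<one> b) p" "in_cd (num_pair \<two> c) p" "in_cd (num_pair \<three> d) p"
    by (rule enumeration_with_prefix[of "weak_order_cd X" B a b c d])
      (use d0_weak_order_cd[OF b'] B assms in blast)+
  then show thesis using that unfolding starts_with_def by blast
qed

lemma embedding_defined:
  assumes p: "starts_with p a b c d" and s: "is_seq4 s i j k l"
  obtains n where "num_pair (num_pair p s) n \<epsilon> e" "\<And>n'. num_pair (num_pair p s) n' \<epsilon> e \<Longrightarrow> n' = n"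
proof -
  obtain m where m: "seq_len p m" "\<three> \<prec> m" using p starts_with_def by blast
  have "card_cls (weak_order_cd X) m"
    using p m unfolding starts_with_def card_cls_def by blast
  moreover have "seq_len s (\<three> \<oplus> \<one>)" using s by (rule seq_len_seq4)
  moreover have "\<three> \<oplus> \<one> \<preceq> m" using m(2) by (simp only: add_one_le_iff)
  moreover have "\<one> \<prec> \<three> \<oplus> \<one>" unfolding less_four_iff by blast
  ultimately have "qpart_cls X s" unfolding qpart_cls_def num_le_def by blast
  then have "prod_cls (\<lambda>p. enum_cls p (weak_order_cd X)) (qpart_cls X) (num_pair p s)"
    using p unfolding prod_cls_def starts_with_def by blast
  moreover have f: "fun_cls (\<lambda>x. x \<epsilon> e)
      (prod_cls (\<lambda>p. enum_cls p (weak_order_cd X)) (qpart_cls X)) (\<lambda>x. x = x)"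
    using embedding unfolding embedding_def by blast
  ultimately obtain n where n: "num_pair (num_pair p s) n \<epsilon> e" unfolding fun_cls_def by blast
  then show thesis using that[OF n] f unfolding fun_cls_def by blast
qed

lemma embedding_value:
  assumes p: "starts_with p a b c d" and s: "is_seq4 s i j k l"
    and n: "num_pair (num_pair p s) n \<epsilon> e" and v: "v \<epsilon> V"
  shows "elem v i \<Longrightarrow> \<not> elem v j \<Longrightarrow> \<not> elem v k \<Longrightarrow> num_pair n (num_pair v a) \<epsilon> F"
    "elem v j \<Longrightarrow> \<not> elem v i \<Longrightarrow> \<not> elem v k \<Longrightarrow> num_pair n (num_pair v b) \<epsilon> F"
    "elem v k \<Longrightarrow> \<not> elem v i \<Longrightarrow> \<not> elem v j \<Longrightarrow> num_pair n (num_pair v c) \<epsilon> F"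
    "\<not> elem v i \<Longrightarrow> \<not> elem v j \<Longrightarrow> \<not> elem v k \<Longrightarrow> num_pair n (num_pair v d) \<epsilon> F"
proof -
  have sel: "selects A s \<three> v x \<longleftrightarrow>
      x = \<zero> \<and> elem v i \<or> x = \<one> \<and> elem v j \<or> x = \<two> \<and> elem v k" for x
    unfolding selects_def seq_at_seq4[OF s] using small_numbers_less M.less_irrefl by blast
  obtain m where m: "seq_len p m" using p starts_with_def by blast
  have emb: "\<And>x. selects A s \<three> v x \<Longrightarrow> (\<And>y. selects A s \<three> v y \<Longrightarrow> y = x) \<Longrightarrow>
          \<exists>r. in_cd (num_pair x r) p \<and> num_pair n (num_pair v r) \<epsilon> F"
    "\<not> (\<exists>x. selects A s \<three> v x) \<Longrightarrow>
          \<exists>r. in_cd (num_pair \<three> r) p \<and> num_pair n (num_pair v r) \<epsilon> F"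
    using embedding n v seq_len_seq4[OF s] unfolding embedding_def by blast+
  have val: "num_pair n (num_pair v r) \<epsilon> F"
    if "\<exists>r. in_cd (num_pair x r) p \<and> num_pair n (num_pair v r) \<epsilon> F" "in_cd (num_pair x r) p" for x r
    using that seq_lenD(3)[OF m] by blast
  have p': "in_cd (num_pair \<zero> a) p" "in_cd (num_pair \<one> b) p" "in_cd (num_pair \<two> c) p"
    "in_cd (num_pair \<three> d) p"
    using p unfolding starts_with_def by blast+
  show "num_pair n (num_pair v a) \<epsilon> F" if "elem v i" "\<not> elem v j" "\<not> elem v k"
    by (rule val[OF emb(1) p'(1)]) (use that sel in auto)
  show "num_pair n (num_pair v b) \<epsilon> F" if "elem v j" "\<not> elem v i" "\<not> elem v k"
    by (rule val[OF emb(1) p'(2)]) (use that sel in auto)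
  show "num_pair n (num_pair v c) \<epsilon> F" if "elem v k" "\<not> elem v i" "\<not> elem v j"
    by (rule val[OF emb(1) p'(3)]) (use that sel in auto)
  show "num_pair n (num_pair v d) \<epsilon> F" if "\<not> elem v i" "\<not> elem v j" "\<not> elem v k"
    by (rule val[OF emb(2) p'(4)]) (use that sel in auto)
qed

text \<open>The permutation and the code are given here rather than chosen, since the existence of
  the ultrafilter needs the same permutation for all indices.\<close>

lemma tier_profile_value:
  assumes p: "starts_with p (tier_order p0 q0 t0) (tier_order p1 q1 t1) (tier_order p2 q2 t2)
      (tier_order p3 q3 t3)"
    and s: "is_seq4 s i j k l" and n: "num_pair (num_pair p s) n \<epsilon> e"
    and disj: "\<And>v. elem v i \<Longrightarrow> \<not> elem v j \<and> \<not> elem v k" "\<And>v. elem v j \<Longrightarrow> \<not> elem v k"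
    and v: "v \<epsilon> V" and xy: "x \<epsilon> X" "y \<epsilon> X"
  shows "prefers F n v x y \<longleftrightarrow>
    (if elem v i then tier p0 q0 t0 x \<le> tier p0 q0 t0 y
     else if elem v j then tier p1 q1 t1 x \<le> tier p1 q1 t1 y
     else if elem v k then tier p2 q2 t2 x \<le> tier p2 q2 t2 y
     else tier p3 q3 t3 x \<le> tier p3 q3 t3 y)"
proof -
  note val = embedding_value[OF p s n v]
  consider "elem v i" "\<not> elem v j" "\<not> elem v k" | "elem v j" "\<not> elem v i" "\<not> elem v k"
    | "elem v k" "\<not> elem v i" "\<not> elem v j" | "\<not> elem v i" "\<not> elem v j" "\<not> elem v k"
    using disj by blast
  then show ?thesis
  proof cases
    case 1
    then show ?thesis using prefers_iff[OF val(1)] in_tier_order[OF xy] by simp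
  next
    case 2
    then show ?thesis using prefers_iff[OF val(2)] in_tier_order[OF xy] by simp
  next
    case 3
    then show ?thesis using prefers_iff[OF val(3)] in_tier_order[OF xy] by simp
  next
    case 4
    then show ?thesis using prefers_iff[OF val(4)] in_tier_order[OF xy] by simp
  qed
qed

text \<open>The distinctness hypotheses allow the four orders to be the first entries of one
  permutation. Disjointness of the three sets ensures that the selecting position is unique whenever
  there is one; all remaining voters receive the fourth order.\<close>

lemma tier_profile:
  assumes neq: "tier_order p0 q0 t0 \<noteq> tier_order p1 q1 t1" "tier_order p0 q0 t0 \<noteq> tier_order p2 q2 t2"
    "tier_order p0 q0 t0 \<noteq> tier_order p3 q3 t3" "tier_order p1 q1 t1 \<noteq> tier_order p2 q2 t2"
    "tier_order p1 q1 t1 \<noteq> tier_order p3 q3 t3" "tier_order p2 q2 t2 \<noteq> tier_order p3 q3 t3"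
    and disj: "\<And>v. elem v i \<Longrightarrow> \<not> elem v j \<and> \<not> elem v k" "\<And>v. elem v j \<Longrightarrow> \<not> elem v k"
  obtains n where "\<And>v x y. v \<epsilon> V \<Longrightarrow> x \<epsilon> X \<Longrightarrow> y \<epsilon> X \<Longrightarrow> prefers F n v x y \<longleftrightarrow>
    (if elem v i then tier p0 q0 t0 x \<le> tier p0 q0 t0 y
     else if elem v j then tier p1 q1 t1 x \<le> tier p1 q1 t1 y
     else if elem v k then tier p2 q2 t2 x \<le> tier p2 q2 t2 y
     else tier p3 q3 t3 x \<le> tier p3 q3 t3 y)"
proof -
  obtain p where p: "starts_with p (tier_order p0 q0 t0) (tier_order p1 q1 t1)
      (tier_order p2 q2 t2) (tier_order p3 q3 t3)"
    by (rule starts_with_exists[OF tier_order tier_order tier_order tier_order neq])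
  \<comment> \<open>the last entry of a quasi-partition is never read\<close>
  obtain s where s: "is_seq4 s i j k k" using is_seq4_exists by blast
  obtain n where n: "num_pair (num_pair p s) n \<epsilon> e" by (rule embedding_defined[OF p s])
  show thesis
    by (rule that[of n], rule tier_profile_value[OF p s n]) (use disj in blast)+
qed

end

section \<open>Forced preferences and field expansion\<close>

context social_model
begin

text \<open>Almost decisiveness in existential form: the coalition prevails against unanimous
  opposition at one profile. By independence it then prevails at every such profile, which is
  \<open>forcesD\<close>.\<close>

definition forces :: "'a \<Rightarrow> 'a \<Rightarrow> 'a \<Rightarrow> bool" where
  "forces n x y \<longleftrightarrow> (\<exists>i. strictly_social i x y \<and>
     (\<forall>v. v \<epsilon> V \<longrightarrow> (if elem v n then strictly i v x y else strictly i v y x)))"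

lemma forcesD:
  assumes "forces n x y" "x \<epsilon> X" "y \<epsilon> X"
    and "\<And>v. v \<epsilon> V \<Longrightarrow> elem v n \<Longrightarrow> strictly j v x y"
    and "\<And>v. v \<epsilon> V \<Longrightarrow> \<not> elem v n \<Longrightarrow> strictly j v y x"
  shows "strictly_social j x y"
proof -
  obtain i where i: "strictly_social i x y"
    "\<And>v. v \<epsilon> V \<Longrightarrow> elem v n \<Longrightarrow> strictly i v x y"
    "\<And>v. v \<epsilon> V \<Longrightarrow> \<not> elem v n \<Longrightarrow> strictly i v y x"
    using assms(1) unfolding forces_def by meson
  have "prefers F i v x y \<longleftrightarrow> prefers F j v x y" "prefers F i v y x \<longleftrightarrow> prefers F j v y x"
    if "v \<epsilon> V" for v
    using i(2,3)[OF that] assms(4,5)[OF that] unfolding strict_rel_def by blast+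
  then show ?thesis using independence[OF assms(2,3), of i j] i(1) by blast
qed

text \<open>Field expansion: the auxiliary profile copies the given ranking of the pair in question and
  places the third alternative so that unanimity and the forced pair settle that pair socially.
  It is at this point that measurability is needed.\<close>

context
  fixes x y z :: 'a
  assumes X3: "x \<epsilon> X" "y \<epsilon> X" "z \<epsilon> X" and distinct: "x \<noteq> y" "x \<noteq> z" "y \<noteq> z"
begin

text \<open>Outside \<open>n\<close> there are three ways to rank \<open>a\<close> and
  \<open>b\<close>. Two of them receive an index here; the third is left to the default value of the
  embedding.\<close>

lemma indifference_profile:
  assumes ab: "a \<epsilon> X" "b \<epsilon> X"
  obtains j k where "\<And>v. v \<epsilon> V \<Longrightarrow> elem v j \<longleftrightarrow> \<not> elem v n \<and> strictly i v a b"
    "\<And>v. v \<epsilon> V \<Longrightarrow> elem v k \<longleftrightarrow> \<not> elem v n \<and> prefers F i v a b \<and> prefers F i v b a"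
proof -
  obtain l where l: "\<And>v. v \<epsilon> V \<Longrightarrow> elem v l \<longleftrightarrow> prefers F i v a b"
    by (rule measurable[OF ab, of i]) blast
  obtain m where m: "\<And>v. v \<epsilon> V \<Longrightarrow> elem v m \<longleftrightarrow> prefers F i v b a"
    by (rule measurable[OF ab(2,1), of i]) blast
  obtain j' where j': "\<And>v. elem v j' \<longleftrightarrow> elem v l \<and> \<not> elem v m" by (rule alg_diff[of l m]) blast
  obtain j where j: "\<And>v. elem v j \<longleftrightarrow> elem v j' \<and> \<not> elem v n" by (rule alg_diff[of j' n]) blast
  obtain k' where k': "\<And>v. elem v k' \<longleftrightarrow> elem v l \<and> elem v m" by (rule alg_int[of l m]) blast
  obtain k where k: "\<And>v. elem v k \<longleftrightarrow> elem v k' \<and> \<not> elem v n" by (rule alg_diff[of k' n]) blast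
  show thesis
    by (rule that[of j k]) (auto simp: j j' k k' l m strict_rel_def)
qed

lemma forces_decisive_right:
  assumes f: "forces n x y"
  shows "decisive_pair A F \<sigma> n x z"
  unfolding decisive_pair_def strict_on_def
proof (intro allI impI)
  fix i assume "\<forall>v. elem v n \<longrightarrow> strictly i v x z"
  then have i: "strictly i v x z" if "elem v n" for v using that by blast
  obtain j k where jk: "\<And>v. v \<epsilon> V \<Longrightarrow> elem v j \<longleftrightarrow> \<not> elem v n \<and> strictly i v x z"
    "\<And>v. v \<epsilon> V \<Longrightarrow> elem v k \<longleftrightarrow> \<not> elem v n \<and> prefers F i v x z \<and> prefers F i v z x"
    by (rule indifference_profile[OF X3(1,3), of n i]) blast
  have disj: "\<And>v. elem v n \<Longrightarrow> \<not> elem v j \<and> \<not> elem v k" "\<And>v. elem v j \<Longrightarrow> \<not> elem v k"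
    using jk elem_V unfolding strict_rel_def by blast+
  \<comment> \<open>On \<open>n\<close> the order is x < y < z. Elsewhere \<open>y\<close> comes
    first and \<open>x\<close>, \<open>z\<close> are ranked as in profile \<open>i\<close>. So y < z
    is unanimous, while x < y holds on \<open>n\<close> and y < x outside, where the forced
    preference decides.\<close>
  obtain m where m: "\<And>v a b. v \<epsilon> V \<Longrightarrow> a \<epsilon> X \<Longrightarrow> b \<epsilon> X \<Longrightarrow> prefers F m v a b \<longleftrightarrow>
    (if elem v n then tier x x y a \<le> tier x x y b
     else if elem v j then tier y y x a \<le> tier y y x b
     else if elem v k then tier y y y a \<le> tier y y y b
     else tier y y z a \<le> tier y y z b)"
  proof (rule tier_profile[of x x y y y x y y y y y z n j k])
    show "tier_order x x y \<noteq> tier_order y y x" "tier_order x x y \<noteq> tier_order y y y"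
      "tier_order x x y \<noteq> tier_order y y z"
      by (rule tier_order_neqI[OF X3(1,2)], use distinct in \<open>simp add: tier_def\<close>)+
    show "tier_order y y x \<noteq> tier_order y y y" "tier_order y y x \<noteq> tier_order y y z"
      by (rule tier_order_neqI[OF X3(3,1)], use distinct in \<open>simp add: tier_def\<close>)+
    show "tier_order y y y \<noteq> tier_order y y z"
      by (rule tier_order_neqI[OF X3(1,3)], use distinct in \<open>simp add: tier_def\<close>)
  qed (use disj in blast)+
  have "strictly_social m x y"
    by (rule forcesD[OF f X3(1,2)]) (use X3 distinct in \<open>auto simp: strict_rel_def m tier_def\<close>)
  moreover have "strictly_social m y z"
    by (rule unanimity[OF X3(2,3)]) (use X3 distinct in \<open>auto simp: strict_rel_def m tier_def\<close>)
  ultimately have "strictly_social m x z" by (rule strictly_social_trans(1))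
  moreover have "(prefers F m v x z \<longleftrightarrow> prefers F i v x z) \<and> (prefers F m v z x \<longleftrightarrow> prefers F i v z x)"
    if v: "v \<epsilon> V" for v
    using i[of v] jk[OF v] prefers_total[OF v X3(1,3), of i] X3 distinct v
    by (auto simp: strict_rel_def m tier_def)
  ultimately show "strictly_social i x z"
    using independence[OF X3(1,3), of m i] by blast
qed

lemma forces_decisive_left:
  assumes f: "forces n x y"
  shows "decisive_pair A F \<sigma> n z y"
  unfolding decisive_pair_def strict_on_def
proof (intro allI impI)
  fix i assume "\<forall>v. elem v n \<longrightarrow> strictly i v z y"
  then have i: "strictly i v z y" if "elem v n" for v using that by blast
  obtain j k where jk: "\<And>v. v \<epsilon> V \<Longrightarrow> elem v j \<longleftrightarrow> \<not> elem v n \<and> strictly i v z y"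
    "\<And>v. v \<epsilon> V \<Longrightarrow> elem v k \<longleftrightarrow> \<not> elem v n \<and> prefers F i v z y \<and> prefers F i v y z"
    by (rule indifference_profile[OF X3(3,2), of n i]) blast
  have disj: "\<And>v. elem v n \<Longrightarrow> \<not> elem v j \<and> \<not> elem v k" "\<And>v. elem v j \<Longrightarrow> \<not> elem v k"
    using jk elem_V unfolding strict_rel_def by blast+
  \<comment> \<open>On \<open>n\<close> the order is z < x < y. Elsewhere \<open>x\<close> comes
    after both \<open>z\<close> and \<open>y\<close>, which are ranked as in profile
    \<open>i\<close>. So z < x is unanimous and x < y is forced.\<close>
  obtain m where m: "\<And>v a b. v \<epsilon> V \<Longrightarrow> a \<epsilon> X \<Longrightarrow> b \<epsilon> X \<Longrightarrow> prefers F m v a b \<longleftrightarrow>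
    (if elem v n then tier z z x a \<le> tier z z x b
     else if elem v j then tier z z y a \<le> tier z z y b
     else if elem v k then tier z y x a \<le> tier z y x b
     else tier y y z a \<le> tier y y z b)"
  proof (rule tier_profile[of z z x z z y z y x y y z n j k])
    show "tier_order z z x \<noteq> tier_order z z y" "tier_order z z x \<noteq> tier_order z y x"
      "tier_order z z x \<noteq> tier_order y y z"
      by (rule tier_order_neqI[OF X3(1,2)], use distinct in \<open>simp add: tier_def\<close>)+
    show "tier_order z z y \<noteq> tier_order z y x" "tier_order z z y \<noteq> tier_order y y z"
      by (rule tier_order_neqI[OF X3(2,3)], use distinct in \<open>simp add: tier_def\<close>)+
    show "tier_order z y x \<noteq> tier_order y y z"
      by (rule tier_order_neqI[OF X3(3,2)], use distinct in \<open>simp add: tier_def\<close>)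
  qed (use disj in blast)+
  have "strictly_social m z x"
    by (rule unanimity[OF X3(3,1)]) (use X3 distinct in \<open>auto simp: strict_rel_def m tier_def\<close>)
  moreover have "strictly_social m x y"
    by (rule forcesD[OF f X3(1,2)]) (use X3 distinct in \<open>auto simp: strict_rel_def m tier_def\<close>)
  ultimately have "strictly_social m z y" by (rule strictly_social_trans(1))
  moreover have "(prefers F m v z y \<longleftrightarrow> prefers F i v z y) \<and> (prefers F m v y z \<longleftrightarrow> prefers F i v y z)"
    if v: "v \<epsilon> V" for v
    using i[of v] jk[OF v] prefers_total[OF v X3(3,2), of i] X3 distinct v
    by (auto simp: strict_rel_def m tier_def)
  ultimately show "strictly_social i z y"
    using independence[OF X3(3,2), of m i] by blast
qed

text \<open>For profiles with two values, \<open>x\<close> first or \<open>y\<close> first: the two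
  middle orders pad the prefix of the permutation to four distinct entries and are assigned to the
  empty set. The third alternative separates, for example, \<open>tier_order x x x\<close> from
  \<open>tier_order x x y\<close>.\<close>

lemma two_tier_orders_neq:
  "tier_order x x x \<noteq> tier_order x x y" "tier_order x x x \<noteq> tier_order y y x"
  "tier_order x x x \<noteq> tier_order y y y" "tier_order x x y \<noteq> tier_order y y x"
  "tier_order x x y \<noteq> tier_order y y y" "tier_order y y x \<noteq> tier_order y y y"
proof -
  show "tier_order x x x \<noteq> tier_order x x y"
    by (rule tier_order_neqI[OF X3(3,2)]) (use distinct in \<open>simp add: tier_def\<close>)
  show "tier_order y y x \<noteq> tier_order y y y"
    by (rule tier_order_neqI[OF X3(3,1)]) (use distinct in \<open>simp add: tier_def\<close>)
  show "tier_order x x x \<noteq> tier_order y y x" "tier_order x x x \<noteq> tier_order y y y"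
    "tier_order x x y \<noteq> tier_order y y x" "tier_order x x y \<noteq> tier_order y y y"
    by (rule tier_order_neqI[OF X3(1,2)], use distinct in \<open>simp add: tier_def\<close>)+
qed

lemma decisive_pair_forces:
  assumes "decisive_pair A F \<sigma> n x y"
  shows "forces n x y"
proof -
  obtain k where k: "\<And>v. \<not> elem v k" by (rule alg_empty) blast
  obtain m where m: "\<And>v a b. v \<epsilon> V \<Longrightarrow> a \<epsilon> X \<Longrightarrow> b \<epsilon> X \<Longrightarrow> prefers F m v a b \<longleftrightarrow>
    (if elem v n then tier x x x a \<le> tier x x x b
     else if elem v k then tier x x y a \<le> tier x x y b
     else if elem v k then tier y y x a \<le> tier y y x b
     else tier y y y a \<le> tier y y y b)"
    by (rule tier_profile[OF two_tier_orders_neq, of n k k]) (use k in blast)+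
  have p: "elem v n \<Longrightarrow> strictly m v x y" "\<not> elem v n \<Longrightarrow> strictly m v y x" if "v \<epsilon> V" for v
    using that X3 distinct k by (auto simp: strict_rel_def m tier_def)
  then have "strictly_social m x y"
    using assms elem_V unfolding decisive_pair_def strict_on_def by blast
  then show ?thesis unfolding forces_def using p by auto
qed

end

section \<open>Spread of forcing to all pairs\<close>

lemma another_alternative: obtains z where "z \<epsilon> X" "z \<noteq> x" "z \<noteq> y"
  by (rule three_alternatives) metis

lemma forces_right:
  assumes "x \<epsilon> X" "y \<epsilon> X" "z \<epsilon> X" "x \<noteq> y" "x \<noteq> z" "y \<noteq> z" "forces n x y"
  shows "forces n x z"
  using decisive_pair_forces[of x z y] forces_decisive_right[OF assms] assms by metis

lemma forces_left:
  assumes "x \<epsilon> X" "y \<epsilon> X" "z \<epsilon> X" "x \<noteq> y" "x \<noteq> z" "y \<noteq> z" "forces n x y"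
  shows "forces n z y"
  using decisive_pair_forces[of z y x] forces_decisive_left[OF assms] assms by metis

text \<open>With a third alternative the pair moves from (x, y) to (x, z), then (y, z), then (y, x),
  one end at a time.\<close>

lemma forces_swap:
  assumes "x \<epsilon> X" "y \<epsilon> X" "x \<noteq> y" "forces n x y"
  shows "forces n y x"
proof -
  obtain z where z: "z \<epsilon> X" "z \<noteq> x" "z \<noteq> y" by (rule another_alternative)
  have "forces n x z" using forces_right[of x y z n] assms z by blast
  then have "forces n y z" using forces_left[of x z y n] assms z by blast
  then show ?thesis using forces_right[of y z x n] assms z by blast
qed

text \<open>Replacing the right end and then the left end works unless the new right end is
  \<open>x\<close>, when the intermediate pair would be degenerate; in that case the pair is swapped
  first.\<close>

lemma forces_any:
  assumes "x \<epsilon> X" "y \<epsilon> X" "x \<noteq> y" "forces n x y" "a \<epsilon> X" "b \<epsilon> X" "a \<noteq> b"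
  shows "forces n a b"
proof -
  have right: "forces n x' b'" if "x' \<epsilon> X" "y' \<epsilon> X" "x' \<noteq> y'" "forces n x' y'" "b' \<epsilon> X" "b' \<noteq> x'"
    for x' y' b'
    using forces_right[of x' y' b' n] that by (cases "b' = y'") auto
  have left: "forces n a' y'" if "x' \<epsilon> X" "y' \<epsilon> X" "x' \<noteq> y'" "forces n x' y'" "a' \<epsilon> X" "a' \<noteq> y'"
    for x' y' a'
    using forces_left[of x' y' a' n] that by (cases "a' = x'") auto
  show ?thesis
  proof (cases "b = x")
    case False
    then have "forces n x b" using right[of x y b] assms by blast
    then show ?thesis using left[of x b a] assms False by blast
  next
    case True
    have "forces n y x" using forces_swap assms by blast
    then show ?thesis using left[of y x a] assms True by blast
  qed
qed

lemma forces_imp_decisive: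
  assumes x: "x \<epsilon> X" "y \<epsilon> X" "x \<noteq> y" "forces n x y"
  shows "decisive_set X A F \<sigma> n"
  unfolding decisive_set_def
proof (intro allI impI)
  fix a b assume ab: "a \<epsilon> X \<and> b \<epsilon> X"
  show "decisive_pair A F \<sigma> n a b"
  proof (cases "a = b")
    case False
    obtain z where z: "z \<epsilon> X" "z \<noteq> a" "z \<noteq> b" by (rule another_alternative)
    have "forces n a z" using forces_any[OF x] ab z by blast
    then show ?thesis using forces_decisive_right[of a z b n] ab z False by blast
  next
    case True
    \<comment> \<open>Decisiveness also speaks of the pair (a, a), where it holds vacuously once
      some voter belongs to the coalition. An empty coalition that forced \<open>x\<close> before
      \<open>y\<close> would contradict unanimity for \<open>y\<close> before
      \<open>x\<close>.\<close>
    have "\<exists>v. elem v n"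
    proof (rule ccontr)
      assume "\<nexists>v. elem v n"
      then obtain i where "strictly_social i x y" "\<And>v. v \<epsilon> V \<Longrightarrow> strictly i v y x"
        using x(4) unfolding forces_def by auto
      then show False using unanimity[OF x(2,1), of i] unfolding strict_rel_def by blast
    qed
    then show ?thesis
      unfolding decisive_pair_def strict_on_def strict_rel_def True by blast
  qed
qed

lemma decisive_iff_forces:
  assumes "x \<epsilon> X" "y \<epsilon> X" "x \<noteq> y"
  shows "decisive_set X A F \<sigma> n \<longleftrightarrow> forces n x y"
proof
  assume d: "decisive_set X A F \<sigma> n"
  obtain z where z: "z \<epsilon> X" "z \<noteq> x" "z \<noteq> y" by (rule another_alternative)
  show "forces n x y"
    using decisive_pair_forces[of x y z n] d assms z unfolding decisive_set_def by blast
qed (rule forces_imp_decisive[OF assms])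

text \<open>Membership in the ultrafilter is decided by the social ranking of \<open>x\<close> and \<open>y\<close> at one profile,
  which the embedding computes from the index of the set.\<close>

lemma decisive_sets_exist: "\<exists>U. \<forall>n. n \<epsilon> U \<longleftrightarrow> decisive_set X A F \<sigma> n"
proof -
  obtain x y z where X3: "x \<epsilon> X" "y \<epsilon> X" "z \<epsilon> X" and distinct: "x \<noteq> y" "x \<noteq> z" "y \<noteq> z"
    by (rule three_alternatives)
  obtain p where p: "starts_with p (tier_order x x x) (tier_order x x y) (tier_order y y x) (tier_order y y y)"
    by (rule starts_with_exists[OF tier_order tier_order tier_order tier_order two_tier_orders_neq[OF X3 distinct]])
  obtain k where k: "\<And>v. \<not> elem v k" by (rule alg_empty) blast
  \<comment> \<open>\<open>G\<close> is the graph of a computation: from the index \<open>n\<close>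
    to a quasi-partition \<open>s\<close>, the index \<open>m\<close> of a profile, and the social
    order \<open>r\<close> there. \<open>S\<close> reads the answer off \<open>r\<close>.\<close>
  define G where "G s m r n \<longleftrightarrow> is_seq4 s n k k k \<and> num_pair (num_pair p s) m \<epsilon> e \<and> num_pair m r \<epsilon> \<sigma>"
    for s m r n
  define S where "S r \<longleftrightarrow> in_cd (num_pair x y) r \<and> \<not> in_cd (num_pair y x) r" for r
  have G: "\<exists>s m r. G s m r n \<and> (\<forall>s' m' r'. G s' m' r' n \<longrightarrow> r' = r) \<and>
      (S r \<longleftrightarrow> decisive_set X A F \<sigma> n)" for n
  proof -
    obtain s where s: "is_seq4 s n k k k" using is_seq4_exists by blast
    obtain m where m: "num_pair (num_pair p s) m \<epsilon> e" "\<And>m'. num_pair (num_pair p s) m' \<epsilon> e \<Longrightarrow> m' = m"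
      by (rule embedding_defined[OF p s]) blast
    have f: "fun_cls (\<lambda>x. x \<epsilon> \<sigma>) (\<lambda>x. x = x) (weak_order_cd X)"
      using welfare welfare_function_def by blast
    then obtain r where r: "num_pair m r \<epsilon> \<sigma>" unfolding fun_cls_def by blast
    have r': "num_pair m r' \<epsilon> \<sigma> \<Longrightarrow> r' = r" for r'
      using f r unfolding fun_cls_def by blast
    have "social \<sigma> m a b \<longleftrightarrow> in_cd (num_pair a b) r" for a b
      unfolding social_def using r r' by blast
    then have S: "S r \<longleftrightarrow> strictly_social m x y" unfolding S_def strict_rel_def by simp
    have val: "elem v n \<Longrightarrow> strictly m v x y" "\<not> elem v n \<Longrightarrow> strictly m v y x" if "v \<epsilon> V" for v
    proof -
      have "prefers F m v a b \<longleftrightarrow> (if elem v n then tier x x x a \<le> tier x x x b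
          else tier y y y a \<le> tier y y y b)" if "a \<epsilon> X" "b \<epsilon> X" for a b
        using tier_profile_value[OF p s m(1) _ _ \<open>v \<epsilon> V\<close> that] k by simp
      then show "elem v n \<Longrightarrow> strictly m v x y" "\<not> elem v n \<Longrightarrow> strictly m v y x"
        using X3 distinct by (auto simp: strict_rel_def tier_def)
    qed
    have "strictly_social m x y \<longleftrightarrow> forces n x y"
    proof
      show "strictly_social m x y \<Longrightarrow> forces n x y" unfolding forces_def using val by auto
      show "forces n x y \<Longrightarrow> strictly_social m x y" using forcesD[of n x y m] X3 val by blast
    qed
    then have "S r \<longleftrightarrow> decisive_set X A F \<sigma> n"
      using S decisive_iff_forces[OF X3(1,2) distinct(1)] by blast
    moreover have "r' = r" if "G s' m' r' n" for s' m' r'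
    proof -
      have "s' = s" using that is_seq4_unique[OF s] unfolding G_def by metis
      then have "m' = m" using that m(2) unfolding G_def by blast
      then show ?thesis using that r' unfolding G_def by blast
    qed
    moreover have "G s m r n" unfolding G_def using s m(1) r by blast
    ultimately show ?thesis by blast
  qed
  \<comment> \<open>The computation exists and its result is unique, so some computation answers yes
    if and only if all do. With \<open>w\<close> bounding the three intermediate values these are a
    Sigma^0_1 and a Pi^0_1 form of the same condition.\<close>
  let ?P = "\<lambda>w n. \<exists>s. s \<preceq> w \<and> (\<exists>m. m \<preceq> w \<and> (\<exists>r. r \<preceq> w \<and> G s m r n \<and> S r))"
  let ?Q = "\<lambda>w n. \<forall>s. s \<preceq> w \<longrightarrow> (\<forall>m. m \<preceq> w \<longrightarrow> (\<forall>r. r \<preceq> w \<longrightarrow> G s m r n \<longrightarrow> S r))"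
  have P: "(\<exists>w. ?P w n) \<longleftrightarrow> decisive_set X A F \<sigma> n" for n
  proof
    assume "decisive_set X A F \<sigma> n"
    then obtain s m r where *: "G s m r n" "S r" using G[of n] by blast
    have "s \<preceq> s \<oplus> (m \<oplus> r)" "m \<preceq> s \<oplus> (m \<oplus> r)" "r \<preceq> s \<oplus> (m \<oplus> r)"
      using le_add(1) M.order_trans[OF le_add(1) le_add(2)] M.order_trans[OF le_add(2) le_add(2)] by auto
    then show "\<exists>w. ?P w n" using * by blast
  qed (use G[of n] in blast)
  have Q: "(\<forall>w. ?Q w n) \<longleftrightarrow> decisive_set X A F \<sigma> n" for n
  proof
    assume w: "\<forall>w. ?Q w n"
    obtain s m r where *: "G s m r n" "S r \<longleftrightarrow> decisive_set X A F \<sigma> n" using G[of n] by blast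
    have "s \<preceq> s \<oplus> (m \<oplus> r)" "m \<preceq> s \<oplus> (m \<oplus> r)" "r \<preceq> s \<oplus> (m \<oplus> r)"
      using le_add(1) M.order_trans[OF le_add(1) le_add(2)] M.order_trans[OF le_add(2) le_add(2)] by auto
    then show "decisive_set X A F \<sigma> n" using * w by blast
  qed (use G[of n] in blast)
  have "d0 (\<lambda>e. ?P (e 0) (e 1))" "d0 (\<lambda>e. ?Q (e 0) (e 1))"
    unfolding G_def S_def
    by (intro d0_intros d0_bex_le d0_ball_le d0_is_seq4 d0_in_cd d0_term_num_pair)+
  then have "\<exists>U. \<forall>n. n \<epsilon> U \<longleftrightarrow> (\<exists>w. ?P w n)"
    by (rule delta1_comprehension) (simp only: P Q)
  then show ?thesis unfolding P .
qed

section \<open>Ultrafilter axioms and principality\<close>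

lemma ultrafilter_decisive:
  assumes U: "\<And>n. n \<epsilon> U \<longleftrightarrow> decisive_set X A F \<sigma> n"
  shows "is_ultrafilter V A U"
  unfolding is_ultrafilter_def U
proof (intro conjI allI impI)
  obtain x y z where X3: "x \<epsilon> X" "y \<epsilon> X" "z \<epsilon> X" and distinct: "x \<noteq> y" "x \<noteq> z" "y \<noteq> z"
    by (rule three_alternatives)
  {
    fix i assume "\<forall>v. elem v i \<longleftrightarrow> v \<epsilon> V"
    then show "decisive_set X A F \<sigma> i"
      using unanimity unfolding decisive_set_def decisive_pair_def strict_on_def by simp
  next
    \<comment> \<open>The pair (x, x) refutes decisiveness: its hypothesis is vacuous on the empty
      set, but nothing is strictly before itself.\<close>
    fix i assume "\<forall>v. \<not> elem v i"
    then show "\<not> decisive_set X A F \<sigma> i"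
      using X3(1) unfolding decisive_set_def decisive_pair_def strict_on_def strict_rel_def by blast
  next
    fix i j assume "decisive_set X A F \<sigma> i \<and> (\<forall>v. elem v i \<longrightarrow> elem v j)"
    then show "decisive_set X A F \<sigma> j"
      unfolding decisive_set_def decisive_pair_def strict_on_def by blast
  next
    fix i j k
    assume ijk: "decisive_set X A F \<sigma> i \<and> decisive_set X A F \<sigma> j \<and>
      (\<forall>v. elem v k \<longleftrightarrow> elem v i \<and> elem v j)"
    obtain i' where i': "\<And>v. elem v i' \<longleftrightarrow> elem v i \<and> \<not> elem v j" by (rule alg_diff[of i j]) blast
    obtain j' where j': "\<And>v. elem v j' \<longleftrightarrow> elem v j \<and> \<not> elem v i" by (rule alg_diff[of j i]) blast
    \<comment> \<open>A Condorcet pattern. The orders are x < y < z on the intersection, z < x < y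
      on the rest of the first set, y < z < x on the rest of the second, and z < y < x elsewhere.
      The two sets enforce x < y and y < z, while x < z is held by the intersection alone.\<close>
    obtain m where m: "\<And>v a b. v \<epsilon> V \<Longrightarrow> a \<epsilon> X \<Longrightarrow> b \<epsilon> X \<Longrightarrow> prefers F m v a b \<longleftrightarrow>
      (if elem v k then tier x x y a \<le> tier x x y b
       else if elem v i' then tier z z x a \<le> tier z z x b
       else if elem v j' then tier y y z a \<le> tier y y z b
       else tier z z y a \<le> tier z z y b)"
    proof (rule tier_profile[of x x y z z x y y z z z y k i' j'])
      show "tier_order x x y \<noteq> tier_order z z x" "tier_order x x y \<noteq> tier_order y y z"
        "tier_order x x y \<noteq> tier_order z z y"
        by (rule tier_order_neqI[OF X3(1,3)], use distinct in \<open>simp add: tier_def\<close>)+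
      show "tier_order z z x \<noteq> tier_order y y z" "tier_order z z x \<noteq> tier_order z z y"
        by (rule tier_order_neqI[OF X3(1,2)], use distinct in \<open>simp add: tier_def\<close>)+
      show "tier_order y y z \<noteq> tier_order z z y"
        by (rule tier_order_neqI[OF X3(2,3)], use distinct in \<open>simp add: tier_def\<close>)
    qed (use ijk i' j' in blast)+
    have "strictly m v x y" if "elem v i" for v
      using that elem_V[OF that] ijk i' X3 distinct by (auto simp: strict_rel_def m tier_def)
    then have "strictly_social m x y"
      using ijk X3 unfolding decisive_set_def decisive_pair_def strict_on_def by blast
    moreover have "strictly m v y z" if "elem v j" for v
      using that elem_V[OF that] ijk i' j' X3 distinct by (auto simp: strict_rel_def m tier_def)
    then have "strictly_social m y z"
      using ijk X3 unfolding decisive_set_def decisive_pair_def strict_on_def by blast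
    ultimately have "strictly_social m x z" by (rule strictly_social_trans(1))
    moreover have "if elem v k then strictly m v x z else strictly m v z x" if "v \<epsilon> V" for v
      using that X3 distinct by (auto simp: strict_rel_def m tier_def)
    ultimately have "forces k x z" unfolding forces_def by blast
    then show "decisive_set X A F \<sigma> k" by (rule forces_imp_decisive[OF X3(1,3) distinct(2)])
  next
    fix i j assume ij: "\<forall>v. elem v j \<longleftrightarrow> v \<epsilon> V \<and> \<not> elem v i"
    show "decisive_set X A F \<sigma> i \<or> decisive_set X A F \<sigma> j"
    proof (cases "forces i x y")
      case True
      then show ?thesis using forces_imp_decisive[OF X3(1,2) distinct(1)] by blast
    next
      case False
      obtain k where k: "\<And>v. \<not> elem v k" by (rule alg_empty) blast
      \<comment> \<open>The order is x < z < y on the set and y < x < z on its complement. Since the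
        set does not force x < y, society ranks \<open>y\<close> weakly before \<open>x\<close>;
        with unanimous x < z this gives y < z, which the complement alone supports.\<close>
      obtain m where m: "\<And>v a b. v \<epsilon> V \<Longrightarrow> a \<epsilon> X \<Longrightarrow> b \<epsilon> X \<Longrightarrow> prefers F m v a b \<longleftrightarrow>
        (if elem v i then tier x x z a \<le> tier x x z b
         else if elem v k then tier x x x a \<le> tier x x x b
         else if elem v k then tier y y y a \<le> tier y y y b
         else tier y y x a \<le> tier y y x b)"
      proof (rule tier_profile[of x x z x x x y y y y y x i k k])
        show "tier_order x x z \<noteq> tier_order x x x"
          by (rule tier_order_neqI[OF X3(2,3)], use distinct in \<open>simp add: tier_def\<close>)
        show "tier_order x x z \<noteq> tier_order y y y" "tier_order x x z \<noteq> tier_order y y x"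
          "tier_order x x x \<noteq> tier_order y y y" "tier_order x x x \<noteq> tier_order y y x"
          by (rule tier_order_neqI[OF X3(1,2)], use distinct in \<open>simp add: tier_def\<close>)+
        show "tier_order y y y \<noteq> tier_order y y x"
          by (rule tier_order_neqI[OF X3(3,1)], use distinct in \<open>simp add: tier_def\<close>)
      qed (use k in blast)+
      have "if elem v i then strictly m v x y else strictly m v y x" if "v \<epsilon> V" for v
        using that k X3 distinct by (auto simp: strict_rel_def m tier_def)
      then have "\<not> strictly_social m x y" using False unfolding forces_def by blast
      then have "social \<sigma> m y x" using social_total[OF X3(1,2), of m] unfolding strict_rel_def by blast
      moreover have "strictly_social m x z"
        by (rule unanimity[OF X3(1,3)]) (use k X3 distinct in \<open>auto simp: strict_rel_def m tier_def\<close>)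
      ultimately have "strictly_social m y z" by (rule strictly_social_trans(2))
      moreover have "if elem v j then strictly m v y z else strictly m v z y" if "v \<epsilon> V" for v
        using that k ij X3 distinct by (auto simp: strict_rel_def m tier_def)
      ultimately have "forces j y z" unfolding forces_def by blast
      then show ?thesis using forces_imp_decisive[OF X3(2,3) distinct(3)] by blast
    qed
  }
qed

text \<open>A dictator is a voter whose singleton is decisive. Failure of
  \<open>dictator_free\<close> only excludes the opposite weak preference, which totality of the
  social order turns into a strict one; atomicity supplies an index for the singleton.\<close>

lemma principal_iff_dictatorial:
  assumes U: "\<And>n. n \<epsilon> U \<longleftrightarrow> decisive_set X A F \<sigma> n"
  shows "principal_uf A U \<longleftrightarrow> \<not> dictator_free V X F \<sigma>"
proof
  assume "principal_uf A U"
  then obtain k d where k: "decisive_set X A F \<sigma> k" "\<And>v. elem v k \<longleftrightarrow> v = d"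
    unfolding principal_uf_def U by blast
  have "d \<epsilon> V" using k(2) elem_V by blast
  moreover have "\<not> social \<sigma> i y x" if "x \<epsilon> X" "y \<epsilon> X" "strictly i d x y" for i x y
  proof -
    have "strictly_social i x y"
      using k(1) that unfolding decisive_set_def decisive_pair_def strict_on_def k(2) by simp
    then show ?thesis unfolding strict_rel_def by blast
  qed
  ultimately show "\<not> dictator_free V X F \<sigma>" unfolding dictator_free_def by blast
next
  assume "\<not> dictator_free V X F \<sigma>"
  then obtain d where d: "d \<epsilon> V"
    "\<And>i x y. x \<epsilon> X \<Longrightarrow> y \<epsilon> X \<Longrightarrow> strictly i d x y \<Longrightarrow> \<not> social \<sigma> i y x"
    unfolding dictator_free_def by blast
  have "is_atomic V A" using society society_def by blast
  then obtain k where k: "\<forall>v. elem v k \<longleftrightarrow> v = d"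
    using d(1) unfolding is_atomic_def by blast
  have "strictly_social i x y" if "x \<epsilon> X" "y \<epsilon> X" "strictly i d x y" for i x y
    using d(2)[OF that] social_total[OF that(1,2), of i] unfolding strict_rel_def by blast
  then have "decisive_set X A F \<sigma> k"
    using k unfolding decisive_set_def decisive_pair_def strict_on_def by blast
  then show "principal_uf A U" unfolding principal_uf_def U using k by blast
qed

end

theorem theorem4p4:
  shows "RCA0 \<turnstile> sentence
    (\<^bold>\<forall>\<^sub>S V X A F \<sigma>. countable_society V X A F \<^bold>\<and> social_welfare_function V X F \<sigma> \<^bold>\<longrightarrow>
      (\<^bold>\<exists>\<^sub>S U. (\<^bold>\<forall>i. i \<^bold>\<in> U \<^bold>\<longleftrightarrow> decisive X A F \<sigma> i) \<^bold>\<and>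
        ultrafilter V A U \<^bold>\<and>
        (is_principal A U \<^bold>\<longleftrightarrow> dictatorial V X F \<sigma>)))"
proof (rule completeness)
  show "basic_axioms \<subseteq> RCA0" unfolding RCA0_def by blast
next
  fix z o' :: nat and pl ti le and el :: "nat \<Rightarrow> nat \<Rightarrow> bool" and e f
  assume "\<And>p e f. p \<in> RCA0 \<Longrightarrow> l2_structure.sat z o' pl ti le el e f p"
  then interpret R: rca0_model z o' pl ti le el by unfold_locales
  show "R.sat e f (sentence
    (\<^bold>\<forall>\<^sub>S V X A F \<sigma>. countable_society V X A F \<^bold>\<and> social_welfare_function V X F \<sigma> \<^bold>\<longrightarrow>
      (\<^bold>\<exists>\<^sub>S U. (\<^bold>\<forall>i. i \<^bold>\<in> U \<^bold>\<longleftrightarrow> decisive X A F \<sigma> i) \<^bold>\<and>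
        ultrafilter V A U \<^bold>\<and>
        (is_principal A U \<^bold>\<longleftrightarrow> dictatorial V X F \<sigma>))))"
    unfolding R.sat_theorem
  proof (intro allI impI)
    fix V X A F \<sigma> assume *: "R.society V X A F \<and> R.welfare_function V X F \<sigma>"
    \<comment> \<open>One embedding is fixed here, since comprehension for the ultrafilter takes it
      as a set parameter.\<close>
    then obtain E where "R.embedding V X A F E" using R.society_def by blast
    then interpret S: social_model z o' pl ti le el V X A F E \<sigma> using * by unfold_locales auto
    obtain U where U: "\<And>n. el n U \<longleftrightarrow> R.decisive_set X A F \<sigma> n" using S.decisive_sets_exist by blast
    show "\<exists>U. (\<forall>i. el i U \<longleftrightarrow> R.decisive_set X A F \<sigma> i) \<and> R.is_ultrafilter V A U \<and>
        (R.principal_uf A U \<longleftrightarrow> \<not> R.dictator_free V X F \<sigma>)"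
      using U S.ultrafilter_decisive[OF U] S.principal_iff_dictatorial[OF U] by blast
  qed
qed

end
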